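(* Let $(X,S)$ be a minimal topological dynamical system with $X$ compact metric and acting group $\mathbb Z$, and let $d\ge2$ be an integer. Let $\pi:(X,S)\to(X_{d-1},S)$ be the extension to the maximal factor of order $d-1$. Then there are minimal systems $X'$, $X_{d-1}'$ and extensions $\theta':X'\to X$, $\pi':X'\to X_{d-1}'$, $\theta:X_{d-1}'\to X_{d-1}$ such that $\pi\circ\theta'=\theta\circ\pi'$, the extensions $\theta$ and $\theta'$ are almost one-to-one, and $$\boldsymbol Q^{[d]}(X')=({\pi'}^{[d]})^{-1}(\boldsymbol Q^{[d]}(X_{d-1}')),$$ where ${\pi'}^{[d]}:(X')^{[d]}\to(X'_{d-1})^{[d]}$ applies $\pi'$ in every coordinate.
   Context: Here $T=\mathbb Z$, generated by the homeomorphism $S$. A system is minimal if all orbits are dense. An extension is a continuous equivariant surjection. An extension $\phi:X\to Y$ is almost one-to-one if there is a dense $G_\delta$ set $X_0\subseteq X$ with $\phi^{-1}(\phi(x))=\{x\}$ for all $x\in X_0$. Cubes. $X^{[d]}=X^{2^d}$ has coordinates indexed by $\{0,1\}^d$ (equivalently subsets of $\{1,\dots,d\}$, $\emptyset\leftrightarrow(0,\dots,0)$); $x^{[d]}$ has all coordinates $x$. A facet of $\{0,1\}^d$ is a subset obtained by fixing the value of one coordinate; an upper facet is a facet containing $(1,\dots,1)$. For $t\in T$, $t^{(\alpha)}\in T^{[d]}$ has coordinate $t$ on $\alpha$ and the identity elsewhere. $\mathcal{HK}^{[d]}(T)$ (resp. $\mathcal F^{[d]}(T)$) is the subgroup of $T^{[d]}$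 generated by $t^{(\alpha)}$, $t\in T$, $\alpha$ a facet (resp. upper facet), acting coordinatewise on $X^{[d]}$. $\boldsymbol Q^{[d]}(X)=\overline{\{\mathbf t x^{[d]}:\mathbf t\in\mathcal{HK}^{[d]}(T),x\in X\}}\subseteq X^{[d]}$. Maximal factor of order $k$ ($k\ge1$). $(x,y)\in\mathbf{RP}^{[k]}(X)$ if there are nets $(\mathbf f_\lambda)$ in $\mathcal F^{[k]}(T)$, $(x_\lambda),(y_\lambda)$ in $X$, and $\mathbf a_*\in X^{2^k-1}$ with $(\mathbf f_\lambda x_\lambda^{[k]},\mathbf f_\lambda y_\lambda^{[k]})\to(x,\mathbf a_*,y,\mathbf a_* )$ (first coordinate of each block is the $\emptyset$-coordinate). For minimal $X$ this is a closed invariant equivalence relation; $X_k=X/\mathbf{RP}^{[k]}(X)$ is the maximal factor of order $k$, a system being of order $k$ if its $\mathbf{RP}^{[k]}$ is the diagonal. *)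

theory Defs
  imports "HOL-Analysis.Analysis" "HOL-Algebra.Product_Groups"
begin

section \<open>Systems with acting group the integers\<close>

text \<open>A system is a compact metrizable space together with a self-homeomorphism \<open>S\<close>. Only
  the values of \<open>S\<close> on the space matter, so negative powers use the inverse relative to it.\<close>

definition tds :: "'a topology \<Rightarrow> ('a \<Rightarrow> 'a) \<Rightarrow> bool" where
  "tds X S \<longleftrightarrow> compact_space X \<and> metrizable_space X \<and> homeomorphic_map X X S"

definition act :: "'a topology \<Rightarrow> ('a \<Rightarrow> 'a) \<Rightarrow> int \<Rightarrow> 'a \<Rightarrow> 'a" where
  "act X S n = (if 0 \<le> n then S ^^ nat n else inv_into (topspace X) S ^^ nat (- n))"

definition minimal_system :: "'a topology \<Rightarrow> ('a \<Rightarrow> 'a) \<Rightarrow> bool" where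
  "minimal_system X S \<longleftrightarrow>
     tds X S \<and> (\<forall>x \<in> topspace X. X closure_of (range (\<lambda>n. act X S n x)) = topspace X)"

definition extension ::
    "'a topology \<Rightarrow> ('a \<Rightarrow> 'a) \<Rightarrow> 'b topology \<Rightarrow> ('b \<Rightarrow> 'b) \<Rightarrow> ('a \<Rightarrow> 'b) \<Rightarrow> bool" where
  "extension X S Y R \<phi> \<longleftrightarrow>
     continuous_map X Y \<phi> \<and> \<phi> ` topspace X = topspace Y \<and>
     (\<forall>x \<in> topspace X. \<phi> (S x) = R (\<phi> x))"

definition almost_one_to_one :: "'a topology \<Rightarrow> ('a \<Rightarrow> 'b) \<Rightarrow> bool" where
  "almost_one_to_one X \<phi> \<longleftrightarrow>
     (\<exists>X0. gdelta_in X X0 \<and> X closure_of X0 = topspace X \<and>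
           (\<forall>x \<in> X0. {z \<in> topspace X. \<phi> z = \<phi> x} = {x}))"


section \<open>Cubes\<close>

text \<open>The vertices of the cube \<open>{0,1}\<^sup>d\<close> are identified with the subsets of \<open>{1..d}\<close>.\<close>

definition vertices :: "nat \<Rightarrow> nat set set" where
  "vertices d = Pow {1..d}"

definition facet :: "nat \<Rightarrow> nat set set \<Rightarrow> bool" where
  "facet d \<alpha> \<longleftrightarrow>
     (\<exists>i \<in> {1..d}. \<alpha> = {\<epsilon> \<in> vertices d. i \<in> \<epsilon>} \<or> \<alpha> = {\<epsilon> \<in> vertices d. i \<notin> \<epsilon>})"

definition upper_facet :: "nat \<Rightarrow> nat set set \<Rightarrow> bool" where
  "upper_facet d \<alpha> \<longleftrightarrow> facet d \<alpha> \<and> {1..d} \<in> \<alpha>"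

definition cube_group :: "nat \<Rightarrow> (nat set \<Rightarrow> int) monoid" where
  "cube_group d = product_group (vertices d) (\<lambda>_. integer_group)"

definition face_elt :: "nat \<Rightarrow> int \<Rightarrow> nat set set \<Rightarrow> nat set \<Rightarrow> int" where
  "face_elt d t \<alpha> = (\<lambda>\<epsilon> \<in> vertices d. if \<epsilon> \<in> \<alpha> then t else 0)"

definition HK :: "nat \<Rightarrow> (nat set \<Rightarrow> int) set" where
  "HK d = generate (cube_group d) {face_elt d t \<alpha> | t \<alpha>. facet d \<alpha>}"

definition FG :: "nat \<Rightarrow> (nat set \<Rightarrow> int) set" where
  "FG d = generate (cube_group d) {face_elt d t \<alpha> | t \<alpha>. upper_facet d \<alpha>}"

definition cube_space :: "'a topology \<Rightarrow> nat \<Rightarrow> (nat set \<Rightarrow> 'a) topology" where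
  "cube_space X d = product_topology (\<lambda>_. X) (vertices d)"

definition diag :: "nat \<Rightarrow> 'a \<Rightarrow> nat set \<Rightarrow> 'a" where
  "diag d x = (\<lambda>\<epsilon> \<in> vertices d. x)"

definition cube_act ::
    "'a topology \<Rightarrow> ('a \<Rightarrow> 'a) \<Rightarrow> nat \<Rightarrow> (nat set \<Rightarrow> int) \<Rightarrow> (nat set \<Rightarrow> 'a) \<Rightarrow> nat set \<Rightarrow> 'a" where
  "cube_act X S d f w = (\<lambda>\<epsilon> \<in> vertices d. act X S (f \<epsilon>) (w \<epsilon>))"

definition cube_map :: "nat \<Rightarrow> ('a \<Rightarrow> 'b) \<Rightarrow> (nat set \<Rightarrow> 'a) \<Rightarrow> nat set \<Rightarrow> 'b" where
  "cube_map d \<phi> w = (\<lambda>\<epsilon> \<in> vertices d. \<phi> (w \<epsilon>))"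

definition Q :: "'a topology \<Rightarrow> ('a \<Rightarrow> 'a) \<Rightarrow> nat \<Rightarrow> (nat set \<Rightarrow> 'a) set" where
  "Q X S d = cube_space X d closure_of
     {cube_act X S d t (diag d x) | t x. t \<in> HK d \<and> x \<in> topspace X}"


section \<open>The maximal factor of order k\<close>

text \<open>A net \<open>(f\<^sub>\<lambda>, x\<^sub>\<lambda>, y\<^sub>\<lambda>)\<close> is rendered, as usual in Isabelle/HOL, by a proper filter \<open>F\<close> on the
  set of triples: a net induces the filter generated by its tails, and conversely a proper
  filter is induced by a net. The point \<open>(x, a)\<close> of the cube, with \<open>x\<close> at the
  vertex \<open>\<emptyset>\<close>, is \<open>a({} := x)\<close>.\<close>

definition RP :: "'a topology \<Rightarrow> ('a \<Rightarrow> 'a) \<Rightarrow> nat \<Rightarrow> ('a \<times> 'a) set" where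
  "RP X S k = {(x, y). x \<in> topspace X \<and> y \<in> topspace X \<and>
     (\<exists>(F :: ((nat set \<Rightarrow> int) \<times> 'a \<times> 'a) filter)
        (a :: nat set \<Rightarrow> 'a).
        F \<noteq> bot \<and>
        (\<forall>\<^sub>F p in F. p \<in> FG k \<times> topspace X \<times> topspace X) \<and>
        a \<in> topspace (product_topology (\<lambda>_. X) (vertices k - {{}})) \<and>
        limitin (prod_topology (cube_space X k) (cube_space X k))
          (\<lambda>(f, u, v). (cube_act X S k f (diag k u), cube_act X S k f (diag k v)))
          (a({} := x), a({} := y)) F)}"

text \<open>The quotient of a space by a relation, on the set of classes.\<close>

definition quotient_space :: "'a topology \<Rightarrow> ('a \<times> 'a) set \<Rightarrow> 'a set topology" where
  "quotient_space X R = topology (\<lambda>U. U \<subseteq> topspace X // R \<and>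
     openin X {x \<in> topspace X. R `` {x} \<in> U})"

lemma openin_quotient_space:
  "openin (quotient_space X R) U \<longleftrightarrow>
     U \<subseteq> topspace X // R \<and> openin X {x \<in> topspace X. R `` {x} \<in> U}"
proof -
  let ?P = "\<lambda>U. {x \<in> topspace X. R `` {x} \<in> U}"
  have "istopology (\<lambda>U. U \<subseteq> topspace X // R \<and> openin X (?P U))"
    unfolding istopology_def
  proof (intro conjI allI impI)
    fix A B assume A: "A \<subseteq> topspace X // R \<and> openin X (?P A)"
      and B: "B \<subseteq> topspace X // R \<and> openin X (?P B)"
    have "?P (A \<inter> B) = ?P A \<inter> ?P B" by auto
    then show "openin X (?P (A \<inter> B))" using A B by auto
    show "A \<inter> B \<subseteq> topspace X // R" using A by auto
  next
    fix K assume K: "\<forall>A \<in> K. A \<subseteq> topspace X // R \<and> openin X (?P A)"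
    have "?P (\<Union>K) = (\<Union>A \<in> K. ?P A)" by auto
    then show "openin X (?P (\<Union>K))" using K by auto
    show "\<Union>K \<subseteq> topspace X // R" using K by auto
  qed
  then show ?thesis
    by (simp add: quotient_space_def topology_inverse')
qed

lemma quotient_map_quotient_space:
  "quotient_map X (quotient_space X R) (\<lambda>x. R `` {x})"
proof -
  have "{x \<in> topspace X. R `` {x} \<in> topspace X // R} = topspace X"
    by (auto simp: quotient_def)
  then have "openin (quotient_space X R) (topspace X // R)"
    by (simp add: openin_quotient_space)
  then have "topspace (quotient_space X R) = topspace X // R"
    using openin_quotient_space[of X R "topspace (quotient_space X R)"]
      openin_subset[of "quotient_space X R" "topspace X // R"] by simp
  then show ?thesis
    by (auto simp: quotient_map_def openin_quotient_space quotient_def)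
qed

text \<open>The induced homeomorphism of the factor sends a class \<open>C\<close> to the class \<open>S ` C\<close>.\<close>

definition max_factor :: "'a topology \<Rightarrow> ('a \<Rightarrow> 'a) \<Rightarrow> nat \<Rightarrow> 'a set topology" where
  "max_factor X S k = quotient_space X (RP X S k)"

definition max_factor_homeo :: "('a \<Rightarrow> 'a) \<Rightarrow> 'a set \<Rightarrow> 'a set" where
  "max_factor_homeo S C = S ` C"

definition max_factor_proj :: "'a topology \<Rightarrow> ('a \<Rightarrow> 'a) \<Rightarrow> nat \<Rightarrow> 'a \<Rightarrow> 'a set" where
  "max_factor_proj X S k x = RP X S k `` {x}"

end

theory Submission
  imports Defs
begin

text \<open>Let \<open>u\<close> be a minimal idempotent fixing \<open>x\<close>. Sending the exponents to \<open>u\<close> one after the other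
  shows that \<open>(id, u, \<dots>, u)\<close> lies in the enveloping semigroup of the face group, and sandwiching
  with it gives a group. An algebraic manipulation in this group shows that every element of the
  Host--Kra enveloping group which is trivial at the vertex \<open>\<emptyset>\<close> comes from the face group. Hence
  the face orbit closure of any cube based at \<open>x\<close> contains the diagonal cube; it follows that
  \<open>(x, y)\<close> is in \<open>RP\<close> of order \<open>d - 1\<close> iff \<open>(x, y, \<dots>, y)\<close> is a \<open>d\<close>-cube, and that \<open>RP\<close>
  is a closed equivalence relation.

  The map sending a point to its \<open>RP\<close> class is upper semicontinuous, so by Baire it is continuous on
  an invariant residual set \<open>Xc\<close> of classes. The closures of \<open>{(x, [x]) | x \<in> Xc}\<close> and of
  \<open>{[x] | x \<in> Xc}\<close> are almost one-to-one extensions of \<open>X\<close> and of its factor, and the map between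
  them is open. Openness allows one to change a single coordinate of a cube within its fibre, because
  \<open>(x, y, \<dots>, y)\<close> is a cube; changing all coordinates in turn gives saturation.\<close>

section \<open>Compact right topological semigroups\<close>

text \<open>The obstacle is that the classes of \<open>RP\<close> vary only upper semicontinuously:
  a point of a limit class need not be a limit of points of the nearby classes. A coordinate of a
  cube then cannot be moved inside its class with the approximating orbit points following it. In
  the modification a fibre consists of limits of generic classes, and convergence in
  \<open>Y'\<close> forces every point of the fibre to be approached from all nearby classes. An
  enveloping semigroup has no inverses of its own. Minimality of \<open>u\<close> is used in the
  form that no other idempotent is absorbed by \<open>u\<close> from both sides. This can be checked
  one vertex at a time, which makes \<open>U\<close> the identity of a group inside the cube
  semigroup. A cube with vertex x at \<open>{}\<close> is reached from the diagonal at x only with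
  the help of the diagonal shift, but the elements that move it back must fix the vertex
  \<open>{}\<close>. The shift is therefore treated as one more direction and then eliminated by
  linear substitutions of the exponents. Genericity is tested against saturated open sets, so the
  category argument takes place in the space of classes; density in \<open>K\<close> is then
  recovered from minimality.\<close>

lemma compact_imp_closed_Hausdorff:
  fixes S :: "'p::topological_space set"
  assumes "Hausdorff_space (euclidean :: 'p topology)" "compact S"
  shows "closed S"
  using assms compactin_imp_closedin[of "euclidean :: 'p topology" S] by simp

lemma Hausdorff_fun:
  assumes "Hausdorff_space (euclidean :: 'b::topological_space topology)"
  shows "Hausdorff_space (euclidean :: ('a \<Rightarrow> 'b) topology)"
  using assms Hausdorff_space_product_topology[of "\<lambda>_. euclidean :: 'b topology" "UNIV :: 'a set"]
  by (simp add: euclidean_product_topology)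

lemma compact_PiE_UNIV:
  fixes S :: "'i \<Rightarrow> 'b::topological_space set"
  assumes "\<And>i. compact (S i)"
  shows "compact (PiE UNIV S)"
  using assms compactin_PiE[of "\<lambda>_. euclidean" UNIV S] by (simp add: euclidean_product_topology)

text \<open>Compactness keeps the intersection of a chain nonempty, so Zorn's lemma applies. Since
  \<open>P\<close> is only required to be stable under intersections, the same statement yields
  minimal closed subsemigroups and minimal closed left ideals.\<close>

lemma compact_minimal_subset:
  fixes S :: "'p::topological_space set"
  assumes H: "Hausdorff_space (euclidean :: 'p topology)" and S: "compact S" "S \<noteq> {}" "P S"
    and Inter: "\<And>C. C \<noteq> {} \<Longrightarrow> (\<And>A. A \<in> C \<Longrightarrow> P A) \<Longrightarrow> P (\<Inter>C)"
  obtains A where "A \<subseteq> S" "compact A" "A \<noteq> {}" "P A"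
    "\<And>B. B \<subseteq> A \<Longrightarrow> compact B \<Longrightarrow> B \<noteq> {} \<Longrightarrow> P B \<Longrightarrow> B = A"
proof -
  define F where "F = {A. A \<subseteq> S \<and> compact A \<and> A \<noteq> {} \<and> P A}"
  \<comment> \<open>Complements are taken because this form of Zorn's lemma produces maximal
    sets.\<close>
  have "\<exists>M\<in>uminus ` F. \<forall>X\<in>uminus ` F. M \<subseteq> X \<longrightarrow> X = M"
  proof (rule subset_Zorn_nonempty)
    show "uminus ` F \<noteq> {}" using S by (auto simp: F_def)
    fix C assume C0: "C \<noteq> {}" and C: "subset.chain (uminus ` F) C"
    define D where "D = uminus ` C"
    have Csub: "C \<subseteq> uminus ` F" and Cch: "\<And>A B. A \<in> C \<Longrightarrow> B \<in> C \<Longrightarrow> A \<subseteq> B \<or> B \<subseteq> A"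
      using C by (auto simp: subset_chain_def)
    have D: "D \<noteq> {}" "D \<subseteq> F" "\<And>A B. A \<in> D \<Longrightarrow> B \<in> D \<Longrightarrow> A \<subseteq> B \<or> B \<subseteq> A"
      using C0 Csub Cch unfolding D_def by (force, force, blast)
    have cl: "closed A" if "A \<in> D" for A
      using D(2) that by (auto simp: F_def compact_imp_closed_Hausdorff[OF H])
    have fin: "\<exists>A\<in>B. \<Inter>B = A" if "finite B" "B \<noteq> {}" "B \<subseteq> D" for B
      using that
    proof (induction B rule: finite_ne_induct)
      case (insert x B)
      then obtain A where "A \<in> B" "\<Inter>B = A" by auto
      moreover have "\<Inter>(insert x B) = x \<inter> A" using \<open>\<Inter>B = A\<close> by simp
      moreover have "x \<inter> A = x \<or> x \<inter> A = A" using insert D(3)[of x A] \<open>A \<in> B\<close> by blast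
      ultimately show ?case by auto
    qed auto
    have ne: "\<Inter>D \<noteq> {}"
    proof -
      obtain A0 where A0: "A0 \<in> D" using D by auto
      have "A0 \<inter> \<Inter>D \<noteq> {}"
      proof (rule compact_imp_fip)
        show "compact A0" using A0 D by (auto simp: F_def)
        show "\<And>T. T \<in> D \<Longrightarrow> closed T" by (rule cl)
        fix B assume B: "finite B" "B \<subseteq> D"
        have "\<exists>A\<in>insert A0 B. \<Inter>(insert A0 B) = A" by (rule fin) (use B A0 in auto)
        then show "A0 \<inter> \<Inter>B \<noteq> {}" using B A0 D(2) by (auto simp: F_def)
      qed
      then show ?thesis by auto
    qed
    have "\<Inter>D \<in> F"
    proof -
      obtain A0 where A0: "A0 \<in> D" using D by auto
      have "compact (A0 \<inter> \<Inter>D)" using A0 D cl by (intro compact_Int_closed) (auto simp: F_def)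
      moreover have "A0 \<inter> \<Inter>D = \<Inter>D" using A0 by auto
      moreover have "P (\<Inter>D)" using D by (intro Inter) (auto simp: F_def)
      moreover have "A0 \<subseteq> S" using A0 D(2) by (auto simp: F_def)
      then have "\<Inter>D \<subseteq> S" using A0 by blast
      ultimately show ?thesis using ne by (simp add: F_def)
    qed
    then show "\<Union>C \<in> uminus ` F"
      by (auto simp: D_def image_iff intro!: bexI[of _ "\<Inter>D"])
  qed
  then obtain A where "A \<in> F" and m: "\<And>B. B \<in> F \<Longrightarrow> - A \<subseteq> - B \<Longrightarrow> - B = - A" by auto
  then have "A \<subseteq> S" "compact A" "A \<noteq> {}" "P A" by (auto simp: F_def)
  moreover have "B = A" if "B \<subseteq> A" "compact B" "B \<noteq> {}" "P B" for B
    using m[of B] that \<open>A \<subseteq> S\<close> by (auto simp: F_def)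
  ultimately show ?thesis by (rule that)
qed

locale right_top_semigroup =
  fixes S :: "'p::topological_space set" and m :: "'p \<Rightarrow> 'p \<Rightarrow> 'p" (infixl \<open>\<odot>\<close> 70)
  assumes Hausdorff: "Hausdorff_space (euclidean :: 'p topology)"
    and compact: "compact S" and nonempty: "S \<noteq> {}"
    and closed: "p \<in> S \<Longrightarrow> q \<in> S \<Longrightarrow> p \<odot> q \<in> S"
    and assoc: "p \<odot> q \<odot> r = p \<odot> (q \<odot> r)"
    and cont: "q \<in> S \<Longrightarrow> continuous_on S (\<lambda>p. p \<odot> q)"
begin

text \<open>The Ellis-Numakura argument. In a minimal closed subsemigroup \<open>A\<close> the set
  \<open>A \<odot> e\<close> is again a closed subsemigroup, hence all of \<open>A\<close>. So some
  p satisfies \<open>p \<odot> e = e\<close>, and the closed subsemigroup of all such p is again all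
  of \<open>A\<close>; in particular it contains \<open>e\<close>.\<close>

lemma idempotent:
  assumes "T \<subseteq> S" "compact T" "T \<noteq> {}" "\<And>p q. p \<in> T \<Longrightarrow> q \<in> T \<Longrightarrow> p \<odot> q \<in> T"
  obtains e where "e \<in> T" "e \<odot> e = e"
proof -
  obtain A where A: "A \<subseteq> T" "compact A" "A \<noteq> {}" "\<forall>p\<in>A. \<forall>q\<in>A. p \<odot> q \<in> A"
    and min: "\<And>B. B \<subseteq> A \<Longrightarrow> compact B \<Longrightarrow> B \<noteq> {} \<Longrightarrow> \<forall>p\<in>B. \<forall>q\<in>B. p \<odot> q \<in> B \<Longrightarrow> B = A"
    by (rule compact_minimal_subset[OF Hausdorff, of T "\<lambda>A. \<forall>p\<in>A. \<forall>q\<in>A. p \<odot> q \<in> A"]) (use assms in auto)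
  obtain e where e: "e \<in> A" using A by auto
  have ce: "continuous_on A (\<lambda>p. p \<odot> e)"
    by (rule continuous_on_subset[OF cont]) (use e A assms in auto)
  have "(\<lambda>p. p \<odot> e) ` A = A"
  proof (rule min)
    show "(\<lambda>p. p \<odot> e) ` A \<subseteq> A" using A e by auto
    show "compact ((\<lambda>p. p \<odot> e) ` A)" using ce A compact_continuous_image by blast
    show "(\<lambda>p. p \<odot> e) ` A \<noteq> {}" using A by auto
    show "\<forall>p\<in>(\<lambda>p. p \<odot> e) ` A. \<forall>q\<in>(\<lambda>p. p \<odot> e) ` A. p \<odot> q \<in> (\<lambda>p. p \<odot> e) ` A"
    proof safe
      fix p q assume "p \<in> A" "q \<in> A"
      then have "p \<odot> e \<odot> q \<in> A" using A e by auto
      moreover have "p \<odot> e \<odot> (q \<odot> e) = p \<odot> e \<odot> q \<odot> e" by (simp add: assoc)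
      ultimately show "p \<odot> e \<odot> (q \<odot> e) \<in> (\<lambda>p. p \<odot> e) ` A" by blast
    qed
  qed
  then have ex: "\<exists>p\<in>A. p \<odot> e = e" using e by (metis image_iff)
  define B where "B = {p \<in> A. p \<odot> e = e}"
  have "B = A"
  proof (rule min)
    show "B \<subseteq> A" "B \<noteq> {}" using ex by (auto simp: B_def)
    have "closed B" unfolding B_def
      using continuous_closed_preimage[OF ce compact_imp_closed_Hausdorff[OF Hausdorff A(2)], of "{e}"]
        compact_imp_closed_Hausdorff[OF Hausdorff, of "{e}"]
      by (simp add: vimage_def Int_def)
    then have "compact (A \<inter> B)" using A(2) by (rule compact_Int_closed[rotated])
    moreover have "A \<inter> B = B" by (auto simp: B_def)
    ultimately show "compact B" by simp
    show "\<forall>p\<in>B. \<forall>q\<in>B. p \<odot> q \<in> B" using A by (auto simp: B_def assoc)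
  qed
  then have "e \<odot> e = e" using e by (auto simp: B_def)
  then show ?thesis using that e A by blast
qed

text \<open>For q in a minimal closed left ideal the translate of \<open>S\<close> by q is a closed
  left ideal inside it, hence equal to it. This is the left divisibility in the last
  conclusion.\<close>

lemma minimal_left_ideal:
  obtains L where "L \<subseteq> S" "compact L" "L \<noteq> {}" "\<forall>p\<in>S. \<forall>q\<in>L. p \<odot> q \<in> L"
    "\<forall>q\<in>L. \<forall>r\<in>L. \<exists>p\<in>S. p \<odot> q = r"
proof -
  obtain A where A: "A \<subseteq> S" "compact A" "A \<noteq> {}" "\<forall>p\<in>S. \<forall>q\<in>A. p \<odot> q \<in> A"
    and min: "\<And>B. B \<subseteq> A \<Longrightarrow> compact B \<Longrightarrow> B \<noteq> {} \<Longrightarrow> \<forall>p\<in>S. \<forall>q\<in>B. p \<odot> q \<in> B \<Longrightarrow> B = A"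
    by (rule compact_minimal_subset[OF Hausdorff, of S "\<lambda>A. \<forall>p\<in>S. \<forall>q\<in>A. p \<odot> q \<in> A"])
      (use compact nonempty closed in auto)
  have orbit: "(\<lambda>p. p \<odot> q) ` S = A" if q: "q \<in> A" for q
  proof (rule min)
    show "(\<lambda>p. p \<odot> q) ` S \<subseteq> A" using A q by auto
    show "compact ((\<lambda>p. p \<odot> q) ` S)"
      using cont[of q] A q compact compact_continuous_image by blast
    show "(\<lambda>p. p \<odot> q) ` S \<noteq> {}" using nonempty by auto
    show "\<forall>p\<in>S. \<forall>r\<in>(\<lambda>p. p \<odot> q) ` S. p \<odot> r \<in> (\<lambda>p. p \<odot> q) ` S"
      by (auto simp: closed simp flip: assoc)
  qed
  have "\<exists>p\<in>S. p \<odot> q = r" if "q \<in> A" "r \<in> A" for q r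
  proof -
    have "r \<in> (\<lambda>p. p \<odot> q) ` S" using orbit[OF that(1)] that(2) by simp
    then show ?thesis by auto
  qed
  then have "\<forall>q\<in>A. \<forall>r\<in>A. \<exists>p\<in>S. p \<odot> q = r" by simp
  then show ?thesis by (rule that[OF A])
qed

text \<open>The compact semigroup of all \<open>g \<odot> p\<close> contains an idempotent
  \<open>v\<close>, and \<open>e \<odot> v\<close> is an idempotent absorbed by \<open>e\<close> on
  both sides, hence \<open>e\<close> itself. So \<open>e \<odot> g \<odot> e\<close> is a left
  inverse. It has a left inverse in turn, and the usual group computation identifies that one with
  \<open>p\<close>.\<close>

lemma inverse_if_unique_idempotent:
  assumes e: "e \<in> S" "e \<odot> e = e"
    and uniq: "\<And>w. w \<in> S \<Longrightarrow> e \<odot> w = w \<Longrightarrow> w \<odot> e = w \<Longrightarrow> w \<odot> w = w \<Longrightarrow> w = e"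
    and p: "p \<in> S" "e \<odot> p = p" "p \<odot> e = p"
  obtains g where "g \<in> S" "e \<odot> g = g" "g \<odot> e = g" "g \<odot> p = e" "p \<odot> g = e"
proof -
  have left: "\<exists>g\<in>S. e \<odot> g = g \<and> g \<odot> e = g \<and> g \<odot> p = e"
    if p: "p \<in> S" "e \<odot> p = p" "p \<odot> e = p" for p
  proof -
    obtain v where v: "v \<in> (\<lambda>g. g \<odot> p) ` S" "v \<odot> v = v"
    proof (rule idempotent)
      show "(\<lambda>g. g \<odot> p) ` S \<subseteq> S" using p closed by auto
      show "compact ((\<lambda>g. g \<odot> p) ` S)" using cont p compact compact_continuous_image by blast
      show "(\<lambda>g. g \<odot> p) ` S \<noteq> {}" using nonempty by auto
      fix x y assume "x \<in> (\<lambda>g. g \<odot> p) ` S" "y \<in> (\<lambda>g. g \<odot> p) ` S"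
      then obtain g h where "g \<in> S" "h \<in> S" "x = g \<odot> p" "y = h \<odot> p" by auto
      then have "x \<odot> y = g \<odot> p \<odot> h \<odot> p" "g \<odot> p \<odot> h \<in> S" using p closed by (auto simp: assoc)
      then show "x \<odot> y \<in> (\<lambda>g. g \<odot> p) ` S" by blast
    qed
    then obtain g where g: "g \<in> S" "v = g \<odot> p" by auto
    have ve: "v \<odot> e = v" using g p by (simp add: assoc)
    have "e \<odot> v = e"
    proof (rule uniq)
      show "e \<odot> v \<in> S" using e g p closed by auto
      show "e \<odot> (e \<odot> v) = e \<odot> v" using e by (simp flip: assoc)
      show "e \<odot> v \<odot> e = e \<odot> v" using ve by (simp add: assoc)
      have "e \<odot> v \<odot> (e \<odot> v) = e \<odot> ((v \<odot> e) \<odot> v)" by (simp add: assoc)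
      then show "e \<odot> v \<odot> (e \<odot> v) = e \<odot> v" using ve v by simp
    qed
    then have "e \<odot> g \<odot> p = e" using g by (simp add: assoc)
    then have "e \<odot> g \<odot> e \<odot> p = e" using p(2) by (simp add: assoc)
    moreover have "e \<odot> (e \<odot> g \<odot> e) = e \<odot> g \<odot> e" using e by (simp flip: assoc)
    moreover have "e \<odot> g \<odot> e \<odot> e = e \<odot> g \<odot> e" using e by (simp add: assoc)
    ultimately show ?thesis using e g closed by (intro bexI[of _ "e \<odot> g \<odot> e"]) auto
  qed
  obtain g where g: "g \<in> S" "e \<odot> g = g" "g \<odot> e = g" "g \<odot> p = e" using left[OF p] by auto
  obtain h where h: "e \<odot> h = h" "h \<odot> e = h" "h \<odot> g = e" using left[OF g(1-3)] by auto
  have "h = h \<odot> (g \<odot> p)" using g h by simp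
  also have "\<dots> = p" using h p by (simp flip: assoc)
  finally have "h = p" .
  then show ?thesis using that[of g] g h by auto
qed

end

section \<open>Enveloping semigroups of actions of the integers\<close>

text \<open>The exponent at vertex \<epsilon> of the face group element with exponent
  \<open>n i\<close> in direction i. All sets of naturals are allowed as vertices, so that a single
  semigroup serves every dimension and leaves room for an auxiliary direction.\<close>

definition lin :: "(nat \<Rightarrow> int) \<Rightarrow> nat set \<Rightarrow> int" where
  "lin n \<epsilon> = (\<Sum>i\<in>\<epsilon>. n i)"

lemma lin_empty [simp]: "lin n {} = 0" by (simp add: lin_def)
lemma lin_infinite [simp]: "infinite \<epsilon> \<Longrightarrow> lin n \<epsilon> = 0" by (simp add: lin_def)
lemma lin_add: "lin (\<lambda>i. m i + n i) \<epsilon> = lin m \<epsilon> + lin n \<epsilon>"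
  by (simp add: lin_def sum.distrib)
lemma lin_minus: "lin (\<lambda>i. - n i) \<epsilon> = - lin n \<epsilon>"
  by (simp add: lin_def sum_negf)
lemma lin_insert: "finite \<epsilon> \<Longrightarrow> i \<notin> \<epsilon> \<Longrightarrow> lin n (insert i \<epsilon>) = n i + lin n \<epsilon>"
  by (simp add: lin_def)
lemma lin_cong: "(\<And>i. i \<in> \<epsilon> \<Longrightarrow> m i = n i) \<Longrightarrow> lin m \<epsilon> = lin n \<epsilon>"
  by (simp add: lin_def)
lemma lin_zero: "lin (\<lambda>_. 0) \<epsilon> = 0" by (simp add: lin_def)

text \<open>The maps are the identity off \<open>K\<close>, so the action laws hold on the whole
  type and the enveloping semigroup can live in the full function space rather than among functions
  on \<open>K\<close>.\<close>

locale zflow =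
  fixes K :: "'m::metric_space set" and a :: "int \<Rightarrow> 'm \<Rightarrow> 'm"
  assumes compact_K: "compact K"
    and a_cont: "continuous_on K (a n)"
    and a_in: "x \<in> K \<Longrightarrow> a n x \<in> K"
    and a_out: "x \<notin> K \<Longrightarrow> a n x = x"
    and a_0: "a 0 x = x"
    and a_add: "a (k + n) x = a k (a n x)"
begin

definition pcomp :: "('i \<Rightarrow> 'm \<Rightarrow> 'm) \<Rightarrow> ('i \<Rightarrow> 'm \<Rightarrow> 'm) \<Rightarrow> 'i \<Rightarrow> 'm \<Rightarrow> 'm" (infixl \<open>\<odot>\<close> 70) where
  "p \<odot> q = (\<lambda>i x. p i (q i x))"

lemma pcomp_assoc: "p \<odot> q \<odot> r = p \<odot> (q \<odot> r)" by (simp add: pcomp_def)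

text \<open>The enveloping semigroup of a family of powers, indexed by \<open>G\<close>, acting on a product of
  copies of \<open>K\<close>.\<close>

definition env :: "('i \<Rightarrow> int) set \<Rightarrow> ('i \<Rightarrow> 'm \<Rightarrow> 'm) set" where
  "env G = closure ((\<lambda>f i. a (f i)) ` G)"

text \<open>A Tychonoff product of copies of \<open>K\<close> and of singletons: the compact space
  that contains every enveloping semigroup.\<close>

definition box :: "('i \<Rightarrow> 'm \<Rightarrow> 'm) set" where
  "box = {p. \<forall>i x. p i x \<in> (if x \<in> K then K else {x})}"

lemma compact_box: "compact (box :: ('i \<Rightarrow> 'm \<Rightarrow> 'm) set)"
proof -
  have "compact (PiE UNIV (\<lambda>i::'i. PiE UNIV (\<lambda>x. if x \<in> K then K else {x})))"
    by (intro compact_PiE_UNIV) (auto simp: compact_K)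
  moreover have "PiE UNIV (\<lambda>i::'i. PiE UNIV (\<lambda>x. if x \<in> K then K else {x})) = box"
    by (auto simp: box_def PiE_def Pi_def)
  ultimately show ?thesis by simp
qed

lemma gen_in_box: "(\<lambda>i. a (f i)) \<in> box" by (auto simp: box_def a_in a_out)

lemma Hausdorff_env: "Hausdorff_space (euclidean :: ('i \<Rightarrow> 'm \<Rightarrow> 'm) topology)"
  by (intro Hausdorff_fun) (simp add: Hausdorff_space_euclidean)

lemma env_subset_box: "env G \<subseteq> box"
  unfolding env_def
proof (rule closure_minimal)
  show "closed box" by (rule compact_imp_closed_Hausdorff[OF Hausdorff_env compact_box])
  show "(\<lambda>f i. a (f i)) ` G \<subseteq> box" using gen_in_box by blast
qed

lemma env_box:
  assumes "p \<in> env G"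
  shows "p i x \<in> (if x \<in> K then K else {x})"
proof -
  have "p \<in> box" using env_subset_box[of G] assms by (rule subsetD)
  then show ?thesis by (simp add: box_def)
qed

lemma env_K: "p \<in> env G \<Longrightarrow> x \<in> K \<Longrightarrow> p i x \<in> K"
  and env_out: "p \<in> env G \<Longrightarrow> x \<notin> K \<Longrightarrow> p i x = x"
  using env_box[of p G i x] by (auto split: if_splits)

lemma compact_env: "compact (env G)"
proof -
  have "compact (box \<inter> env G)" by (rule compact_Int_closed[OF compact_box]) (simp add: env_def)
  then show ?thesis using env_subset_box[of G] by (simp add: Int_absorb1)
qed

lemma gen_in_env: "f \<in> G \<Longrightarrow> (\<lambda>i. a (f i)) \<in> env G"
  unfolding env_def by (rule closure_subset[THEN subsetD]) (rule imageI)

lemma continuous_eval: "continuous_on S (\<lambda>p :: 'i \<Rightarrow> 'j \<Rightarrow> 'b::topological_space. p i x)"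
  by (rule continuous_on_product_then_coordinatewise[OF
        continuous_on_product_then_coordinatewise[OF continuous_on_id]])

text \<open>In the topology of pointwise convergence a right translation merely changes the point of
  evaluation, so it is continuous for every \<open>q\<close>. A left translation is continuous only
  if the left factor consists of continuous maps, which is why \<open>env_comp\<close> treats
  generators on the left first.\<close>

lemma continuous_comp_right: "continuous_on S (\<lambda>p. p \<odot> q)"
  unfolding pcomp_def
  by (rule continuous_on_coordinatewise_then_product,
      rule continuous_on_coordinatewise_then_product, rule continuous_eval)

lemma env_comp:
  assumes G: "\<And>f g. f \<in> G \<Longrightarrow> g \<in> G \<Longrightarrow> (\<lambda>i. f i + g i) \<in> G"
    and p: "p \<in> env G" and q: "q \<in> env G"
  shows "p \<odot> q \<in> env G"
proof -
  have left: "(\<lambda>i. a (f i)) \<odot> r \<in> env G" if f: "f \<in> G" and r: "r \<in> env G" for f r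
  proof -
    \<comment> \<open>Left translation by a generator, made constant off \<open>K\<close> because
      \<open>a\<close> is known to be continuous only on \<open>K\<close>. On \<open>env G\<close>
      the two agree.\<close>
    let ?h = "\<lambda>r i x. if x \<in> K then a (f i) (r i x) else x"
    have "continuous_on box ?h"
    proof (rule continuous_on_coordinatewise_then_product, rule continuous_on_coordinatewise_then_product)
      fix i x
      show "continuous_on box (\<lambda>r. if x \<in> K then a (f i) (r i x) else x)"
      proof (cases "x \<in> K")
        case True
        have "continuous_on box (\<lambda>r. a (f i) (r i x))"
          by (rule continuous_on_compose2[OF a_cont continuous_eval]) (use True in \<open>auto simp: box_def\<close>)
        then show ?thesis using True by simp
      qed simp
    qed
    then have "continuous_on (env G) ?h" using env_subset_box[of G] by (rule continuous_on_subset)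
    then have "?h ` closure ((\<lambda>f i. a (f i)) ` G) \<subseteq> env G"
    proof (intro image_closure_subset)
      show "closed (env G)" by (simp add: env_def)
      show "?h ` (\<lambda>f i. a (f i)) ` G \<subseteq> env G"
      proof safe
        fix g assume g: "g \<in> G"
        have "?h (\<lambda>i. a (g i)) = (\<lambda>i. a (f i + g i))"
          by (auto simp: fun_eq_iff a_add a_out)
        then show "?h (\<lambda>i. a (g i)) \<in> env G" using gen_in_env[OF G[OF f g]] by simp
      qed
    qed (simp add: env_def)
    moreover have "?h r = (\<lambda>i. a (f i)) \<odot> r"
      using env_out[OF r] by (auto simp: pcomp_def fun_eq_iff a_out)
    ultimately show ?thesis using r by (auto simp: env_def)
  qed
  have "(\<lambda>p. p \<odot> q) ` closure ((\<lambda>f i. a (f i)) ` G) \<subseteq> env G"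
    by (intro image_closure_subset continuous_comp_right) (use left q in \<open>auto simp: env_def\<close>)
  then show ?thesis using p by (auto simp: env_def)
qed

lemma env_semigroup:
  assumes "\<And>f g. f \<in> G \<Longrightarrow> g \<in> G \<Longrightarrow> (\<lambda>i. f i + g i) \<in> G" "G \<noteq> {}"
  shows "right_top_semigroup (env G) (\<odot>)"
proof
  show "env G \<noteq> {}" using assms gen_in_env by (metis empty_iff equals0I)
qed (auto simp: Hausdorff_env compact_env env_comp assms pcomp_assoc continuous_comp_right)

text \<open>The vertices are finite sets of naturals. The indices \<open>1..d\<close> are the directions of the cube
  and the index \<open>0\<close> carries the diagonal shift of the Host--Kra group; on infinite sets \<open>lin\<close> is \<open>0\<close>.\<close>

abbreviation E :: "(nat set \<Rightarrow> 'm \<Rightarrow> 'm) set" where "E \<equiv> env (range lin)"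
abbreviation E1 :: "(unit \<Rightarrow> 'm \<Rightarrow> 'm) set" where "E1 \<equiv> env UNIV"

lemma range_lin_add: "f \<in> range lin \<Longrightarrow> g \<in> range lin \<Longrightarrow> (\<lambda>\<epsilon>. f \<epsilon> + g \<epsilon>) \<in> range lin"
  by (auto simp: fun_eq_iff image_iff simp flip: lin_add)

sublocale E: right_top_semigroup E "(\<odot>)"
  by (rule env_semigroup[OF range_lin_add]) auto

sublocale E1: right_top_semigroup E1 "(\<odot>)"
  by (rule env_semigroup) auto

lemma env_reindex:
  assumes p: "p \<in> env G" and gen: "\<And>f. f \<in> G \<Longrightarrow> (\<lambda>i. f (\<tau> i)) \<in> H"
  shows "(\<lambda>i. p (\<tau> i)) \<in> env H"
proof -
  have "(\<lambda>p i. p (\<tau> i)) ` closure ((\<lambda>f i. a (f i)) ` G) \<subseteq> env H"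
  proof (intro image_closure_subset)
    show "continuous_on (closure ((\<lambda>f i. a (f i)) ` G)) (\<lambda>p i. p (\<tau> i))"
      by (rule continuous_on_coordinatewise_then_product)
        (rule continuous_on_product_then_coordinatewise[OF continuous_on_id])
    show "(\<lambda>p i. p (\<tau> i)) ` (\<lambda>f i. a (f i)) ` G \<subseteq> env H"
      using gen gen_in_env by fastforce
  qed (simp add: env_def)
  then show ?thesis using p by (auto simp: env_def)
qed

text \<open>A linear substitution of the exponents acts on linear forms as a pullback along \<tau>.
  Pulling back coordinates is continuous, so the substitution extends from the generators to the
  closure.\<close>

lemma E_reindex:
  assumes "p \<in> E" "\<And>n \<epsilon>. lin (\<phi> n) \<epsilon> = lin n (\<tau> \<epsilon>)"
  shows "(\<lambda>\<epsilon>. p (\<tau> \<epsilon>)) \<in> E"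
proof (rule env_reindex[OF assms(1)])
  fix f assume "f \<in> range lin"
  then obtain n where "f = lin n" by auto
  then have "(\<lambda>i. f (\<tau> i)) = lin (\<phi> n)" using assms(2) by auto
  then show "(\<lambda>i. f (\<tau> i)) \<in> range lin" by simp
qed

lemma E_coordinate: "p \<in> E \<Longrightarrow> (\<lambda>_. p \<epsilon>) \<in> E1"
  by (rule env_reindex) auto

lemma E_trivial:
  assumes "p \<in> E" "infinite \<epsilon> \<or> \<epsilon> = {}"
  shows "p \<epsilon> = id"
proof -
  have "(\<lambda>_::unit. p \<epsilon>) \<in> env {\<lambda>_. 0}"
    by (rule env_reindex[OF assms(1)]) (use assms(2) in auto)
  moreover have "closed {\<lambda>_::unit. a 0}" by (intro compact_imp_closed_Hausdorff[OF Hausdorff_env]) simp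
  ultimately have "(\<lambda>_::unit. p \<epsilon>) = (\<lambda>_. a 0)" by (simp add: env_def)
  then show ?thesis by (auto simp: fun_eq_iff a_0)
qed

lemma E_approx:
  assumes p: "p \<in> E" and V: "finite V" and e: "e > 0"
  obtains n where "\<And>\<epsilon> x. (\<epsilon>, x) \<in> V \<Longrightarrow> dist (a (lin n \<epsilon>) x) (p \<epsilon> x) < e"
proof -
  let ?U = "{q. \<forall>v\<in>V. q (fst v) (snd v) \<in> ball (p (fst v) (snd v)) e}"
  have "?U = (\<Inter>v\<in>V. (\<lambda>q. q (fst v) (snd v)) -` ball (p (fst v) (snd v)) e)" by auto
  moreover have "open \<dots>"
    using V by (intro open_INT ballI) (auto intro!: open_vimage continuous_eval)
  ultimately have "open ?U" by simp
  moreover have "p \<in> ?U" using e by auto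
  ultimately have "?U \<inter> (\<lambda>f i. a (f i)) ` range lin \<noteq> {}"
    using p open_Int_closure_eq_empty[of ?U "(\<lambda>f i. a (f i)) ` range lin"] unfolding env_def by blast
  then obtain n where "(\<lambda>i. a (lin n i)) \<in> ?U" by auto
  then show ?thesis using that[of n] by (fastforce simp: dist_commute)
qed

end

lemma tendsto_fun_iff:
  fixes l :: "'i \<Rightarrow> 'b::topological_space"
  shows "(f \<longlongrightarrow> l) F \<longleftrightarrow> (\<forall>i. ((\<lambda>x. f x i) \<longlongrightarrow> l i) F)"
  using limitin_componentwise[of "\<lambda>_. euclidean :: 'b topology" "UNIV :: 'i set" f l F]
  by (simp add: euclidean_product_topology)

lemma finite_vertices [simp]: "finite (vertices d)" by (simp add: vertices_def)
lemma empty_in_vertices [simp]: "{} \<in> vertices d" by (simp add: vertices_def)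
lemma vertices_finite: "\<epsilon> \<in> vertices d \<Longrightarrow> finite \<epsilon>"
  by (auto simp: vertices_def intro: finite_subset)
lemma vertices_0: "\<epsilon> \<in> vertices d \<Longrightarrow> 0 \<notin> \<epsilon>" by (auto simp: vertices_def)

text \<open>Since no vertex contains 0, this reads a Host-Kra element with shift \<open>s\<close> as
  a face element with the extra direction 0, evaluated at the vertices containing 0.\<close>

lemma lin_shift:
  "\<epsilon> \<in> vertices d \<Longrightarrow> lin (n(0 := s)) (insert 0 \<epsilon>) = s + lin n \<epsilon>"
  by (subst lin_insert) (auto simp: vertices_finite vertices_0 intro!: lin_cong)

lemma lin_single: "lin (\<lambda>i. if i = j then c else 0) \<epsilon> = (if finite \<epsilon> \<and> j \<in> \<epsilon> then c else 0)"
  by (cases "finite \<epsilon>") (simp_all add: lin_def)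

section \<open>Idempotents on cubes and the group that they determine\<close>

context zflow
begin

definition idem_ext :: "('m \<Rightarrow> 'm) \<Rightarrow> nat set \<Rightarrow> 'm \<Rightarrow> 'm" where
  "idem_ext u \<epsilon> = (if finite \<epsilon> \<and> \<epsilon> \<noteq> {} then u else id)"

text \<open>Sending \<open>n\<^sub>0\<close>, \<open>n\<^sub>1\<close>, \dots successively to an idempotent sends every nonempty sum to it.\<close>

lemma idem_ext_in_E:
  assumes u: "(\<lambda>_. u) \<in> E1" "u \<circ> u = u"
  shows "idem_ext u \<in> E"
proof -
  \<comment> \<open>Only the exponent in direction \<open>j\<close> is sent to \<open>u\<close>; all
    the others are set to 0.\<close>
  define v where "v j \<epsilon> = (if finite \<epsilon> \<and> j \<in> \<epsilon> then u else id)" for j and \<epsilon> :: "nat set"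
  have v: "v j \<in> E" for j
  proof -
    let ?h = "\<lambda>(p :: unit \<Rightarrow> 'm \<Rightarrow> 'm) \<epsilon>. if finite \<epsilon> \<and> j \<in> \<epsilon> then p () else id"
    have "?h ` closure ((\<lambda>f i. a (f i)) ` UNIV) \<subseteq> E"
    proof (intro image_closure_subset)
      show "continuous_on (closure ((\<lambda>f i. a (f i)) ` UNIV)) ?h"
      proof (rule continuous_on_coordinatewise_then_product)
        fix \<epsilon>
        show "continuous_on (closure ((\<lambda>f i. a (f i)) ` UNIV)) (\<lambda>p. ?h p \<epsilon>)"
        proof (cases "finite \<epsilon> \<and> j \<in> \<epsilon>")
          case True
          then show ?thesis by (simp add: continuous_on_product_then_coordinatewise[OF continuous_on_id])
        next
          case False
          then show ?thesis by (simp only: if_False continuous_on_const)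
        qed
      qed
      show "?h ` (\<lambda>f i. a (f i)) ` UNIV \<subseteq> E"
      proof safe
        fix f :: "unit \<Rightarrow> int"
        have "?h (\<lambda>i. a (f i)) = (\<lambda>\<epsilon>. a (lin (\<lambda>i. if i = j then f () else 0) \<epsilon>))"
          by (auto simp: fun_eq_iff lin_single a_0)
        then show "?h (\<lambda>i. a (f i)) \<in> E" by (simp add: gen_in_env)
      qed
    qed (simp add: env_def)
    moreover have "?h (\<lambda>_. u) = v j" by (auto simp: v_def)
    moreover have "?h (\<lambda>_. u) \<in> ?h ` closure ((\<lambda>f i. a (f i)) ` UNIV)"
      using u(1) unfolding env_def by (rule imageI)
    ultimately show ?thesis by (simp only: subsetD)
  qed
  \<comment> \<open>The state after the exponents in the directions below \<open>j\<close> have been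
    sent to \<open>u\<close>. A vertex containing several of these directions receives a power of
    \<open>u\<close>, which is \<open>u\<close> by idempotence. There are infinitely many
    directions, so \<open>idem_ext u\<close> is reached as the limit in \<open>j\<close>.\<close>
  define w where "w j \<epsilon> = (if finite \<epsilon> \<and> (\<exists>i\<in>\<epsilon>. i < j) then u else id)" for j and \<epsilon> :: "nat set"
  have w: "w j \<in> E" for j
  proof (induction j)
    case 0
    have "w 0 = (\<lambda>\<epsilon>. a (lin (\<lambda>_. 0) \<epsilon>))" by (auto simp: w_def fun_eq_iff lin_zero a_0)
    then show ?case by (simp add: gen_in_env)
  next
    case (Suc j)
    have uu: "u (u x) = u x" for x using fun_cong[OF u(2), of x] by simp
    have "w (Suc j) = v j \<odot> w j"
    proof (intro ext)
      fix \<epsilon> x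
      show "w (Suc j) \<epsilon> x = (v j \<odot> w j) \<epsilon> x"
        by (cases "j \<in> \<epsilon>"; cases "\<exists>i\<in>\<epsilon>. i < j")
          (use less_SucE in \<open>auto simp: w_def v_def pcomp_def uu less_Suc_eq\<close>)
    qed
    then show ?case using E.closed[OF v Suc] by simp
  qed
  have "w \<longlonglongrightarrow> idem_ext u"
    unfolding tendsto_fun_iff
  proof (intro allI)
    fix \<epsilon> :: "nat set" and x
    have "\<forall>\<^sub>F j in sequentially. w j \<epsilon> x = idem_ext u \<epsilon> x"
    proof (cases "finite \<epsilon> \<and> \<epsilon> \<noteq> {}")
      case True
      then obtain i where "i \<in> \<epsilon>" by auto
      then have "\<forall>j\<ge>Suc i. w j \<epsilon> x = idem_ext u \<epsilon> x"
        using True by (auto simp: w_def idem_ext_def Suc_le_eq)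
      then show ?thesis unfolding eventually_sequentially by blast
    qed (auto simp: w_def idem_ext_def)
    then show "(\<lambda>j. w j \<epsilon> x) \<longlonglongrightarrow> idem_ext u \<epsilon> x" by (rule tendsto_eventually)
  qed
  then show ?thesis
    by (rule Lim_in_closed_set[rotated 3]) (use w in \<open>auto simp: env_def\<close>)
qed

end

text \<open>Minimality of the idempotent enters as \<open>u_unique\<close>. This form is stable
  under passing to cubes, because it can be applied at each vertex separately.\<close>

locale idempotent_zflow = zflow K a for K :: "'m::metric_space set" and a +
  fixes u :: "'m \<Rightarrow> 'm"
  assumes u_E1: "(\<lambda>_. u) \<in> E1" and uu: "u (u x) = u x"
    and u_unique: "(\<lambda>_. w) \<in> E1 \<Longrightarrow> (\<And>x. u (w x) = w x) \<Longrightarrow> (\<And>x. w (u x) = w x)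
      \<Longrightarrow> (\<And>x. w (w x) = w x) \<Longrightarrow> w = u"
begin

abbreviation U where "U \<equiv> idem_ext u"

lemma U_E: "U \<in> E" by (rule idem_ext_in_E) (auto simp: u_E1 uu)

lemma U_U: "U \<odot> U = U" by (auto simp: pcomp_def idem_ext_def uu fun_eq_iff)

definition Grp where "Grp p \<longleftrightarrow> p \<in> E \<and> U \<odot> p = p \<and> p \<odot> U = p"

lemma Grp_comp: "Grp p \<Longrightarrow> Grp q \<Longrightarrow> Grp (p \<odot> q)"
  unfolding Grp_def by (metis pcomp_assoc E.closed)

lemma Grp_sandwich: "p \<in> E \<Longrightarrow> Grp (U \<odot> p \<odot> U)"
  unfolding Grp_def by (metis pcomp_assoc E.closed U_E U_U)

lemma Grp_U_left: "Grp p \<Longrightarrow> finite \<epsilon> \<Longrightarrow> \<epsilon> \<noteq> {} \<Longrightarrow> u (p \<epsilon> x) = p \<epsilon> x"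
  and Grp_U_right: "Grp p \<Longrightarrow> finite \<epsilon> \<Longrightarrow> \<epsilon> \<noteq> {} \<Longrightarrow> p \<epsilon> (u x) = p \<epsilon> x"
proof -
  assume "Grp p" "finite \<epsilon>" "\<epsilon> \<noteq> {}"
  moreover from this have "(U \<odot> p) \<epsilon> x = p \<epsilon> x" "(p \<odot> U) \<epsilon> x = p \<epsilon> x" by (auto simp: Grp_def)
  ultimately show "u (p \<epsilon> x) = p \<epsilon> x" "p \<epsilon> (u x) = p \<epsilon> x"
    by (auto simp: pcomp_def idem_ext_def)
qed

text \<open>An idempotent absorbed by \<open>U\<close> on both sides has at every finite nonempty
  vertex an idempotent of \<open>E1\<close> absorbed by \<open>u\<close>, hence \<open>u\<close>. At
  the remaining indices all of \<open>E\<close> is the identity. So \<open>U\<close> is the only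
  such idempotent, and inverses exist.\<close>

lemma Grp_inverse:
  assumes "Grp p"
  obtains g where "Grp g" "g \<odot> p = U" "p \<odot> g = U"
proof -
  have uniq: "w = U" if w: "w \<in> E" "U \<odot> w = w" "w \<odot> U = w" "w \<odot> w = w" for w
  proof
    fix \<epsilon> show "w \<epsilon> = U \<epsilon>"
    proof (cases "finite \<epsilon> \<and> \<epsilon> \<noteq> {}")
      case True
      have "w \<epsilon> = u"
      proof (rule u_unique)
        show "(\<lambda>_. w \<epsilon>) \<in> E1" using w(1) by (rule E_coordinate)
        have "Grp w" using w by (simp add: Grp_def)
        then show "u (w \<epsilon> x) = w \<epsilon> x" "w \<epsilon> (u x) = w \<epsilon> x" for x
          using True Grp_U_left Grp_U_right by blast+
        show "w \<epsilon> (w \<epsilon> x) = w \<epsilon> x" for x using w(4) unfolding pcomp_def by metis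
      qed
      then show ?thesis using True by (simp add: idem_ext_def)
    next
      case False
      then show ?thesis using E_trivial[OF w(1)] by (auto simp: idem_ext_def)
    qed
  qed
  show ?thesis
    by (rule E.inverse_if_unique_idempotent[of U p])
      (use assms uniq U_E U_U that in \<open>auto simp: Grp_def\<close>)
qed

text \<open>A pullback can leave the group: a nonempty \<epsilon> with
  \<open>\<tau> \<epsilon>\<close> empty receives the identity instead of \<open>u\<close>.
  Sandwiching with \<open>U\<close> once more repairs exactly these vertices and changes no other
  finite nonempty vertex.\<close>

lemma Grp_reindex:
  assumes "Grp p" "\<And>n \<epsilon>. lin (\<phi> n) \<epsilon> = lin n (\<tau> \<epsilon>)"
  obtains q where "Grp q"
    "\<And>\<epsilon> x. finite \<epsilon> \<Longrightarrow> \<epsilon> \<noteq> {} \<Longrightarrow> q \<epsilon> x = (if finite (\<tau> \<epsilon>) \<and> \<tau> \<epsilon> \<noteq> {} then p (\<tau> \<epsilon>) x else u x)"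
proof -
  have pE: "p \<in> E" using assms by (simp add: Grp_def)
  have "(\<lambda>\<epsilon>. p (\<tau> \<epsilon>)) \<in> E" using pE assms(2) by (rule E_reindex)
  then have 1: "Grp (U \<odot> (\<lambda>\<epsilon>. p (\<tau> \<epsilon>)) \<odot> U)" by (rule Grp_sandwich)
  have 2: "(U \<odot> (\<lambda>\<epsilon>. p (\<tau> \<epsilon>)) \<odot> U) \<epsilon> x = (if finite (\<tau> \<epsilon>) \<and> \<tau> \<epsilon> \<noteq> {} then p (\<tau> \<epsilon>) x else u x)"
    if e: "finite \<epsilon>" "\<epsilon> \<noteq> {}" for \<epsilon> x
  proof (cases "finite (\<tau> \<epsilon>) \<and> \<tau> \<epsilon> \<noteq> {}")
    case True
    then show ?thesis using e assms(1)
      by (simp add: pcomp_def Grp_U_left Grp_U_right) (simp add: idem_ext_def Grp_U_left Grp_U_right assms(1))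
  next
    case False
    then have "p (\<tau> \<epsilon>) = id" using E_trivial[OF pE] by auto
    then show ?thesis using False e by (auto simp: pcomp_def idem_ext_def uu)
  qed
  show ?thesis by (rule that[OF 1 2])
qed

text \<open>The shift \<open>n\<^sub>0\<close> can be absorbed: by induction on the dimension, each new coordinate \<open>k\<close> is
  corrected by comparing the substitutions \<open>n\<^sub>k := n\<^sub>0\<close> and \<open>n\<^sub>k := n\<^sub>k + n\<^sub>0\<close>.\<close>

lemma Grp_absorb_shift:
  assumes p: "Grp p" and p0: "\<And>x. p {0} x = u x"
  shows "\<exists>r. Grp r \<and> (\<forall>\<epsilon> x. \<epsilon> \<subseteq> {1..j} \<longrightarrow> \<epsilon> \<noteq> {} \<longrightarrow> r \<epsilon> x = p (insert 0 \<epsilon>) x)"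
proof (induction j)
  case 0
  show ?case using p by auto
next
  case (Suc j)
  then obtain r where r: "Grp r"
    "\<And>\<epsilon> x. \<epsilon> \<subseteq> {1..j} \<Longrightarrow> \<epsilon> \<noteq> {} \<Longrightarrow> r \<epsilon> x = p (insert 0 \<epsilon>) x" by blast
  let ?k = "Suc j"
  have l1: "lin (n(?k := 0)) \<epsilon> = lin n (\<epsilon> - {?k})" for n \<epsilon>
  proof (cases "finite \<epsilon>")
    case True
    then show ?thesis unfolding lin_def by (intro sum.mono_neutral_cong_right) auto
  qed auto
  \<comment> \<open>\<open>c\<close> is \<open>r\<close> with the new direction ignored, that is,
    with the substitution of 0 for its exponent.\<close>
  obtain c where c: "Grp c" "\<And>\<epsilon> x. finite \<epsilon> \<Longrightarrow> \<epsilon> \<noteq> {} \<Longrightarrow>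
      c \<epsilon> x = (if finite (\<epsilon> - {?k}) \<and> \<epsilon> - {?k} \<noteq> {} then r (\<epsilon> - {?k}) x else u x)"
    using Grp_reindex[OF r(1) l1] by blast
  \<comment> \<open>Substitution for \<open>b\<close>: the new exponent becomes the old shift, and
    the shift becomes 0.\<close>
  let ?\<alpha> = "\<lambda>\<epsilon>. (\<epsilon> - {0, ?k}) \<union> (if ?k \<in> \<epsilon> then {0} else {})"
  have l2: "lin (n(0 := 0, ?k := n 0)) \<epsilon> = lin n (?\<alpha> \<epsilon>)" for n \<epsilon>
  proof (cases "finite \<epsilon>")
    case True
    have "lin (n(0 := 0, ?k := n 0)) (\<epsilon> - {0, ?k}) = lin n (\<epsilon> - {0, ?k})"
      by (rule lin_cong) auto
    moreover have "lin (n(0 := 0, ?k := n 0)) \<epsilon>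
        = lin (n(0 := 0, ?k := n 0)) (\<epsilon> - {0, ?k}) + (if ?k \<in> \<epsilon> then n 0 else 0)"
    proof -
      have "lin (n(0 := 0, ?k := n 0)) \<epsilon>
        = lin (n(0 := 0, ?k := n 0)) (\<epsilon> - {0, ?k}) + lin (n(0 := 0, ?k := n 0)) (\<epsilon> \<inter> {0, ?k})"
        unfolding lin_def using True by (subst sum.Int_Diff[of _ _ "{0, ?k}"]) auto
      moreover have "lin (n(0 := 0, ?k := n 0)) (\<epsilon> \<inter> {0, ?k}) = (if ?k \<in> \<epsilon> then n 0 else 0)"
        by (cases "0 \<in> \<epsilon>"; cases "?k \<in> \<epsilon>") (auto simp: lin_def)
      ultimately show ?thesis by simp
    qed
    moreover have "lin n (?\<alpha> \<epsilon>) = lin n (\<epsilon> - {0, ?k}) + (if ?k \<in> \<epsilon> then n 0 else 0)"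
      using True lin_insert[of "\<epsilon> - {0, ?k}" 0 n] by auto
    ultimately show ?thesis by simp
  qed auto
  obtain b where b: "Grp b" "\<And>\<epsilon> x. finite \<epsilon> \<Longrightarrow> \<epsilon> \<noteq> {} \<Longrightarrow>
      b \<epsilon> x = (if finite (?\<alpha> \<epsilon>) \<and> ?\<alpha> \<epsilon> \<noteq> {} then p (?\<alpha> \<epsilon>) x else u x)"
    using Grp_reindex[OF p l2] by blast
  \<comment> \<open>Substitution for \<open>q\<close>: the shift is added to the new exponent and
    then becomes 0.\<close>
  let ?\<beta> = "\<lambda>\<epsilon>. if ?k \<in> \<epsilon> then insert 0 \<epsilon> else \<epsilon> - {0}"
  have l3: "lin (n(0 := 0, ?k := n ?k + n 0)) \<epsilon> = lin n (?\<beta> \<epsilon>)" for n \<epsilon>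
  proof (cases "finite \<epsilon>")
    case True
    have "lin (n(0 := 0, ?k := n ?k + n 0)) \<epsilon> = lin (n(0 := 0, ?k := n ?k + n 0)) (\<epsilon> - {0})"
      using True unfolding lin_def by (intro sum.mono_neutral_cong_right) auto
    also have "\<dots> = lin n (\<epsilon> - {0}) + (if ?k \<in> \<epsilon> then n 0 else 0)"
    proof (cases "?k \<in> \<epsilon>")
      case k: True
      then have e: "\<epsilon> - {0} = insert ?k (\<epsilon> - {0, ?k})" by auto
      have "lin (n(0 := 0, ?k := n ?k + n 0)) (\<epsilon> - {0, ?k}) = lin n (\<epsilon> - {0, ?k})"
        by (rule lin_cong) auto
      then show ?thesis using True k unfolding e by (subst (1 2) lin_insert) auto
    next
      case False
      have "lin (n(0 := 0, ?k := n ?k + n 0)) (\<epsilon> - {0}) = lin n (\<epsilon> - {0})"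
        by (rule lin_cong) (use False in auto)
      then show ?thesis using False by simp
    qed
    also have "\<dots> = lin n (?\<beta> \<epsilon>)"
    proof (cases "?k \<in> \<epsilon>")
      case k: True
      have "insert 0 \<epsilon> = insert 0 (\<epsilon> - {0})" by auto
      then show ?thesis using True k lin_insert[of "\<epsilon> - {0}" 0 n] by simp
    qed simp
    finally show ?thesis .
  qed auto
  obtain q where q: "Grp q" "\<And>\<epsilon> x. finite \<epsilon> \<Longrightarrow> \<epsilon> \<noteq> {} \<Longrightarrow>
      q \<epsilon> x = (if finite (?\<beta> \<epsilon>) \<and> ?\<beta> \<epsilon> \<noteq> {} then p (?\<beta> \<epsilon>) x else u x)"
    using Grp_reindex[OF p l3] by blast
  obtain g where g: "Grp g" "g \<odot> b = U" "b \<odot> g = U" using Grp_inverse[OF b(1)] by blast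
  \<comment> \<open>The new solution is c times the inverse of b times q. At vertices without the
    new direction, \<open>b\<close> and \<open>q\<close> both equal \<open>p\<close> and cancel,
    leaving \<open>r\<close>. At vertices with it, \<open>c\<close> and \<open>b\<close> agree, by
    the choice of \<open>r\<close> or, when nothing else is left in the vertex, by
    \<open>p0\<close>; then \<open>q\<close> remains, which has the desired value.\<close>
  have "Grp (c \<odot> g \<odot> q)" by (intro Grp_comp c(1) g(1) q(1))
  moreover have "(c \<odot> g \<odot> q) \<epsilon> x = p (insert 0 \<epsilon>) x" if e: "\<epsilon> \<subseteq> {1..?k}" "\<epsilon> \<noteq> {}" for \<epsilon> x
  proof -
    have fin: "finite \<epsilon>" by (rule finite_subset[OF e(1)]) simp
    have z: "0 \<notin> \<epsilon>" using e by auto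
    have gb: "g \<epsilon> (b \<epsilon> y) = u y" "b \<epsilon> (g \<epsilon> y) = u y" for y
    proof -
      have "(g \<odot> b) \<epsilon> y = u y" "(b \<odot> g) \<epsilon> y = u y" using fin e by (simp_all add: g(2,3) idem_ext_def)
      then show "g \<epsilon> (b \<epsilon> y) = u y" "b \<epsilon> (g \<epsilon> y) = u y" by (simp_all add: pcomp_def)
    qed
    show ?thesis
    proof (cases "?k \<in> \<epsilon>")
      case False
      then have e': "\<epsilon> \<subseteq> {1..j}" using e by (auto simp: le_Suc_eq)
      have al: "?\<alpha> \<epsilon> = \<epsilon>" "?\<beta> \<epsilon> = \<epsilon>" "\<epsilon> - {?k} = \<epsilon>" using False z by auto
      have "b \<epsilon> y = p \<epsilon> y" "q \<epsilon> y = p \<epsilon> y" "c \<epsilon> y = r \<epsilon> y" for y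
        using b(2)[OF fin e(2)] q(2)[OF fin e(2)] c(2)[OF fin e(2)] unfolding al using fin e(2) by simp_all
      then have "(c \<odot> g \<odot> q) \<epsilon> x = r \<epsilon> (u x)" using gb(1)[of x] by (simp add: pcomp_def)
      also have "\<dots> = p (insert 0 \<epsilon>) x" using Grp_U_right[OF r(1) fin e(2)] r(2)[OF e' e(2)] by simp
      finally show ?thesis .
    next
      case True
      let ?d = "\<epsilon> - {?k}"
      have d: "?d \<subseteq> {1..j}" using e by (auto simp: le_Suc_eq)
      have al: "?\<alpha> \<epsilon> = insert 0 ?d" "?\<beta> \<epsilon> = insert 0 \<epsilon>" using True z by auto
      have bb: "b \<epsilon> y = p (insert 0 ?d) y" and qq: "q \<epsilon> y = p (insert 0 \<epsilon>) y" for y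
        using b(2)[OF fin e(2)] q(2)[OF fin e(2)] unfolding al using fin by simp_all
      have "c \<epsilon> y = b \<epsilon> y" for y
      proof (cases "?d = {}")
        case d: True
        show ?thesis using c(2)[OF fin e(2), of y] p0 unfolding bb d by simp
      next
        case False
        then show ?thesis using c(2)[OF fin e(2), of y] r(2)[OF d, of y] fin unfolding bb by simp
      qed
      then have "(c \<odot> g \<odot> q) \<epsilon> x = u (p (insert 0 \<epsilon>) x)" using gb(2) qq by (simp add: pcomp_def)
      also have "\<dots> = p (insert 0 \<epsilon>) x" using fin by (intro Grp_U_left[OF p]) auto
      finally show ?thesis .
    qed
  qed
  ultimately show ?case by blast
qed

end

section \<open>Cubes and regional proximality\<close>

lemma finite_equicontinuous:
  fixes f :: "'i \<Rightarrow> 'b::metric_space \<Rightarrow> 'c::metric_space"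
  assumes "finite V" "e > 0" "\<And>i. i \<in> V \<Longrightarrow> continuous_on (K i) (f i)" "\<And>i. i \<in> V \<Longrightarrow> y i \<in> K i"
  shows "\<exists>\<delta>>0. \<forall>i\<in>V. \<forall>z\<in>K i. dist z (y i) < \<delta> \<longrightarrow> dist (f i z) (f i (y i)) < e"
  using assms(1,3,4)
proof (induction V rule: finite_induct)
  case empty
  show ?case by (intro exI[of _ 1]) auto
next
  case (insert i V)
  have "\<exists>\<delta>>0. \<forall>i\<in>V. \<forall>z\<in>K i. dist z (y i) < \<delta> \<longrightarrow> dist (f i z) (f i (y i)) < e"
    by (rule insert.IH) (use insert.prems in auto)
  then obtain \<delta> where \<delta>: "\<delta> > 0" "\<forall>i\<in>V. \<forall>z\<in>K i. dist z (y i) < \<delta> \<longrightarrow> dist (f i z) (f i (y i)) < e"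
    by blast
  have "continuous_on (K i) (f i)" "y i \<in> K i" using insert.prems by auto
  then obtain \<delta>' where "\<delta>' > 0" "\<forall>z\<in>K i. dist z (y i) < \<delta>' \<longrightarrow> dist (f i z) (f i (y i)) < e"
    using \<open>e > 0\<close> unfolding continuous_on_iff by blast
  with \<delta> show ?case by (intro exI[of _ "min \<delta> \<delta>'"]) auto
qed

context zflow
begin

text \<open>Membership in the closure defining \<open>Q\<close>, stated by approximation. The
  diagonal shift of the Host-Kra group does not appear, as it only moves the base point
  \<open>x\<close>; values of \<open>w\<close> off the vertices are unconstrained.\<close>

definition cube :: "nat \<Rightarrow> (nat set \<Rightarrow> 'm) \<Rightarrow> bool" where
  "cube d w \<longleftrightarrow> (\<forall>e>0. \<exists>n. \<exists>x\<in>K. \<forall>\<epsilon>\<in>vertices d. dist (a (lin n \<epsilon>) x) (w \<epsilon>) < e)"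

lemma cubeE:
  assumes "cube d w" "e > 0"
  obtains n x where "x \<in> K" "\<And>\<epsilon>. \<epsilon> \<in> vertices d \<Longrightarrow> dist (a (lin n \<epsilon>) x) (w \<epsilon>) < e"
  using assms unfolding cube_def by blast

lemma cube_approx:
  assumes "\<And>e. e > 0 \<Longrightarrow> \<exists>w'. cube d w' \<and> (\<forall>\<epsilon>\<in>vertices d. dist (w' \<epsilon>) (w \<epsilon>) < e)"
  shows "cube d w"
  unfolding cube_def
proof (intro allI impI)
  fix e :: real assume e: "e > 0"
  then obtain w' where w': "cube d w'" "\<forall>\<epsilon>\<in>vertices d. dist (w' \<epsilon>) (w \<epsilon>) < e/2"
    using assms[of "e/2"] by auto
  obtain n x where nx: "x \<in> K" "\<And>\<epsilon>. \<epsilon> \<in> vertices d \<Longrightarrow> dist (a (lin n \<epsilon>) x) (w' \<epsilon>) < e/2"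
    using cubeE[OF w'(1) half_gt_zero[OF e]] by blast
  have "dist (a (lin n \<epsilon>) x) (w \<epsilon>) < e" if "\<epsilon> \<in> vertices d" for \<epsilon>
    using nx(2)[OF that] w'(2) that dist_triangle[of "a (lin n \<epsilon>) x" "w \<epsilon>" "w' \<epsilon>"] by force
  then show "\<exists>n. \<exists>x\<in>K. \<forall>\<epsilon>\<in>vertices d. dist (a (lin n \<epsilon>) x) (w \<epsilon>) < e" using nx(1) by blast
qed

lemma cube_cong: "cube d w \<Longrightarrow> (\<And>\<epsilon>. \<epsilon> \<in> vertices d \<Longrightarrow> w \<epsilon> = w' \<epsilon>) \<Longrightarrow> cube d w'"
  by (simp add: cube_def)

lemma cube_K:
  assumes "cube d w" "\<epsilon> \<in> vertices d"
  shows "w \<epsilon> \<in> K"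
proof -
  have "\<exists>y\<in>K. dist y (w \<epsilon>) < e" if e: "e > 0" for e
  proof -
    obtain n x where "x \<in> K" "\<And>\<epsilon>. \<epsilon> \<in> vertices d \<Longrightarrow> dist (a (lin n \<epsilon>) x) (w \<epsilon>) < e"
      using cubeE[OF assms(1) e] by blast
    then show ?thesis using assms(2) by (intro bexI[of _ "a (lin n \<epsilon>) x"]) (auto intro: a_in)
  qed
  then have "w \<epsilon> \<in> closure K" by (simp add: closure_approachable)
  then show ?thesis using compact_K by (simp add: compact_imp_closed)
qed

lemma cube_diag: "x \<in> K \<Longrightarrow> cube d (\<lambda>_. x)"
  unfolding cube_def by (intro allI impI exI[of _ "\<lambda>_. 0"] bexI[of _ x]) (auto simp: lin_zero a_0)

lemma a_equicontinuous:
  assumes "e > 0" "\<And>\<epsilon>. \<epsilon> \<in> vertices d \<Longrightarrow> w \<epsilon> \<in> K"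
  obtains \<delta> where "\<delta> > 0" "\<And>\<epsilon> z. \<epsilon> \<in> vertices d \<Longrightarrow> z \<in> K \<Longrightarrow> dist z (w \<epsilon>) < \<delta> \<Longrightarrow>
    dist (a (f \<epsilon>) z) (a (f \<epsilon>) (w \<epsilon>)) < e"
proof -
  have "\<exists>\<delta>>0. \<forall>\<epsilon>\<in>vertices d. \<forall>z\<in>K. dist z (w \<epsilon>) < \<delta> \<longrightarrow>
      dist (a (f \<epsilon>) z) (a (f \<epsilon>) (w \<epsilon>)) < e"
    by (rule finite_equicontinuous[OF finite_vertices assms(1)]) (simp_all add: a_cont assms(2))
  then show ?thesis using that by blast
qed

lemma cube_translate:
  assumes "cube d w"
  shows "cube d (\<lambda>\<epsilon>. a (s + lin n \<epsilon>) (w \<epsilon>))"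
  unfolding cube_def
proof (intro allI impI)
  fix e :: real assume e: "e > 0"
  obtain \<delta> where \<delta>: "\<delta> > 0" "\<And>\<epsilon> z. \<epsilon> \<in> vertices d \<Longrightarrow> z \<in> K \<Longrightarrow> dist z (w \<epsilon>) < \<delta> \<Longrightarrow>
      dist (a (s + lin n \<epsilon>) z) (a (s + lin n \<epsilon>) (w \<epsilon>)) < e"
    using a_equicontinuous[where d = d and w = w and f = "\<lambda>\<epsilon>. s + lin n \<epsilon>", OF e cube_K[OF assms]] by blast
  obtain m x where mx: "x \<in> K" "\<And>\<epsilon>. \<epsilon> \<in> vertices d \<Longrightarrow> dist (a (lin m \<epsilon>) x) (w \<epsilon>) < \<delta>"
    using cubeE[OF assms \<delta>(1)] by blast
  have "dist (a (lin (\<lambda>i. m i + n i) \<epsilon>) (a s x)) (a (s + lin n \<epsilon>) (w \<epsilon>)) < e" if "\<epsilon> \<in> vertices d" for \<epsilon>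
  proof -
    have "a (lin (\<lambda>i. m i + n i) \<epsilon>) (a s x) = a (s + lin n \<epsilon>) (a (lin m \<epsilon>) x)"
      unfolding a_add[symmetric] lin_add by (simp add: algebra_simps)
    then show ?thesis using \<delta>(2)[OF that a_in[OF mx(1)] mx(2)[OF that]] by simp
  qed
  then show "\<exists>n'. \<exists>y\<in>K. \<forall>\<epsilon>\<in>vertices d. dist (a (lin n' \<epsilon>) y) (a (s + lin n \<epsilon>) (w \<epsilon>)) < e"
    using a_in[OF mx(1)] by blast
qed

lemma cube_E:
  assumes "cube d w" "p \<in> E"
  shows "cube d (\<lambda>\<epsilon>. p \<epsilon> (w \<epsilon>))"
proof (rule cube_approx)
  fix e :: real assume e: "e > 0"
  obtain n where n: "\<And>\<epsilon> x. (\<epsilon>, x) \<in> (\<lambda>\<epsilon>. (\<epsilon>, w \<epsilon>)) ` vertices d \<Longrightarrow> dist (a (lin n \<epsilon>) x) (p \<epsilon> x) < e"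
    by (rule E_approx[OF assms(2) finite_imageI[OF finite_vertices] e]) blast
  have "cube d (\<lambda>\<epsilon>. a (lin n \<epsilon>) (w \<epsilon>))" using cube_translate[OF assms(1), of 0 n] by simp
  moreover have "\<forall>\<epsilon>\<in>vertices d. dist (a (lin n \<epsilon>) (w \<epsilon>)) (p \<epsilon> (w \<epsilon>)) < e" using n by auto
  ultimately show "\<exists>w'. cube d w' \<and> (\<forall>\<epsilon>\<in>vertices d. dist (w' \<epsilon>) (p \<epsilon> (w \<epsilon>)) < e)" by blast
qed

text \<open>Reflecting the directions in \<sigma> amounts to negating their exponents and moving the
  base point to the vertex \<sigma>.\<close>

lemma cube_reflect:
  assumes "cube d w" "\<sigma> \<in> vertices d"
  shows "cube d (\<lambda>\<epsilon>. w ((\<epsilon> - \<sigma>) \<union> (\<sigma> - \<epsilon>)))"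
  unfolding cube_def
proof (intro allI impI)
  fix e :: real assume e: "e > 0"
  obtain n x where nx: "x \<in> K" "\<And>\<epsilon>. \<epsilon> \<in> vertices d \<Longrightarrow> dist (a (lin n \<epsilon>) x) (w \<epsilon>) < e"
    using cubeE[OF assms(1) e] by blast
  let ?n = "\<lambda>i. if i \<in> \<sigma> then - n i else n i"
  have "a (lin ?n \<epsilon>) (a (lin n \<sigma>) x) = a (lin n ((\<epsilon> - \<sigma>) \<union> (\<sigma> - \<epsilon>))) x" if "\<epsilon> \<in> vertices d" for \<epsilon>
  proof -
    have f: "finite \<epsilon>" "finite \<sigma>" using that assms vertices_finite by auto
    have "lin ?n \<epsilon> = lin ?n (\<epsilon> \<inter> \<sigma>) + lin ?n (\<epsilon> - \<sigma>)"
      unfolding lin_def by (rule sum.Int_Diff[OF f(1)])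
    moreover have "lin ?n (\<epsilon> - \<sigma>) = lin n (\<epsilon> - \<sigma>)" by (rule lin_cong) auto
    moreover have "lin ?n (\<epsilon> \<inter> \<sigma>) = - lin n (\<epsilon> \<inter> \<sigma>)"
      unfolding lin_minus[symmetric] by (rule lin_cong) auto
    moreover have "lin n \<sigma> = lin n (\<sigma> \<inter> \<epsilon>) + lin n (\<sigma> - \<epsilon>)"
      unfolding lin_def by (rule sum.Int_Diff[OF f(2)])
    moreover have "lin n ((\<epsilon> - \<sigma>) \<union> (\<sigma> - \<epsilon>)) = lin n (\<epsilon> - \<sigma>) + lin n (\<sigma> - \<epsilon>)"
      unfolding lin_def using f by (intro sum.union_disjoint) auto
    ultimately show ?thesis by (simp add: Int_commute flip: a_add)
  qed
  moreover have "(\<epsilon> - \<sigma>) \<union> (\<sigma> - \<epsilon>) \<in> vertices d" if "\<epsilon> \<in> vertices d" for \<epsilon>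
    using that assms by (auto simp: vertices_def)
  ultimately show "\<exists>n. \<exists>x\<in>K. \<forall>\<epsilon>\<in>vertices d. dist (a (lin n \<epsilon>) x) (w ((\<epsilon> - \<sigma>) \<union> (\<sigma> - \<epsilon>))) < e"
    using nx a_in by (intro exI[of _ ?n] bexI[of _ "a (lin n \<sigma>) x"]) auto
qed

lemma cube_upper_face:
  assumes "cube (Suc k) w"
  shows "cube k (\<lambda>\<epsilon>. w (insert (Suc k) \<epsilon>))"
  unfolding cube_def
proof (intro allI impI)
  fix e :: real assume e: "e > 0"
  obtain n x where nx: "x \<in> K" "\<And>\<epsilon>. \<epsilon> \<in> vertices (Suc k) \<Longrightarrow> dist (a (lin n \<epsilon>) x) (w \<epsilon>) < e"
    using cubeE[OF assms(1) e] by blast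
  have "dist (a (lin n \<epsilon>) (a (n (Suc k)) x)) (w (insert (Suc k) \<epsilon>)) < e" if \<epsilon>: "\<epsilon> \<in> vertices k" for \<epsilon>
  proof -
    have "Suc k \<notin> \<epsilon>" "insert (Suc k) \<epsilon> \<in> vertices (Suc k)" using \<epsilon> by (auto simp: vertices_def)
    then have "lin n (insert (Suc k) \<epsilon>) = lin n \<epsilon> + n (Suc k)"
      using vertices_finite[OF \<epsilon>] by (simp add: lin_insert)
    then show ?thesis using nx(2)[OF \<open>insert (Suc k) \<epsilon> \<in> vertices (Suc k)\<close>] by (simp add: a_add)
  qed
  then show "\<exists>n. \<exists>x\<in>K. \<forall>\<epsilon>\<in>vertices k. dist (a (lin n \<epsilon>) x) (w (insert (Suc k) \<epsilon>)) < e"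
    using a_in[OF nx(1)] by blast
qed

end

section \<open>Recurrence of cubes and the proximality relation in a minimal system\<close>

locale minimal_zflow = zflow K a for K :: "'m::metric_space set" and a +
  assumes a_dense: "x \<in> K \<Longrightarrow> y \<in> K \<Longrightarrow> 0 < e \<Longrightarrow> \<exists>n. dist (a n x) y < e"
begin

text \<open>A minimal left ideal \<open>L\<close> maps \<open>x\<close> onto a closed set containing
  an orbit closure, so \<open>x\<close> is reached and the elements of \<open>L\<close> fixing
  \<open>x\<close> form a compact semigroup with an idempotent e. For uniqueness, an idempotent w
  absorbed by e lies in \<open>L\<close>, so e = gw for some g. Then e = gww = ew = w.\<close>

lemma fixing_idempotent:
  assumes x: "x \<in> K"
  obtains u where "idempotent_zflow K a u" "u x = x"
proof -
  obtain L where L: "L \<subseteq> E1" "compact L" "L \<noteq> {}" and ideal: "\<forall>p\<in>E1. \<forall>q\<in>L. p \<odot> q \<in> L"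
    and min: "\<forall>q\<in>L. \<forall>r\<in>L. \<exists>p\<in>E1. p \<odot> q = r"
    by (rule E1.minimal_left_ideal)
  have ev: "continuous_on L (\<lambda>p. p () x)" by (rule continuous_eval)
  have "x \<in> (\<lambda>p. p () x) ` L"
  proof -
    obtain q where q: "q \<in> L" using L by auto
    then have qx: "q () x \<in> K" using env_K[OF subsetD[OF L(1)] x] by simp
    have "x \<in> closure ((\<lambda>p. p () x) ` L)"
      unfolding closure_approachable
    proof (intro allI impI)
      fix e :: real assume "e > 0"
      then obtain n where n: "dist (a n (q () x)) x < e" using a_dense[OF qx x] by blast
      have "(\<lambda>_. a n) \<odot> q \<in> L" using ideal q gen_in_env[of "\<lambda>_. n" "UNIV :: (unit \<Rightarrow> int) set"] by simp
      then have "a n (q () x) \<in> (\<lambda>p. p () x) ` L"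
        by (rule rev_image_eqI) (simp add: pcomp_def)
      then show "\<exists>y\<in>(\<lambda>p. p () x) ` L. dist y x < e" using n by blast
    qed
    moreover have "closed ((\<lambda>p. p () x) ` L)"
      using compact_continuous_image[OF ev L(2)] by (rule compact_imp_closed)
    ultimately show ?thesis by simp
  qed
  define T where "T = {p \<in> L. p () x = x}"
  have "closed L" by (rule compact_imp_closed_Hausdorff[OF Hausdorff_env L(2)])
  then have "closed T" unfolding T_def
    using continuous_closed_preimage[OF ev, of "{x}"] by (simp add: vimage_def Int_def)
  then have "compact (L \<inter> T)" by (rule compact_Int_closed[OF L(2)])
  moreover have "L \<inter> T = T" by (auto simp: T_def)
  ultimately have "compact T" by simp
  have TE: "T \<subseteq> E1" "T \<noteq> {}" using L(1) \<open>x \<in> (\<lambda>p. p () x) ` L\<close> by (auto simp: T_def)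
  have TT: "p \<odot> q \<in> T" if "p \<in> T" "q \<in> T" for p q
  proof -
    have "p \<in> E1" "q \<in> L" using that TE(1) by (auto simp: T_def)
    then have "p \<odot> q \<in> L" using ideal by simp
    moreover have "(p \<odot> q) () x = x" using that by (simp add: T_def pcomp_def)
    ultimately show ?thesis by (simp add: T_def)
  qed
  obtain e where e: "e \<in> T" "e \<odot> e = e"
    using E1.idempotent[OF TE(1) \<open>compact T\<close> TE(2) TT] by blast
  have ee: "(\<lambda>_. e ()) = e" by auto
  have "idempotent_zflow K a (e ())"
  proof
    show "(\<lambda>_. e ()) \<in> E1" using e(1) TE(1) unfolding ee by (rule subsetD[rotated])
    show "e () (e () y) = e () y" for y
      using fun_cong[OF fun_cong[OF e(2), of "()"], of y] unfolding pcomp_def .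
    fix w assume w: "(\<lambda>_. w) \<in> E1" "\<And>y. e () (w y) = w y" "\<And>y. w (e () y) = w y" "\<And>y. w (w y) = w y"
    have "(\<lambda>_. w) \<odot> e = (\<lambda>_. w)" using w(3) by (auto simp: pcomp_def fun_eq_iff)
    moreover have "(\<lambda>_. w) \<odot> e \<in> L" using ideal w(1) e(1) by (simp add: T_def)
    ultimately have "(\<lambda>_. w) \<in> L" by simp
    moreover have "e \<in> L" using e(1) by (simp add: T_def)
    ultimately obtain g where g1: "g \<in> E1" "g \<odot> (\<lambda>_. w) = e" using min by blast
    have g: "g () (w y) = e () y" for y
      using fun_cong[OF fun_cong[OF g1(2), of "()"], of y] unfolding pcomp_def .
    show "w = e ()"
    proof
      fix y
      have "e () y = g () (w (w y))" using g w(4) by simp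
      also have "\<dots> = e () (w y)" by (rule g)
      finally show "w y = e () y" using w(2) by simp
    qed
  qed
  moreover have "e () x = x" using e by (simp add: T_def)
  ultimately show ?thesis by (rule that)
qed

text \<open>The base points of approximating cubes can be replaced by points of the dense orbit of
  \<open>x\<close>, at the cost of a shift. Compactness of \<open>E\<close> then replaces the
  approximating group elements by a single semigroup element.\<close>

lemma cube_orbit:
  assumes w: "cube d w" and x: "x \<in> K"
  obtains p where "p \<in> E" "\<And>\<epsilon>. \<epsilon> \<in> vertices d \<Longrightarrow> p (insert 0 \<epsilon>) x = w \<epsilon>"
proof -
  have 1: "\<exists>n. \<forall>\<epsilon>\<in>vertices d. dist (a (lin n (insert 0 \<epsilon>)) x) (w \<epsilon>) < e" if e: "e > 0" for e
  proof -
    obtain n y where ny: "y \<in> K" "\<And>\<epsilon>. \<epsilon> \<in> vertices d \<Longrightarrow> dist (a (lin n \<epsilon>) y) (w \<epsilon>) < e/2"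
      using cubeE[OF w half_gt_zero[OF e]] by blast
    obtain \<delta> where \<delta>: "\<delta> > 0" "\<And>\<epsilon> z. \<epsilon> \<in> vertices d \<Longrightarrow> z \<in> K \<Longrightarrow> dist z y < \<delta> \<Longrightarrow>
        dist (a (lin n \<epsilon>) z) (a (lin n \<epsilon>) y) < e/2"
      using a_equicontinuous[OF half_gt_zero[OF e], where d = d and w = "\<lambda>_. y" and f = "lin n"] ny(1) by blast
    obtain s where s: "dist (a s x) y < \<delta>" using a_dense[OF x ny(1) \<delta>(1)] by blast
    have "dist (a (lin (n(0 := s)) (insert 0 \<epsilon>)) x) (w \<epsilon>) < e" if \<epsilon>: "\<epsilon> \<in> vertices d" for \<epsilon>
    proof -
      have "a (lin (n(0 := s)) (insert 0 \<epsilon>)) x = a (lin n \<epsilon>) (a s x)"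
        unfolding lin_shift[OF \<epsilon>] a_add[symmetric] by (simp add: add.commute)
      moreover have "dist (a (lin n \<epsilon>) (a s x)) (a (lin n \<epsilon>) y) < e/2" by (rule \<delta>(2)[OF \<epsilon> a_in[OF x] s])
      ultimately show ?thesis
        using ny(2)[OF \<epsilon>] dist_triangle[of "a (lin n \<epsilon>) (a s x)" "w \<epsilon>" "a (lin n \<epsilon>) y"] by simp
    qed
    then show ?thesis by blast
  qed
  have "\<exists>n. \<forall>\<epsilon>\<in>vertices d. dist (a (lin n (insert 0 \<epsilon>)) x) (w \<epsilon>) < inverse (Suc m)" for m
    by (rule 1[of "inverse (Suc m)"]) simp
  then obtain N where N: "\<And>m \<epsilon>. \<epsilon> \<in> vertices d \<Longrightarrow> dist (a (lin (N m) (insert 0 \<epsilon>)) x) (w \<epsilon>) < inverse (Suc m)"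
    by metis
  \<comment> \<open>Off the vertices the value is set to that of \<open>w\<close>, so that
    convergence to \<open>w\<close> holds in the whole function space.\<close>
  let ?h = "\<lambda>p \<epsilon>. if \<epsilon> \<in> vertices d then p (insert 0 \<epsilon>) x else w \<epsilon>"
  have ch: "continuous_on E ?h"
  proof (rule continuous_on_coordinatewise_then_product)
    fix \<epsilon> show "continuous_on E (\<lambda>p. ?h p \<epsilon>)"
      using continuous_eval[of E "insert 0 \<epsilon>" x] by (cases "\<epsilon> \<in> vertices d") simp_all
  qed
  have "closed (?h ` E)"
    by (rule compact_imp_closed_Hausdorff[OF _ compact_continuous_image[OF ch compact_env]])
      (intro Hausdorff_fun Hausdorff_space_euclidean)
  moreover have "(\<lambda>m. ?h (\<lambda>\<epsilon>. a (lin (N m) \<epsilon>))) \<longlonglongrightarrow> w"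
    unfolding tendsto_fun_iff
  proof
    fix \<epsilon>
    show "(\<lambda>m. ?h (\<lambda>\<epsilon>. a (lin (N m) \<epsilon>)) \<epsilon>) \<longlonglongrightarrow> w \<epsilon>"
    proof (cases "\<epsilon> \<in> vertices d")
      case True
      have "(\<lambda>m. dist (a (lin (N m) (insert 0 \<epsilon>)) x) (w \<epsilon>)) \<longlonglongrightarrow> 0"
        by (rule tendsto_sandwich[OF _ _ tendsto_const LIMSEQ_inverse_real_of_nat])
          (use N[OF True] in \<open>auto intro!: always_eventually less_imp_le\<close>)
      then have "(\<lambda>m. a (lin (N m) (insert 0 \<epsilon>)) x) \<longlonglongrightarrow> w \<epsilon>" by (rule iffD2[OF tendsto_dist_iff])
      then show ?thesis using True by simp
    qed auto
  qed
  moreover have "\<forall>\<^sub>F m in sequentially. ?h (\<lambda>\<epsilon>. a (lin (N m) \<epsilon>)) \<in> ?h ` E"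
    by (intro always_eventually allI imageI gen_in_env rangeI)
  ultimately have "w \<in> ?h ` E"
    using Lim_in_closed_set[of "?h ` E" "\<lambda>m. ?h (\<lambda>\<epsilon>. a (lin (N m) \<epsilon>))" sequentially w]
      trivial_limit_sequentially by blast
  then obtain p where p: "p \<in> E" "w = ?h p" by (rule imageE)
  have "p (insert 0 \<epsilon>) x = w \<epsilon>" if "\<epsilon> \<in> vertices d" for \<epsilon>
    using fun_cong[OF p(2), of \<epsilon>] that by simp
  then show ?thesis by (rule that[OF p(1)])
qed

text \<open>Equivalently, the orbit closure of the diagonal cube at \<open>x\<close> under the face group is the only
  minimal set among the cubes based at \<open>x\<close>. A cube is first written as \<open>p\<close> applied to the
  diagonal, with the shift as coordinate \<open>0\<close>; then \<open>p\<close> is inverted and the shift absorbed.\<close>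

theorem cube_recurrent:
  assumes w: "cube d w"
  obtains r where "r \<in> E" "\<And>\<epsilon>. \<epsilon> \<in> vertices d \<Longrightarrow> r \<epsilon> (w \<epsilon>) = w {}"
proof -
  define x where "x = w {}"
  have x: "x \<in> K" using cube_K[OF w, of "{}"] by (simp add: x_def)
  obtain u where u: "idempotent_zflow K a u" "u x = x" using fixing_idempotent[OF x] by blast
  interpret idempotent_zflow K a u by (rule u)
  obtain p0 where p0: "p0 \<in> E" "\<And>\<epsilon>. \<epsilon> \<in> vertices d \<Longrightarrow> p0 (insert 0 \<epsilon>) x = w \<epsilon>"
    using cube_orbit[OF w x] by blast
  define p where "p = U \<odot> p0 \<odot> U"
  have p: "Grp p" unfolding p_def using p0(1) by (rule Grp_sandwich)
  have px: "p (insert 0 \<epsilon>) x = u (w \<epsilon>)" if "\<epsilon> \<in> vertices d" for \<epsilon>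
    using p0(2)[OF that] vertices_finite[OF that] by (simp add: p_def pcomp_def idem_ext_def u(2))
  obtain g where g: "Grp g" "g \<odot> p = U" "p \<odot> g = U" using Grp_inverse[OF p] by blast
  have gp: "g \<epsilon> (p \<epsilon> y) = u y" "p \<epsilon> (g \<epsilon> y) = u y" if "finite \<epsilon>" "\<epsilon> \<noteq> {}" for \<epsilon> y
  proof -
    have "(g \<odot> p) \<epsilon> y = u y" "(p \<odot> g) \<epsilon> y = u y" using that by (simp_all add: g(2,3) idem_ext_def)
    then show "g \<epsilon> (p \<epsilon> y) = u y" "p \<epsilon> (g \<epsilon> y) = u y" by (simp_all add: pcomp_def)
  qed
  \<comment> \<open>\<open>s\<close> retains only the shift of \<open>p\<close>: it has the value of
    \<open>p {0}\<close> at every finite vertex containing 0.\<close>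
  let ?\<tau> = "\<lambda>\<epsilon> :: nat set. if finite \<epsilon> then \<epsilon> \<inter> {0} else {}"
  have l: "lin (\<lambda>i. if i = 0 then n 0 else 0) \<epsilon> = lin n (?\<tau> \<epsilon>)" for n \<epsilon>
    by (auto simp: lin_def)
  obtain s where s: "Grp s" "\<And>\<epsilon> y. finite \<epsilon> \<Longrightarrow> \<epsilon> \<noteq> {} \<Longrightarrow>
      s \<epsilon> y = (if finite (?\<tau> \<epsilon>) \<and> ?\<tau> \<epsilon> \<noteq> {} then p (?\<tau> \<epsilon>) y else u y)"
    using Grp_reindex[OF p l] by blast
  have s0: "s (insert 0 \<epsilon>) y = p {0} y" if "finite \<epsilon>" for \<epsilon> y
    using s(2)[of "insert 0 \<epsilon>" y] that by simp
  \<comment> \<open>The factor \<open>s\<close> compensates the inverse \<open>g\<close> in the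
    shift direction; this is the hypothesis for absorbing the shift. At the vertices with 0 added,
    \<open>g\<close> undoes \<open>p\<close> and \<open>s\<close> then applies \<open>p {0}\<close>,
    which fixes \<open>x\<close>.\<close>
  have "(s \<odot> g) {0} y = u y" for y
    using s0[of "{}"] gp(2)[of "{0}"] by (simp add: pcomp_def)
  then obtain r where r: "Grp r" "\<And>\<epsilon> y. \<epsilon> \<subseteq> {1..d} \<Longrightarrow> \<epsilon> \<noteq> {} \<Longrightarrow> r \<epsilon> y = (s \<odot> g) (insert 0 \<epsilon>) y"
    using Grp_absorb_shift[OF Grp_comp[OF s(1) g(1)], of d] by blast
  have "r \<odot> U \<in> E" using r(1) U_E E.closed by (simp add: Grp_def)
  moreover have "(r \<odot> U) \<epsilon> (w \<epsilon>) = w {}" if \<epsilon>: "\<epsilon> \<in> vertices d" for \<epsilon>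
  proof (cases "\<epsilon> = {}")
    case True
    then show ?thesis using E_trivial[OF \<open>r \<odot> U \<in> E\<close>, of "{}"] by simp
  next
    case False
    have fin: "finite \<epsilon>" using \<epsilon> by (rule vertices_finite)
    have "(r \<odot> U) \<epsilon> (w \<epsilon>) = r \<epsilon> (u (w \<epsilon>))" using False fin by (simp add: pcomp_def idem_ext_def)
    also have "\<dots> = s (insert 0 \<epsilon>) (g (insert 0 \<epsilon>) (p (insert 0 \<epsilon>) x))"
      using r(2)[of \<epsilon>] \<epsilon> False px[OF \<epsilon>] by (simp add: vertices_def pcomp_def)
    also have "\<dots> = p {0} x" using gp(1)[of "insert 0 \<epsilon>"] fin s0 u(2) by simp
    also have "\<dots> = x" using px[of "{}"] u(2) by (simp add: x_def)
    finally show ?thesis by (simp add: x_def)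
  qed
  ultimately show ?thesis by (rule that)
qed

text \<open>For \<open>d = k + 1\<close> this is the paper's \<open>RP\<close> of order \<open>k\<close>.\<close>

definition Rel :: "nat \<Rightarrow> 'm \<Rightarrow> 'm \<Rightarrow> bool" where
  "Rel d x y \<longleftrightarrow> cube d (\<lambda>\<epsilon>. if \<epsilon> = {} then x else y)"

lemma Rel_K1: "Rel d x y \<Longrightarrow> x \<in> K"
  unfolding Rel_def using cube_K[of d _ "{}"] by force

lemma Rel_refl: "x \<in> K \<Longrightarrow> Rel d x x" by (simp add: Rel_def cube_diag)

text \<open>The two faces in the last direction differ only at the first vertex. Recurrence
  collapses the upper face to the constant \<open>w {Suc k}\<close>. The same element applied to the
  lower face does the same at its nonempty vertices and leaves \<open>w {}\<close> in place, being
  trivial at \<open>{}\<close>.\<close>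

lemma Rel_if_cube:
  assumes w: "cube (Suc k) w" and eq: "\<And>\<epsilon>. \<epsilon> \<in> vertices k \<Longrightarrow> \<epsilon> \<noteq> {} \<Longrightarrow> w (insert (Suc k) \<epsilon>) = w \<epsilon>"
  shows "Rel (Suc k) (w {}) (w {Suc k})"
proof -
  obtain r where r: "r \<in> E" "\<And>\<epsilon>. \<epsilon> \<in> vertices k \<Longrightarrow> r \<epsilon> (w (insert (Suc k) \<epsilon>)) = w {Suc k}"
    using cube_recurrent[OF cube_upper_face[OF w]] by blast
  have l: "lin (n(Suc k := 0)) \<epsilon> = lin n (\<epsilon> - {Suc k})" for n \<epsilon>
  proof (cases "finite \<epsilon>")
    case True
    then show ?thesis unfolding lin_def by (intro sum.mono_neutral_cong_right) auto
  qed auto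
  \<comment> \<open>Setting the exponent of the last direction to 0 makes one element act
    identically on both faces.\<close>
  have "(\<lambda>\<epsilon>. r (\<epsilon> - {Suc k})) \<in> E" using r(1) l by (rule E_reindex)
  then have "cube (Suc k) (\<lambda>\<epsilon>. r (\<epsilon> - {Suc k}) (w \<epsilon>))" by (rule cube_E[OF w])
  then show ?thesis unfolding Rel_def
  proof (rule cube_cong)
    fix \<epsilon> assume \<epsilon>: "\<epsilon> \<in> vertices (Suc k)"
    then have d: "\<epsilon> - {Suc k} \<in> vertices k" by (auto simp: vertices_def le_Suc_eq)
    show "r (\<epsilon> - {Suc k}) (w \<epsilon>) = (if \<epsilon> = {} then w {} else w {Suc k})"
    proof (cases "Suc k \<in> \<epsilon>")
      case True
      then have "insert (Suc k) (\<epsilon> - {Suc k}) = \<epsilon>" by auto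
      then show ?thesis using r(2)[OF d] True by auto
    next
      case False
      then have e: "\<epsilon> - {Suc k} = \<epsilon>" by auto
      show ?thesis
      proof (cases "\<epsilon> = {}")
        case True
        then show ?thesis using E_trivial[OF r(1), of "{}"] by simp
      next
        case False
        then show ?thesis using r(2)[of \<epsilon>] eq[of \<epsilon>] d unfolding e by simp
      qed
    qed
  qed
qed

text \<open>Reflection in the last direction exchanges the two faces, which differ only at their
  first vertices.\<close>

lemma Rel_sym:
  assumes "Rel (Suc k) x y" shows "Rel (Suc k) y x"
proof -
  let ?w = "\<lambda>\<epsilon>. if \<epsilon> = {} then x else y"
  let ?w' = "\<lambda>\<epsilon>. ?w ((\<epsilon> - {Suc k}) \<union> ({Suc k} - \<epsilon>))"
  have "cube (Suc k) ?w'"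
    using assms unfolding Rel_def by (rule cube_reflect) (auto simp: vertices_def)
  then have "Rel (Suc k) (?w' {}) (?w' {Suc k})"
    by (rule Rel_if_cube) (auto simp: vertices_def)
  then show ?thesis by simp
qed

text \<open>Off \<open>{}\<close>, \<open>r\<close> carries \<open>x\<close> to \<open>y\<close> and
  \<open>r'\<close> carries \<open>z\<close> to \<open>y\<close>. Since \<open>u\<close> fixes
  \<open>z\<close>, the sandwiched \<open>r'\<close> can be inverted at \<open>z\<close>; following
  \<open>r\<close> and then \<open>U\<close> by this inverse carries \<open>x\<close> to
  \<open>z\<close> off \<open>{}\<close> and keeps \<open>x\<close> at \<open>{}\<close>.\<close>

lemma Rel_trans:
  assumes xy: "Rel (Suc k) x y" and yz: "Rel (Suc k) y z"
  shows "Rel (Suc k) x z"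
proof -
  let ?d = "Suc k"
  obtain r where r: "r \<in> E" "\<And>\<epsilon>. \<epsilon> \<in> vertices ?d \<Longrightarrow> r \<epsilon> (if \<epsilon> = {} then y else x) = y"
    using cube_recurrent[OF Rel_sym[OF xy, unfolded Rel_def]] by auto
  obtain r' where r': "r' \<in> E" "\<And>\<epsilon>. \<epsilon> \<in> vertices ?d \<Longrightarrow> r' \<epsilon> (if \<epsilon> = {} then y else z) = y"
    using cube_recurrent[OF yz[unfolded Rel_def]] by auto
  obtain u where u: "idempotent_zflow K a u" "u z = z"
    using fixing_idempotent[OF Rel_K1[OF Rel_sym[OF yz]]] by blast
  interpret idempotent_zflow K a u by (rule u)
  let ?p = "U \<odot> r' \<odot> U"
  obtain g where g: "Grp g" "g \<odot> ?p = U" using Grp_inverse[OF Grp_sandwich[OF r'(1)]] by blast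
  have "g \<odot> U \<odot> r \<in> E" using g(1) r(1) U_E E.closed by (simp add: Grp_def)
  then have "cube ?d (\<lambda>\<epsilon>. (g \<odot> U \<odot> r) \<epsilon> x)"
    using cube_E[OF cube_diag[OF Rel_K1[OF xy]]] by blast
  then show ?thesis unfolding Rel_def
  proof (rule cube_cong)
    fix \<epsilon> assume \<epsilon>: "\<epsilon> \<in> vertices ?d"
    show "(g \<odot> U \<odot> r) \<epsilon> x = (if \<epsilon> = {} then x else z)"
    proof (cases "\<epsilon> = {}")
      case True
      then show ?thesis using E_trivial[OF \<open>g \<odot> U \<odot> r \<in> E\<close>, of "{}"] by simp
    next
      case False
      have "(g \<odot> ?p) \<epsilon> z = z"
        using False vertices_finite[OF \<epsilon>] u(2) unfolding g(2) by (simp add: idem_ext_def)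
      moreover have "r' \<epsilon> z = y" "r \<epsilon> x = y" using r(2)[OF \<epsilon>] r'(2)[OF \<epsilon>] False by simp_all
      ultimately show ?thesis
        using False vertices_finite[OF \<epsilon>] u(2) by (simp add: pcomp_def idem_ext_def)
    qed
  qed
qed

lemma Rel_translate: "Rel d x y \<Longrightarrow> Rel d (a n x) (a n y)"
  unfolding Rel_def
  by (drule cube_translate[of _ _ n "\<lambda>_. 0"]) (auto simp: lin_zero elim: cube_cong)

lemma Rel_any_vertex:
  assumes "Rel d x y" "\<sigma> \<in> vertices d"
  shows "cube d (\<lambda>\<epsilon>. if \<epsilon> = \<sigma> then x else y)"
  using cube_reflect[OF assms(1)[unfolded Rel_def] assms(2)]
  by (rule cube_cong) auto

lemma Rel_closed:
  assumes "\<And>i. Rel d (x i) (y i)" "x \<longlonglongrightarrow> l" "y \<longlonglongrightarrow> m"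
  shows "Rel d l m"
  unfolding Rel_def
proof (rule cube_approx)
  fix e :: real assume e: "e > 0"
  have "\<forall>\<^sub>F i in sequentially. dist (x i) l < e \<and> dist (y i) m < e"
    using tendstoD[OF assms(2) e] tendstoD[OF assms(3) e] by (rule eventually_conj)
  then obtain i where "dist (x i) l < e" "dist (y i) m < e"
    using eventually_happens by force
  then show "\<exists>w'. cube d w' \<and> (\<forall>\<epsilon>\<in>vertices d. dist (w' \<epsilon>) (if \<epsilon> = {} then l else m) < e)"
    using assms(1)[of i] unfolding Rel_def by (intro exI[of _ "\<lambda>\<epsilon>. if \<epsilon> = {} then x i else y i"]) auto
qed

end

section \<open>Cubes as limits of sequences\<close>

context zflow
begin

lemma closed_K: "closed K" using compact_K by (rule compact_imp_closed)

lemma a_inverse: "a (- n) (a n x) = x" "a n (a (- n) x) = x"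
  by (simp_all add: a_0 flip: a_add)

lemma cube_limit:
  assumes "\<And>i. cube d (w i)" "\<And>\<epsilon>. \<epsilon> \<in> vertices d \<Longrightarrow> (\<lambda>i. w i \<epsilon>) \<longlonglongrightarrow> l \<epsilon>"
  shows "cube d l"
proof (rule cube_approx)
  fix e :: real assume e: "e > 0"
  have "\<forall>\<^sub>F i in sequentially. \<forall>\<epsilon>\<in>vertices d. dist (w i \<epsilon>) (l \<epsilon>) < e"
    by (rule eventually_ball_finite) (use tendstoD[OF assms(2) e] in auto)
  then obtain i where "\<forall>\<epsilon>\<in>vertices d. dist (w i \<epsilon>) (l \<epsilon>) < e"
    using eventually_happens'[OF sequentially_bot] by blast
  then show "\<exists>w'. cube d w' \<and> (\<forall>\<epsilon>\<in>vertices d. dist (w' \<epsilon>) (l \<epsilon>) < e)" using assms(1) by blast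
qed

text \<open>For a fixed approximation only finitely many continuous maps are involved, so the base
  point can be moved slightly into any dense set. This later places base points in
  \<open>Xc\<close>, whose points remain in \<open>Xc\<close> under the action.\<close>

lemma cube_sequence:
  assumes w: "cube d w" and D: "D \<subseteq> K" "\<And>y e. y \<in> K \<Longrightarrow> e > 0 \<Longrightarrow> \<exists>z\<in>D. dist z y < e"
  obtains N x where "\<forall>i::nat. x i \<in> D"
    "\<forall>\<epsilon>\<in>vertices d. (\<lambda>i. a (lin (N i) \<epsilon>) (x i)) \<longlonglongrightarrow> w \<epsilon>"
proof -
  have 1: "\<exists>n. \<exists>z\<in>D. \<forall>\<epsilon>\<in>vertices d. dist (a (lin n \<epsilon>) z) (w \<epsilon>) < e" if e: "e > 0" for e
  proof -
    obtain n y where ny: "y \<in> K" "\<And>\<epsilon>. \<epsilon> \<in> vertices d \<Longrightarrow> dist (a (lin n \<epsilon>) y) (w \<epsilon>) < e/2"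
      using cubeE[OF w half_gt_zero[OF e]] by blast
    obtain \<delta> where \<delta>: "\<delta> > 0" "\<And>\<epsilon> z. \<epsilon> \<in> vertices d \<Longrightarrow> z \<in> K \<Longrightarrow> dist z y < \<delta> \<Longrightarrow>
        dist (a (lin n \<epsilon>) z) (a (lin n \<epsilon>) y) < e/2"
      using a_equicontinuous[OF half_gt_zero[OF e], where d = d and w = "\<lambda>_. y" and f = "lin n"] ny(1) by blast
    obtain z where z: "z \<in> D" "dist z y < \<delta>" using D(2)[OF ny(1) \<delta>(1)] by blast
    have "dist (a (lin n \<epsilon>) z) (w \<epsilon>) < e" if \<epsilon>: "\<epsilon> \<in> vertices d" for \<epsilon>
      using ny(2)[OF \<epsilon>] \<delta>(2)[OF \<epsilon> subsetD[OF D(1) z(1)] z(2)]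
        dist_triangle[of "a (lin n \<epsilon>) z" "w \<epsilon>" "a (lin n \<epsilon>) y"] by simp
    then show ?thesis using z(1) by blast
  qed
  have "\<exists>n. \<exists>z\<in>D. \<forall>\<epsilon>\<in>vertices d. dist (a (lin n \<epsilon>) z) (w \<epsilon>) < inverse (Suc m)" for m
    by (rule 1[of "inverse (Suc m)"]) simp
  then obtain N x where Nx: "\<And>m. x m \<in> D"
      "\<And>m \<epsilon>. \<epsilon> \<in> vertices d \<Longrightarrow> dist (a (lin (N m) \<epsilon>) (x m)) (w \<epsilon>) < inverse (Suc m)"
    by metis
  show ?thesis
  proof (rule that[of x N], intro allI Nx(1), intro ballI)
    fix \<epsilon> assume \<epsilon>: "\<epsilon> \<in> vertices d"
    have "(\<lambda>m. dist (a (lin (N m) \<epsilon>) (x m)) (w \<epsilon>)) \<longlonglongrightarrow> 0"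
      by (rule tendsto_sandwich[OF _ _ tendsto_const LIMSEQ_inverse_real_of_nat])
        (use Nx(2)[OF \<epsilon>] in \<open>auto intro!: always_eventually less_imp_le\<close>)
    then show "(\<lambda>m. a (lin (N m) \<epsilon>) (x m)) \<longlonglongrightarrow> w \<epsilon>" by (rule iffD2[OF tendsto_dist_iff])
  qed
qed

lemma cube_of_sequence:
  assumes x: "\<And>i::nat. x i \<in> K"
    and lim: "\<And>\<epsilon>. \<epsilon> \<in> vertices d \<Longrightarrow> (\<lambda>i. a (lin (N i) \<epsilon>) (x i)) \<longlonglongrightarrow> w \<epsilon>"
  shows "cube d w"
  by (rule cube_limit[OF _ lim]) (use cube_translate[OF cube_diag[OF x], of d 0] in simp_all)

lemma a_tendsto:
  assumes "\<And>i::nat. x i \<in> K" "x \<longlonglongrightarrow> l"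
  shows "(\<lambda>i. a s (x i)) \<longlonglongrightarrow> a s l"
proof -
  have "l \<in> K" using closed_sequentially[OF closed_K] assms by blast
  then show ?thesis using a_cont[of s] assms unfolding continuous_on_sequentially o_def by blast
qed

end

section \<open>The almost one-to-one modification\<close>

text \<open>Points of \<open>X'\<close> are pairs of a point of \<open>K\<close> and a real sequence, interleaved.\<close>

definition pt :: "(nat \<Rightarrow> real) \<Rightarrow> (nat \<Rightarrow> real) \<Rightarrow> nat \<Rightarrow> real" where
  "pt x h j = (if even j then x (j div 2) else h (j div 2))"

definition prX :: "(nat \<Rightarrow> real) \<Rightarrow> nat \<Rightarrow> real" where "prX w j = w (2 * j)"
definition prY :: "(nat \<Rightarrow> real) \<Rightarrow> nat \<Rightarrow> real" where "prY w j = w (2 * j + 1)"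

lemma prX_pt [simp]: "prX (pt x h) = x" and prY_pt [simp]: "prY (pt x h) = h"
  by (auto simp: pt_def prX_def prY_def fun_eq_iff)

lemma pt_pr [simp]: "pt (prX w) (prY w) = w"
proof
  fix j show "pt (prX w) (prY w) j = w j"
    by (cases "even j") (auto simp: pt_def prX_def prY_def elim!: oddE evenE)
qed

lemma tendsto_pt_iff:
  "(f \<longlongrightarrow> w) F \<longleftrightarrow> ((\<lambda>i. prX (f i)) \<longlongrightarrow> prX w) F \<and> ((\<lambda>i. prY (f i)) \<longlongrightarrow> prY w) F"
proof
  assume "(f \<longlongrightarrow> w) F"
  then have "((\<lambda>x. f x i) \<longlongrightarrow> w i) F" for i unfolding tendsto_fun_iff by blast
  then show "((\<lambda>i. prX (f i)) \<longlongrightarrow> prX w) F \<and> ((\<lambda>i. prY (f i)) \<longlongrightarrow> prY w) F"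
    unfolding tendsto_fun_iff prX_def prY_def by blast
next
  assume "((\<lambda>i. prX (f i)) \<longlongrightarrow> prX w) F \<and> ((\<lambda>i. prY (f i)) \<longlongrightarrow> prY w) F"
  then have *: "((\<lambda>x. f x (2 * i)) \<longlongrightarrow> w (2 * i)) F" "((\<lambda>x. f x (2 * i + 1)) \<longlongrightarrow> w (2 * i + 1)) F" for i
    unfolding tendsto_fun_iff[of _ "prX w"] tendsto_fun_iff[of _ "prY w"] prX_def prY_def by blast+
  have "((\<lambda>x. f x j) \<longlongrightarrow> w j) F" for j
    by (cases "even j") (use *[of "j div 2"] in \<open>auto elim!: oddE evenE\<close>)
  then show "(f \<longlongrightarrow> w) F" unfolding tendsto_fun_iff by blast
qed

lemmas tendsto_ptI = iffD2[OF tendsto_pt_iff, OF conjI]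
lemmas tendsto_prX = iffD1[OF tendsto_pt_iff, THEN conjunct1]
lemmas tendsto_prY = iffD1[OF tendsto_pt_iff, THEN conjunct2]

lemma continuous_on_prX: "continuous_on S prX"
  unfolding prX_def
  by (rule continuous_on_coordinatewise_then_product)
    (rule continuous_on_product_then_coordinatewise[OF continuous_on_id])

lemma continuous_on_prY: "continuous_on S prY"
  unfolding prY_def
  by (rule continuous_on_coordinatewise_then_product)
    (rule continuous_on_product_then_coordinatewise[OF continuous_on_id])

text \<open>Real sequences are also indexed by pairs of a natural number and an integer; \<open>shift\<close> acts
  on the second component.\<close>

definition enc :: "nat \<Rightarrow> int \<Rightarrow> nat" where "enc n t = prod_encode (n, int_encode t)"
definition dec1 :: "nat \<Rightarrow> nat" where "dec1 j = fst (prod_decode j)"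
definition dec2 :: "nat \<Rightarrow> int" where "dec2 j = int_decode (snd (prod_decode j))"

lemma enc_dec [simp]: "dec1 (enc n t) = n" "dec2 (enc n t) = t" "enc (dec1 j) (dec2 j) = j"
  by (simp_all add: enc_def dec1_def dec2_def)

definition shift :: "int \<Rightarrow> (nat \<Rightarrow> real) \<Rightarrow> nat \<Rightarrow> real" where
  "shift s h j = h (enc (dec1 j) (dec2 j + s))"

lemma shift_0: "shift 0 h = h" by (simp add: shift_def fun_eq_iff)

lemma shift_add: "shift (s + t) h = shift s (shift t h)"
  by (simp add: shift_def fun_eq_iff add.assoc)

lemma continuous_on_shift: "continuous_on S (shift s)"
  unfolding shift_def
  by (rule continuous_on_coordinatewise_then_product)
    (rule continuous_on_product_then_coordinatewise[OF continuous_on_id])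

lemma tendsto_shift: "h \<longlonglongrightarrow> l \<Longrightarrow> (\<lambda>i. shift s (h i)) \<longlonglongrightarrow> shift s l"
  unfolding tendsto_fun_iff shift_def by blast

lemma infdist_compact:
  assumes "compact A" "A \<noteq> {}"
  shows "\<exists>z\<in>A. dist y z = infdist y A"
proof -
  have "continuous_on A (dist y)" by (intro continuous_intros)
  then obtain z where z: "z \<in> A" "\<forall>x\<in>A. dist y z \<le> dist y x"
    using continuous_attains_inf[OF assms] by blast
  have "dist y z \<le> infdist y A"
    unfolding infdist_notempty[OF assms(2)] using z(2) by (intro cINF_greatest[OF assms(2)]) blast
  then show ?thesis using z(1) infdist_le[OF z(1), of y] by (intro bexI[of _ z]) auto
qed

text \<open>The sequence \<open>e\<close> is dense in the whole type; distances to its members then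
  decide how close an arbitrary point is to a class.\<close>

locale odiagram = minimal_zflow K a for K :: "(nat \<Rightarrow> real) set" and a +
  fixes k :: nat and e :: "nat \<Rightarrow> nat \<Rightarrow> real"
  assumes e_dense: "0 < \<delta> \<Longrightarrow> \<exists>n. dist (e n) x < \<delta>"
begin

abbreviation d where "d \<equiv> Suc k"

definition cls :: "(nat \<Rightarrow> real) \<Rightarrow> (nat \<Rightarrow> real) set" where
  "cls x = {y. Rel d x y}"

lemma Rel_K2: "Rel d x y \<Longrightarrow> y \<in> K" by (rule Rel_K1[OF Rel_sym])

lemma cls_self: "x \<in> K \<Longrightarrow> x \<in> cls x" by (simp add: cls_def Rel_refl)

lemma cls_eq: "Rel d x y \<Longrightarrow> cls x = cls y"
  unfolding cls_def using Rel_sym Rel_trans by blast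

lemma cls_K: "cls x \<subseteq> K" using Rel_K2 by (auto simp: cls_def)

lemma cls_translate: "cls (a s x) = a s ` cls x"
proof
  show "cls (a s x) \<subseteq> a s ` cls x"
  proof
    fix y assume "y \<in> cls (a s x)"
    then have "Rel d (a (- s) (a s x)) (a (- s) y)" unfolding cls_def by (auto intro: Rel_translate)
    then have "a (- s) y \<in> cls x" by (simp add: a_inverse cls_def)
    then show "y \<in> a s ` cls x" by (rule rev_image_eqI) (simp add: a_inverse)
  qed
  show "a s ` cls x \<subseteq> cls (a s x)" by (auto simp: cls_def intro: Rel_translate)
qed

lemma compact_cls: "compact (cls x)"
proof -
  have "closed (cls x)"
    unfolding closed_sequential_limits
  proof (intro allI impI)
    fix y l assume y: "(\<forall>n. y n \<in> cls x) \<and> y \<longlonglongrightarrow> l"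
    have "Rel d x l" by (rule Rel_closed[where x = "\<lambda>_. x" and y = y]) (use y in \<open>auto simp: cls_def\<close>)
    then show "l \<in> cls x" by (simp add: cls_def)
  qed
  then have "compact (K \<inter> cls x)" by (rule compact_Int_closed[OF compact_K])
  then show ?thesis using cls_K[of x] by (simp add: Int_absorb1)
qed

definition D :: "nat \<Rightarrow> (nat \<Rightarrow> real) \<Rightarrow> real" where
  "D n x = infdist (e n) (cls x)"

text \<open>\<open>H x\<close> records the classes along the whole two-sided orbit of \<open>x\<close>, each through its distances
  to the dense sequence \<open>e\<close>. In this way the induced homeomorphism becomes a shift.\<close>

definition H :: "(nat \<Rightarrow> real) \<Rightarrow> nat \<Rightarrow> real" where
  "H x j = D (dec1 j) (a (dec2 j) x)"

lemma H_translate: "H (a s x) = shift s (H x)"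
  by (simp add: H_def shift_def fun_eq_iff a_add)

lemma D_cong: "Rel d x y \<Longrightarrow> D n x = D n y" by (simp add: D_def cls_eq)

lemma H_cong: "Rel d x y \<Longrightarrow> H x = H y"
  unfolding H_def by (intro ext D_cong Rel_translate)

lemma D_attained:
  assumes "x \<in> K" obtains z where "Rel d x z" "dist (e n) z = D n x"
  using infdist_compact[OF compact_cls[of x], of "e n"] cls_self[OF assms]
  unfolding D_def cls_def by blast

text \<open>Nearest points in the classes of the \<open>x i\<close> accumulate at some point, which
  lies in the class of \<open>l\<close> because \<open>Rel\<close> is closed. In terms of distances
  this is upper semicontinuity of the class map.\<close>

lemma D_lsc:
  assumes x: "\<And>i. x i \<in> K" "x \<longlonglongrightarrow> l" and c: "\<And>i. D n (x i) \<le> c"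
  shows "D n l \<le> c"
proof -
  have "\<exists>z. Rel d (x i) z \<and> dist (e n) z \<le> c" for i
    using D_attained[OF x(1), of i n] c[of i] by metis
  then obtain z where z: "\<And>i. Rel d (x i) (z i)" "\<And>i. dist (e n) (z i) \<le> c" by metis
  have "\<forall>i. z i \<in> K" using z(1) Rel_K2 by blast
  then obtain y r where r: "strict_mono r" "(z \<circ> r) \<longlonglongrightarrow> y"
    using compact_K unfolding compact_def by blast
  have "Rel d l y"
    by (rule Rel_closed[where x = "x \<circ> r" and y = "z \<circ> r"])
      (use z(1) r LIMSEQ_subseq_LIMSEQ[OF x(2) r(1)] in auto)
  moreover have "dist (e n) y \<le> c"
    by (rule LIMSEQ_le_const2[OF tendsto_dist[OF tendsto_const r(2)]]) (use z(2) in auto)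
  ultimately show ?thesis unfolding D_def cls_def by (intro infdist_le2) auto
qed

section \<open>Baire category on the space of classes\<close>

definition sat_open :: "(nat \<Rightarrow> real) set \<Rightarrow> bool" where
  "sat_open V \<longleftrightarrow> openin (top_of_set K) V \<and> (\<forall>x\<in>V. cls x \<subseteq> V)"

lemma sat_open_K: "sat_open V \<Longrightarrow> V \<subseteq> K"
  unfolding sat_open_def using openin_imp_subset by blast

lemma sat_open_Union: "(\<And>V. V \<in> F \<Longrightarrow> sat_open V) \<Longrightarrow> sat_open (\<Union>F)"
  unfolding sat_open_def by (meson UnionE Union_upper openin_Union order_trans)

lemma sat_open_translate:
  assumes "sat_open V" shows "sat_open (a s ` V)"
proof -
  have VK: "V \<subseteq> K" using assms by (rule sat_open_K)
  have eq: "a s ` V = K \<inter> a (- s) -` V"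
  proof
    show "a s ` V \<subseteq> K \<inter> a (- s) -` V" using VK by (auto simp: a_inverse intro: a_in)
    show "K \<inter> a (- s) -` V \<subseteq> a s ` V" by (auto simp: a_inverse intro!: rev_image_eqI[of "a (- s) _"])
  qed
  have "openin (top_of_set K) (a s ` V)"
    unfolding eq using assms a_cont[of "- s"] a_in
    by (intro continuous_openin_preimage[where T = K]) (auto simp: sat_open_def)
  moreover have "cls y \<subseteq> a s ` V" if "y \<in> a s ` V" for y
  proof -
    obtain x where x: "y = a s x" "x \<in> V" using \<open>y \<in> a s ` V\<close> by (rule imageE)
    have "cls x \<subseteq> V" using assms x(2) unfolding sat_open_def by blast
    then show ?thesis unfolding x(1) cls_translate by (rule image_mono)
  qed
  ultimately show ?thesis by (simp add: sat_open_def)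
qed

text \<open>Density is given against saturated open sets only, so the category theorem is applied to
  the quotient by \<open>Rel\<close>. The quotient is compact, and Hausdorff because the class map
  is closed; saturation allows a class in the intersection to be pulled back to a point.\<close>

lemma Baire_sat_open:
  assumes F: "countable F" "\<And>V. V \<in> F \<Longrightarrow> sat_open V" "K \<noteq> {}"
    and dense: "\<And>V W. V \<in> F \<Longrightarrow> sat_open W \<Longrightarrow> W \<noteq> {} \<Longrightarrow> V \<inter> W \<noteq> {}"
  shows "K \<inter> \<Inter>F \<noteq> {}"
proof -
  define R where "R = {(x, y). Rel d x y}"
  have R: "R `` {x} = cls x" for x by (simp add: R_def cls_def Image_def)
  define Y where "Y = quotient_space (top_of_set K) R"
  have qm: "quotient_map (top_of_set K) Y cls"
    using quotient_map_quotient_space[of "top_of_set K" R] by (simp add: R Y_def)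
  have topY: "topspace Y = cls ` K" using quotient_imp_surjective_map[OF qm] by simp
  have clseq: "cls x = cls y \<longleftrightarrow> Rel d x y" if "x \<in> K" "y \<in> K" for x y
    using cls_self[OF that(2)] cls_eq[of x y] by (auto simp: cls_def)
  \<comment> \<open>The saturation of a closed set is closed: related partners of a convergent
    sequence subconverge by compactness, and \<open>Rel\<close> is closed.\<close>
  have closed: "closed_map (top_of_set K) Y cls"
    unfolding closed_map_def
  proof (intro allI impI)
    fix S assume S: "closedin (top_of_set K) S"
    have SK: "S \<subseteq> K" using S closedin_imp_subset by blast
    have cS: "closed S" using S closed_K closedin_closed_trans by blast
    have eq: "{x \<in> topspace (top_of_set K). cls x \<in> cls ` S} = {x \<in> K. \<exists>y\<in>S. Rel d x y}"
      using clseq SK by (auto simp: image_iff)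
    have "closed {x \<in> K. \<exists>y\<in>S. Rel d x y}"
      unfolding closed_sequential_limits
    proof (intro allI impI)
      fix x l assume x: "(\<forall>n. x n \<in> {x \<in> K. \<exists>y\<in>S. Rel d x y}) \<and> x \<longlonglongrightarrow> l"
      then obtain y where y: "\<And>n. y n \<in> S" "\<And>n. Rel d (x n) (y n)" by simp metis
      have "compact S" using cS SK compact_K by (metis compact_Int_closed inf.absorb_iff2)
      then obtain m r where r: "m \<in> S" "strict_mono r" "(y \<circ> r) \<longlonglongrightarrow> m"
        using y(1) unfolding compact_def by blast
      have "x \<longlonglongrightarrow> l" using x by blast
      have "Rel d l m"
        by (rule Rel_closed[where x = "x \<circ> r" and y = "y \<circ> r"])
          (use y r LIMSEQ_subseq_LIMSEQ[OF \<open>x \<longlonglongrightarrow> l\<close> r(2)] in auto)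
      then show "l \<in> {x \<in> K. \<exists>y\<in>S. Rel d x y}" using r(1) Rel_K1 by blast
    qed
    then have "closedin (top_of_set K) {x \<in> topspace (top_of_set K). cls x \<in> cls ` S}"
      unfolding eq by (intro closed_subset) auto
    moreover have "cls ` S \<subseteq> topspace Y" using SK topY by blast
    ultimately show "closedin Y (cls ` S)" using qm unfolding quotient_map_closedin by blast
  qed
  have met: "metrizable_space (top_of_set K)"
    by (intro metrizable_space_subtopology metrizable_space_euclidean)
  have H: "Hausdorff_space Y"
    using normal_Hausdorff_space_closed_continuous_map_image[of "top_of_set K" Y cls]
      metrizable_imp_normal_space[OF met] metrizable_imp_Hausdorff_space[OF met] closed
      quotient_imp_continuous_map[OF qm] quotient_imp_surjective_map[OF qm] by blast
  have "compact_space (top_of_set K)" using compact_K by (simp add: compact_space_subtopology)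
  then have cY: "compact_space Y"
    using image_compactin[OF _ quotient_imp_continuous_map[OF qm], of K] topY
    by (simp add: compact_space_def)
  have pre: "{x \<in> K. cls x \<in> cls ` V} = V" if "sat_open V" for V
  proof
    show "V \<subseteq> {x \<in> K. cls x \<in> cls ` V}" using sat_open_K[OF that] by blast
    show "{x \<in> K. cls x \<in> cls ` V} \<subseteq> V"
    proof
      fix x assume "x \<in> {x \<in> K. cls x \<in> cls ` V}"
      then obtain y where "x \<in> K" "y \<in> V" "cls x = cls y" by blast
      then show "x \<in> V" using cls_self[of x] that unfolding sat_open_def by blast
    qed
  qed
  have "Y closure_of \<Inter>((`) cls ` F) = topspace Y"
  proof (rule Baire_category)
    show "completely_metrizable_space Y \<or> locally_compact_space Y \<and> regular_space Y"
      using cY H compact_imp_locally_compact_space compact_Hausdorff_imp_regular_space by blast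
    show "countable ((`) cls ` F)" using F(1) by simp
    fix T assume "T \<in> (`) cls ` F"
    then obtain V where V: "V \<in> F" "T = cls ` V" by blast
    have sV: "sat_open V" by (rule F(2)[OF V(1)])
    have oT: "openin Y T"
    proof -
      have "cls ` V \<subseteq> topspace Y" using sat_open_K[OF sV] topY by blast
      moreover have "openin (top_of_set K) {x \<in> topspace (top_of_set K). cls x \<in> cls ` V}"
        using pre[OF sV] sV by (simp add: sat_open_def)
      ultimately show ?thesis using qm unfolding quotient_map_def V(2) by blast
    qed
    moreover have "T \<inter> W \<noteq> {}" if W: "openin Y W" "W \<noteq> {}" for W
    proof -
      let ?W = "{x \<in> K. cls x \<in> W}"
      have "openin (top_of_set K) ?W"
        using openin_continuous_map_preimage[OF quotient_imp_continuous_map[OF qm] W(1)] by simp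
      moreover have "cls x \<subseteq> ?W" if "x \<in> ?W" for x
        using that cls_eq[of x] Rel_K2 by (auto simp: cls_def)
      ultimately have sW: "sat_open ?W" by (simp add: sat_open_def)
      have "?W \<noteq> {}" using W openin_subset[OF W(1)] topY by auto
      then have "V \<inter> ?W \<noteq> {}" by (rule dense[OF V(1) sW])
      then show ?thesis using V(2) by auto
    qed
    ultimately show "openin Y T \<and> Y closure_of T = topspace Y"
      by (metis dense_intersects_open inf.commute)
  qed
  then have "\<Inter>((`) cls ` F) \<inter> topspace Y \<noteq> {}"
    using F(3) topY by (metis Int_empty_right closure_of_empty closure_of_restrict image_is_empty inf_commute)
  then have "\<exists>x\<in>K. \<forall>V\<in>F. cls x \<in> cls ` V" unfolding topY by fastforce
  then obtain x where x: "x \<in> K" "\<And>V. V \<in> F \<Longrightarrow> cls x \<in> cls ` V" by blast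
  have "x \<in> V" if "V \<in> F" for V using pre[OF F(2)[OF that]] x that by blast
  then show ?thesis using x(1) by blast
qed

text \<open>\<open>Oq n q s\<close> removes from \<open>K\<close> the boundary, in the quotient by \<open>Rel\<close>, of the closed set where
  \<open>D n \<circ> a s\<close> is at most \<open>q\<close>. Hence \<open>H\<close> is continuous at the points of \<open>Xc\<close>.\<close>

definition Oq where
  "Oq n q s = {x \<in> K. D n (a s x) \<le> q \<longrightarrow> (\<exists>V. sat_open V \<and> x \<in> V \<and> (\<forall>y\<in>V. D n (a s y) \<le> q))}"

definition Xc where "Xc = {x \<in> K. \<forall>n s. \<forall>q\<in>\<rat>. x \<in> Oq n q s}"

lemma sat_open_complement: "sat_open {x \<in> K. \<not> D n (a s x) \<le> q}"
proof -
  have "closed {x \<in> K. D n (a s x) \<le> q}"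
    unfolding closed_sequential_limits
  proof (intro allI impI)
    fix x l assume "(\<forall>i. x i \<in> {x \<in> K. D n (a s x) \<le> q}) \<and> x \<longlonglongrightarrow> l"
    then have x: "\<And>i. x i \<in> K" "\<And>i. D n (a s (x i)) \<le> q" "x \<longlonglongrightarrow> l" by auto
    have "l \<in> K" using closed_sequentially[OF closed_K] x by blast
    moreover have "D n (a s l) \<le> q"
      by (rule D_lsc[OF _ a_tendsto[OF x(1,3)]]) (use x a_in in auto)
    ultimately show "l \<in> {x \<in> K. D n (a s x) \<le> q}" by simp
  qed
  then have "openin (top_of_set K) (K - {x \<in> K. D n (a s x) \<le> q})"
    by (simp add: openin_diff closedin_subset closed_subset)
  moreover have "K - {x \<in> K. D n (a s x) \<le> q} = {x \<in> K. \<not> D n (a s x) \<le> q}" by auto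
  moreover have "cls x \<subseteq> {x \<in> K. \<not> D n (a s x) \<le> q}" if "x \<in> {x \<in> K. \<not> D n (a s x) \<le> q}" for x
    using that D_cong[OF Rel_translate, of x _ n s] Rel_K2 by (auto simp: cls_def)
  ultimately show ?thesis by (simp add: sat_open_def)
qed

lemma Oq_Union: "Oq n q s = \<Union>({{x \<in> K. \<not> D n (a s x) \<le> q}} \<union> {V. sat_open V \<and> (\<forall>y\<in>V. D n (a s y) \<le> q)})"
  unfolding Oq_def using sat_open_K by blast

lemma sat_open_Oq: "sat_open (Oq n q s)"
  unfolding Oq_Union by (rule sat_open_Union) (auto simp: sat_open_complement)

text \<open>Either \<open>W\<close> lies in the sublevel set and is itself a witness for its
  interior, or \<open>W\<close> meets the complement.\<close>

lemma Oq_dense: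
  assumes "sat_open W" "W \<noteq> {}" shows "Oq n q s \<inter> W \<noteq> {}"
proof (cases "\<forall>y\<in>W. D n (a s y) \<le> q")
  case True
  then have "W \<subseteq> Oq n q s" using assms sat_open_K[OF assms(1)] unfolding Oq_def by blast
  then show ?thesis using assms(2) by blast
next
  case False
  then show ?thesis using sat_open_K[OF assms(1)] unfolding Oq_def by blast
qed

lemma Oq_translate:
  assumes "x \<in> Oq n q (s + t)" shows "a t x \<in> Oq n q s"
proof -
  have x: "x \<in> K" using assms by (simp add: Oq_def)
  show ?thesis unfolding Oq_def
  proof (intro CollectI conjI impI)
    show "a t x \<in> K" using x by (rule a_in)
    assume "D n (a s (a t x)) \<le> q"
    then obtain V where V: "sat_open V" "x \<in> V" "\<And>y. y \<in> V \<Longrightarrow> D n (a (s + t) y) \<le> q"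
      using assms unfolding Oq_def by (auto simp flip: a_add)
    show "\<exists>V. sat_open V \<and> a t x \<in> V \<and> (\<forall>y\<in>V. D n (a s y) \<le> q)"
      using sat_open_translate[OF V(1), of t] V(2,3)
      by (intro exI[of _ "a t ` V"]) (auto simp flip: a_add)
  qed
qed

lemma Xc_K: "x \<in> Xc \<Longrightarrow> x \<in> K" by (simp add: Xc_def)

lemma Xc_translate: "x \<in> Xc \<Longrightarrow> a t x \<in> Xc"
  unfolding Xc_def using Oq_translate a_in by blast

lemma Xc_Rel: "x \<in> Xc \<Longrightarrow> Rel d x y \<Longrightarrow> y \<in> Xc"
  using sat_open_Oq Rel_K2 unfolding Xc_def sat_open_def cls_def by blast

lemma Xc_nonempty:
  assumes "K \<noteq> {}" shows "Xc \<noteq> {}"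
proof -
  have "K \<inter> \<Inter>((\<lambda>(n, q, s). Oq n q s) ` (UNIV \<times> \<rat> \<times> UNIV)) \<noteq> {}"
  proof (rule Baire_sat_open)
    show "countable ((\<lambda>(n, q, s). Oq n q s) ` (UNIV \<times> \<rat> \<times> UNIV))"
      by (intro countable_image countable_SIGMA countable_rat) auto
    show "\<And>V. V \<in> (\<lambda>(n, q, s). Oq n q s) ` (UNIV \<times> \<rat> \<times> UNIV) \<Longrightarrow> sat_open V"
      using sat_open_Oq by auto
    show "V \<inter> W \<noteq> {}" if "V \<in> (\<lambda>(n, q, s). Oq n q s) ` (UNIV \<times> \<rat> \<times> UNIV)" "sat_open W" "W \<noteq> {}" for V W
    proof -
      from that(1) obtain n q s where "V = Oq n q s" by auto
      then show ?thesis using Oq_dense[OF that(2,3)] by simp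
    qed
  qed (rule assms)
  then show ?thesis unfolding Xc_def by auto
qed

text \<open>Density in \<open>K\<close>, and not only in the space of classes, comes from
  minimality: \<open>Xc\<close> is nonempty and invariant, so it contains a dense orbit.\<close>

lemma Xc_dense:
  assumes "y \<in> K" "\<delta> > 0" shows "\<exists>z\<in>Xc. dist z y < \<delta>"
proof -
  obtain x where x: "x \<in> Xc" using Xc_nonempty assms(1) by blast
  then obtain n where "dist (a n x) y < \<delta>" using a_dense[OF Xc_K[OF x] assms] by blast
  then show ?thesis using Xc_translate[OF x] by blast
qed

text \<open>Lower semicontinuity of each coordinate holds at every point of \<open>K\<close>. The
  upper bound is where \<open>Xc\<close> enters: a sublevel set with rational bound that contains
  \<open>l\<close> also contains a saturated neighbourhood of \<open>l\<close>.\<close>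

lemma H_continuous:
  assumes l: "l \<in> Xc" and x: "\<And>i. x i \<in> K" "x \<longlonglongrightarrow> l"
  shows "(\<lambda>i. H (x i)) \<longlonglongrightarrow> H l"
  unfolding tendsto_fun_iff
proof
  fix j
  define n where "n = dec1 j"
  define s where "s = dec2 j"
  have evV: "\<forall>\<^sub>F i in sequentially. x i \<in> V" if V: "sat_open V" "l \<in> V" for V
  proof -
    obtain G where G: "open G" "V = K \<inter> G"
      using V(1) unfolding sat_open_def by (auto simp: openin_open)
    have "\<forall>\<^sub>F i in sequentially. x i \<in> G" using topological_tendstoD[OF x(2) G(1)] V(2) G(2) by simp
    then show ?thesis using x(1) G(2) by (auto elim: eventually_mono)
  qed
  have "(\<lambda>i. D n (a s (x i))) \<longlonglongrightarrow> D n (a s l)"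
  proof (rule order_tendstoI)
    fix c assume "c < D n (a s l)"
    then have "\<forall>\<^sub>F i in sequentially. x i \<in> {x \<in> K. \<not> D n (a s x) \<le> c}"
      by (intro evV sat_open_complement) (use Xc_K[OF l] in auto)
    then show "\<forall>\<^sub>F i in sequentially. c < D n (a s (x i))" by (auto elim: eventually_mono)
  next
    fix c assume "D n (a s l) < c"
    then obtain q where q: "q \<in> \<rat>" "D n (a s l) < q" "q < c" using Rats_dense_in_real by blast
    have "l \<in> Oq n q s" using l q(1) by (simp add: Xc_def)
    then obtain V where V: "sat_open V" "l \<in> V" "\<forall>y\<in>V. D n (a s y) \<le> q"
      using q(2) unfolding Oq_def by (auto simp: less_imp_le)
    show "\<forall>\<^sub>F i in sequentially. D n (a s (x i)) < c"
      using evV[OF V(1,2)] by (rule eventually_mono) (use V(3) q(3) in force)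
  qed
  then show "(\<lambda>i. H (x i) j) \<longlonglongrightarrow> H l j" by (simp add: H_def n_def s_def)
qed

end

section \<open>The modified systems \<open>X'\<close> and \<open>Y'\<close> and the lifting of
  cubes\<close>

context odiagram
begin

definition X' where "X' = closure ((\<lambda>x. pt x (H x)) ` Xc)"
definition Y' where "Y' = prY ` X'"

lemma Xc_subset: "Xc \<subseteq> K" using Xc_K by blast

lemma X'_sequence:
  assumes "w \<in> X'"
  obtains x where "\<And>i::nat. x i \<in> Xc" "x \<longlonglongrightarrow> prX w" "(\<lambda>i. H (x i)) \<longlonglongrightarrow> prY w"
proof -
  obtain v where v: "\<forall>i. v i \<in> (\<lambda>x. pt x (H x)) ` Xc" "v \<longlonglongrightarrow> w"
    using iffD1[OF closure_sequential assms[unfolded X'_def]] by blast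
  have "\<forall>i. \<exists>x. x \<in> Xc \<and> v i = pt x (H x)" using v(1) by blast
  then obtain x where x: "\<forall>i. x i \<in> Xc \<and> v i = pt (x i) (H (x i))" using choice[of "\<lambda>i x. x \<in> Xc \<and> v i = pt x (H x)"] by blast
  then have vx: "v = (\<lambda>i. pt (x i) (H (x i)))" by blast
  have "(\<lambda>i. prX (v i)) \<longlonglongrightarrow> prX w" "(\<lambda>i. prY (v i)) \<longlonglongrightarrow> prY w"
    using tendsto_prX[OF v(2)] tendsto_prY[OF v(2)] .
  then have "x \<longlonglongrightarrow> prX w" "(\<lambda>i. H (x i)) \<longlonglongrightarrow> prY w" by (simp_all add: vx)
  then show ?thesis using that[of x] x by blast
qed

lemma X'_limit:
  assumes "\<And>i::nat. v i \<in> X'" "v \<longlonglongrightarrow> w" shows "w \<in> X'"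
  by (rule closed_sequentially[of X' v w]) (use assms in \<open>simp_all add: X'_def\<close>)

lemma pt_in_X': "x \<in> Xc \<Longrightarrow> pt x (H x) \<in> X'"
  unfolding X'_def by (rule closure_subset[THEN subsetD]) (rule imageI)

lemma prX_X':
  assumes "w \<in> X'" shows "prX w \<in> K"
proof -
  obtain x where x: "\<And>i::nat. x i \<in> Xc" "x \<longlonglongrightarrow> prX w"
    using X'_sequence[OF assms] by blast
  show ?thesis by (rule closed_sequentially[OF closed_K _ x(2)]) (intro Xc_K x(1))
qed

text \<open>Continuity of \<open>H\<close> at the points of \<open>Xc\<close> leaves a single limit,
  so the fibre of \<open>prX\<close> over such a point is a singleton.\<close>

lemma prY_over_Xc:
  assumes "w \<in> X'" "prX w \<in> Xc" shows "prY w = H (prX w)"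
proof -
  obtain x where x: "\<And>i::nat. x i \<in> Xc" "x \<longlonglongrightarrow> prX w" "(\<lambda>i. H (x i)) \<longlonglongrightarrow> prY w"
    using X'_sequence[OF assms(1)] by blast
  have "(\<lambda>i. H (x i)) \<longlonglongrightarrow> H (prX w)" by (rule H_continuous[OF assms(2) Xc_K[OF x(1)] x(2)])
  then show ?thesis using x(3) LIMSEQ_unique by blast
qed

lemma compact_X': "compact X'"
proof -
  have "\<forall>n. \<exists>c. \<forall>z\<in>K. dist (e n) z \<le> c"
    using compact_imp_bounded[OF compact_K] bounded_any_center by blast
  from choice[OF this] obtain b where b: "\<forall>n. \<forall>z\<in>K. dist (e n) z \<le> b n" by (rule exE)
  \<comment> \<open>Even coordinates range over projections of \<open>K\<close>. An odd coordinate
    is a distance from some \<open>e n\<close> to a class, bounded by \<open>b n\<close> at all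
    times because orbits stay in \<open>K\<close>.\<close>
  let ?S = "\<lambda>j. if even j then (\<lambda>x. x (j div 2)) ` K else {0 .. b (dec1 (j div 2))}"
  have c: "compact (PiE UNIV ?S)"
  proof (rule compact_PiE_UNIV)
    fix j show "compact (?S j)"
      using compact_continuous_image[OF continuous_on_product_then_coordinatewise[OF continuous_on_id] compact_K]
      by simp
  qed
  have "pt x (H x) \<in> PiE UNIV ?S" if x: "x \<in> K" for x
  proof -
    have "H x j \<in> {0 .. b (dec1 j)}" for j
    proof -
      have "H x j \<le> dist (e (dec1 j)) (a (dec2 j) x)"
        unfolding H_def D_def by (intro infdist_le cls_self a_in x)
      also have "\<dots> \<le> b (dec1 j)" using b a_in[OF x] by blast
      finally show ?thesis by (simp add: H_def D_def infdist_nonneg)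
    qed
    then have "pt x (H x) j \<in> ?S j" for j using x unfolding pt_def by (cases "even j") simp_all
    then show ?thesis by (simp add: PiE_UNIV_domain)
  qed
  then have "(\<lambda>x. pt x (H x)) ` Xc \<subseteq> PiE UNIV ?S" by (intro image_subsetI) (simp add: Xc_K)
  then have "X' \<subseteq> PiE UNIV ?S"
    unfolding X'_def using compact_imp_closed[OF c] by (rule closure_minimal)
  moreover have "compact (PiE UNIV ?S \<inter> X')"
    by (rule compact_Int_closed[OF c]) (simp add: X'_def)
  ultimately show ?thesis by (simp add: Int_absorb1)
qed

text \<open>Since the fibre maps converge along \<open>H (x i) \<rightarrow> h\<close>, the extension \<open>prY\<close> is open.\<close>

lemma fibre_lift:
  assumes x: "\<And>i::nat. x i \<in> K" and h: "(\<lambda>i. H (x i)) \<longlonglongrightarrow> prY w" and w: "w \<in> X'"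
  obtains z where "\<And>i. Rel d (x i) (z i)" "z \<longlonglongrightarrow> prX w"
proof -
  let ?y = "prX w"
  obtain x' where x': "\<And>i::nat. x' i \<in> Xc" "x' \<longlonglongrightarrow> ?y" "(\<lambda>i. H (x' i)) \<longlonglongrightarrow> prY w"
    using X'_sequence[OF w] by blast
  have Hn: "H u (enc n 0) = D n u" for u n by (simp add: H_def a_0)
  \<comment> \<open>The entries at time 0 of \<open>prY w\<close> are limits of distances to the
    classes of the \<open>x' i\<close>. These classes contain the points \<open>x' i\<close>, which
    converge to \<open>?y\<close>, so the limits are at most the distances to \<open>?y\<close>
    itself.\<close>
  have le: "prY w (enc n 0) \<le> dist (e n) ?y" for n
  proof (rule LIMSEQ_le)
    show "(\<lambda>i. H (x' i) (enc n 0)) \<longlonglongrightarrow> prY w (enc n 0)" using x'(3) unfolding tendsto_fun_iff by blast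
    show "(\<lambda>i. dist (e n) (x' i)) \<longlonglongrightarrow> dist (e n) ?y" by (intro tendsto_intros x'(2))
    show "\<exists>N. \<forall>i\<ge>N. H (x' i) (enc n 0) \<le> dist (e n) (x' i)"
      unfolding Hn D_def using infdist_le[OF cls_self[OF Xc_K[OF x'(1)]]] by blast
  qed
  have lim: "(\<lambda>i. infdist ?y (cls (x i))) \<longlonglongrightarrow> 0"
  proof (rule LIMSEQ_I)
    fix r :: real assume r: "0 < r"
    \<comment> \<open>Choosing \<open>e n\<close> near \<open>?y\<close> makes entry n of
      \<open>prY w\<close> small. Convergence of \<open>H (x i)\<close> then brings the class of
      \<open>x i\<close> near \<open>e n\<close>, and so near \<open>?y\<close>.\<close>
    obtain n where n: "dist (e n) ?y < r / 2" using e_dense[of "r / 2"] r by auto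
    have "(\<lambda>i. H (x i) (enc n 0)) \<longlonglongrightarrow> prY w (enc n 0)" using h unfolding tendsto_fun_iff by blast
    then have "\<forall>\<^sub>F i in sequentially. H (x i) (enc n 0) < r / 2"
      by (rule order_tendstoD(2)) (use le[of n] n in linarith)
    then obtain N where N: "\<And>i. i \<ge> N \<Longrightarrow> D n (x i) < r / 2"
      unfolding Hn eventually_sequentially by blast
    have "norm (infdist ?y (cls (x i)) - 0) < r" if "i \<ge> N" for i
      using N[OF that] infdist_triangle[of ?y "cls (x i)" "e n"] n infdist_nonneg[of ?y "cls (x i)"]
      by (simp add: D_def dist_commute)
    then show "\<exists>N. \<forall>i\<ge>N. norm (infdist ?y (cls (x i)) - 0) < r" by blast
  qed
  have "\<exists>z\<in>cls (x i). dist ?y z = infdist ?y (cls (x i))" for i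
    using cls_self[OF x] by (intro infdist_compact compact_cls) blast
  then obtain z where z: "\<And>i. z i \<in> cls (x i)" "\<And>i. dist ?y (z i) = infdist ?y (cls (x i))" by metis
  have "(\<lambda>i. dist (z i) ?y) \<longlonglongrightarrow> 0" using lim by (simp add: z(2) dist_commute)
  then have "z \<longlonglongrightarrow> ?y" by (rule iffD2[OF tendsto_dist_iff])
  moreover have "Rel d (x i) (z i)" for i using z(1)[of i] by (simp add: cls_def)
  ultimately show ?thesis using that by blast
qed

text \<open>This makes the map from \<open>Y'\<close> to the maximal factor well defined. Generic
  points approaching one of the two base points have related partners approaching the other, and
  \<open>Rel\<close> is closed.\<close>

lemma Rel_if_prY_eq:
  assumes "w \<in> X'" "w' \<in> X'" "prY w = prY w'" shows "Rel d (prX w) (prX w')"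
proof -
  obtain x where x: "\<And>i::nat. x i \<in> Xc" "x \<longlonglongrightarrow> prX w" "(\<lambda>i. H (x i)) \<longlonglongrightarrow> prY w"
    using X'_sequence[OF assms(1)] by blast
  obtain z where z: "\<And>i. Rel d (x i) (z i)" "z \<longlonglongrightarrow> prX w'"
    using fibre_lift[OF Xc_K[OF x(1)] x(3)[unfolded assms(3)] assms(2)] by blast
  show ?thesis by (rule Rel_closed[OF z(1) x(2) z(2)])
qed

definition aX :: "int \<Rightarrow> (nat \<Rightarrow> real) \<Rightarrow> nat \<Rightarrow> real" where
  "aX s w = (if w \<in> X' then pt (a s (prX w)) (shift s (prY w)) else w)"
definition aY :: "int \<Rightarrow> (nat \<Rightarrow> real) \<Rightarrow> nat \<Rightarrow> real" where
  "aY s h = (if h \<in> Y' then shift s h else h)"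

lemma aX_in: "w \<in> X' \<Longrightarrow> aX s w \<in> X'"
proof -
  assume w: "w \<in> X'"
  obtain x where x: "\<And>i::nat. x i \<in> Xc" "x \<longlonglongrightarrow> prX w" "(\<lambda>i. H (x i)) \<longlonglongrightarrow> prY w"
    using X'_sequence[OF w] by blast
  show "aX s w \<in> X'"
  proof (rule X'_limit)
    show "pt (a s (x i)) (H (a s (x i))) \<in> X'" for i by (intro pt_in_X' Xc_translate x(1))
    show "(\<lambda>i. pt (a s (x i)) (H (a s (x i)))) \<longlonglongrightarrow> aX s w"
      by (rule tendsto_ptI) (use w a_tendsto[OF Xc_K[OF x(1)] x(2)] tendsto_shift[OF x(3)]
        in \<open>simp_all add: aX_def H_translate\<close>)
  qed
qed

lemma prX_aX: "w \<in> X' \<Longrightarrow> prX (aX s w) = a s (prX w)"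
  and prY_aX: "w \<in> X' \<Longrightarrow> prY (aX s w) = aY s (prY w)"
  by (auto simp: aX_def aY_def Y'_def)

lemma aY_in: "h \<in> Y' \<Longrightarrow> aY s h \<in> Y'"
  unfolding Y'_def using aX_in prY_aX[symmetric] by auto

lemma aX_pt: "x \<in> Xc \<Longrightarrow> aX s (pt x (H x)) = pt (a s x) (H (a s x))"
  by (simp add: aX_def pt_in_X' H_translate)

lemma H_in_Y': "x \<in> Xc \<Longrightarrow> H x \<in> Y'"
  unfolding Y'_def using imageI[OF pt_in_X', of x prY] by simp

lemma compact_Y': "compact Y'"
  unfolding Y'_def by (rule compact_continuous_image[OF continuous_on_prY compact_X'])

sublocale X: zflow X' aX
proof
  show "compact X'" by (rule compact_X')
  show "continuous_on X' (aX s)" for s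
  proof -
    have "continuous_on X' (\<lambda>w. pt (a s (prX w)) (shift s (prY w)))"
    proof (rule continuous_on_coordinatewise_then_product)
      fix j
      have 1: "continuous_on X' (\<lambda>w. a s (prX w))"
        by (rule continuous_on_compose2[OF a_cont continuous_on_prX]) (use prX_X' in blast)
      have 2: "continuous_on X' (\<lambda>w. shift s (prY w))"
        by (rule continuous_on_compose2[OF continuous_on_shift[of UNIV] continuous_on_prY]) simp
      show "continuous_on X' (\<lambda>w. pt (a s (prX w)) (shift s (prY w)) j)"
        using continuous_on_product_then_coordinatewise[OF 1] continuous_on_product_then_coordinatewise[OF 2]
        by (cases "even j") (simp_all add: pt_def)
    qed
    then show ?thesis by (rule continuous_on_cong[THEN iffD1, rotated 2]) (auto simp: aX_def)
  qed
  show "aX s w \<in> X'" if "w \<in> X'" for s w using that by (rule aX_in)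
  show "aX s w = w" if "w \<notin> X'" for s w using that by (simp add: aX_def)
  show "aX 0 w = w" for w by (simp add: aX_def a_0 shift_0)
  show "aX (s + t) w = aX s (aX t w)" for s t w
  proof (cases "w \<in> X'")
    case True
    then show ?thesis using aX_in[OF True, of t] by (simp add: aX_def a_add shift_add)
  qed (simp add: aX_def)
qed

sublocale Y: zflow Y' aY
proof
  show "compact Y'" by (rule compact_Y')
  show "continuous_on Y' (aY s)" for s
    by (rule continuous_on_cong[THEN iffD1, rotated 2, OF continuous_on_shift]) (auto simp: aY_def)
  show "aY s w \<in> Y'" if "w \<in> Y'" for s w using that by (rule aY_in)
  show "aY s w = w" if "w \<notin> Y'" for s w using that by (simp add: aY_def)
  show "aY 0 w = w" for w by (simp add: aY_def shift_0)
  show "aY (s + t) w = aY s (aY t w)" for s t w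
    using aY_in[of w t] by (simp add: aY_def shift_add)
qed

text \<open>Minimality of \<open>K\<close> brings the base point to \<open>x\<close>. A subsequence
  converges in the compact \<open>X'\<close>, and over a point of \<open>Xc\<close> only one limit
  is possible.\<close>

lemma aX_orbit_sequence:
  assumes w: "w \<in> X'" and x: "x \<in> Xc"
  obtains s where "(\<lambda>i::nat. aX (s i) w) \<longlonglongrightarrow> pt x (H x)"
proof -
  have "\<exists>n. dist (a n (prX w)) x < inverse (Suc m)" for m :: nat
    by (rule a_dense[OF prX_X'[OF w] Xc_K[OF x]]) simp
  then have "\<forall>m::nat. \<exists>n. dist (a n (prX w)) x < inverse (Suc m)" by blast
  from choice[OF this] obtain n where n: "\<And>m::nat. dist (a (n m) (prX w)) x < inverse (Suc m)" by blast
  have "(\<lambda>m. dist (a (n m) (prX w)) x) \<longlonglongrightarrow> 0"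
    by (rule tendsto_sandwich[OF _ _ tendsto_const LIMSEQ_inverse_real_of_nat])
      (use n in \<open>auto intro!: always_eventually less_imp_le\<close>)
  then have lim: "(\<lambda>m. a (n m) (prX w)) \<longlonglongrightarrow> x" by (rule iffD2[OF tendsto_dist_iff])
  have aw: "\<forall>m. aX (n m) w \<in> X'" using aX_in[OF w] by blast
  obtain v r where r: "v \<in> X'" "strict_mono (r :: nat \<Rightarrow> nat)" "((\<lambda>m. aX (n m) w) \<circ> r) \<longlonglongrightarrow> v"
    by (rule seq_compactE[OF compact_imp_seq_compact[OF compact_X'] aw])
  have "(\<lambda>m. prX (aX (n (r m)) w)) \<longlonglongrightarrow> prX v" using tendsto_prX[OF r(3)] by (simp add: o_def)
  moreover have "(\<lambda>m. prX (aX (n (r m)) w)) \<longlonglongrightarrow> x"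
    using LIMSEQ_subseq_LIMSEQ[OF lim r(2)] by (simp add: o_def prX_aX[OF w])
  ultimately have pX: "prX v = x" by (rule LIMSEQ_unique)
  have "v = pt (prX v) (prY v)" by (rule pt_pr[symmetric])
  also have "\<dots> = pt x (H x)" using prY_over_Xc[OF r(1)] x by (simp only: pX)
  finally have v: "v = pt x (H x)" .
  show ?thesis by (rule that[of "n \<circ> r"]) (use r(3) in \<open>simp only: v o_def\<close>)
qed

sublocale X: minimal_zflow X' aX
proof
  fix w w' :: "nat \<Rightarrow> real" and r :: real
  assume w: "w \<in> X'" and w': "w' \<in> X'" and r: "r > 0"
  obtain v where v: "v \<in> (\<lambda>x. pt x (H x)) ` Xc" "dist v w' < r / 2"
    using w' half_gt_zero[OF r] unfolding X'_def closure_approachable by blast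
  then obtain x where x: "x \<in> Xc" "v = pt x (H x)" by blast
  obtain s where "(\<lambda>i::nat. aX (s i) w) \<longlonglongrightarrow> v" using aX_orbit_sequence[OF w x(1)] x(2) by blast
  then obtain i where "dist (aX (s i) w) v < r / 2"
    using tendstoD[of _ v sequentially "r / 2"] eventually_happens'[OF sequentially_bot] half_gt_zero[OF r] by blast
  then have "dist (aX (s i) w) w' < r" using v(2) dist_triangle[of "aX (s i) w" w' v] by simp
  then show "\<exists>n. dist (aX n w) w' < r" by blast
qed

lemma Y'_dense:
  assumes "h \<in> Y'" "r > 0" shows "\<exists>h'\<in>H ` Xc. dist h' h < r"
proof -
  obtain w where w: "w \<in> X'" "h = prY w" using assms(1) unfolding Y'_def by blast
  obtain x where x: "\<And>i::nat. x i \<in> Xc" "x \<longlonglongrightarrow> prX w" "(\<lambda>i. H (x i)) \<longlonglongrightarrow> prY w"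
    using X'_sequence[OF w(1)] by blast
  obtain i where "dist (H (x i)) h < r"
    using tendstoD[OF x(3) assms(2)] eventually_happens'[OF sequentially_bot] w(2) by blast
  then show ?thesis using x(1) by blast
qed

sublocale Y: minimal_zflow Y' aY
proof
  fix h h' :: "nat \<Rightarrow> real" and r :: real
  assume h: "h \<in> Y'" and h': "h' \<in> Y'" and r: "r > 0"
  obtain w where w: "w \<in> X'" "h = prY w" using h unfolding Y'_def by blast
  obtain x where x: "x \<in> Xc" "dist (H x) h' < r / 2" using Y'_dense[OF h' half_gt_zero[OF r]] by blast
  obtain s where s: "(\<lambda>i::nat. aX (s i) w) \<longlonglongrightarrow> pt x (H x)" using aX_orbit_sequence[OF w(1) x(1)] by blast
  have "(\<lambda>i. aY (s i) h) \<longlonglongrightarrow> H x" using tendsto_prY[OF s] by (simp add: prY_aX w)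
  then obtain i where "dist (aY (s i) h) (H x) < r / 2"
    using tendstoD[of _ "H x" sequentially "r / 2"] eventually_happens'[OF sequentially_bot] half_gt_zero[OF r] by blast
  then have "dist (aY (s i) h) h' < r" using x(2) dist_triangle[of "aY (s i) h" h' "H x"] by simp
  then show "\<exists>n. dist (aY n h) h' < r" by blast
qed

text \<open>The coordinates are changed one at a time.\<close>

lemma cube_in_class:
  assumes x: "x \<in> Xc" and w: "\<And>\<epsilon>. \<epsilon> \<in> vertices d \<Longrightarrow> Rel d x (w \<epsilon>)"
  shows "cube d w"
proof -
  \<comment> \<open>\<open>W\<close> collects the vertices at which \<open>w\<close> may differ from
    \<open>x\<close>; the induction starts at the constant cube.\<close>
  have "cube d w" if "finite W" "\<And>\<epsilon>. \<epsilon> \<in> vertices d \<Longrightarrow> Rel d x (w \<epsilon>)"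
      "\<And>\<epsilon>. \<epsilon> \<in> vertices d \<Longrightarrow> \<epsilon> \<notin> W \<Longrightarrow> w \<epsilon> = x" "W \<subseteq> vertices d" for W w
    using that
  proof (induction W arbitrary: w rule: finite_induct)
    case empty
    show ?case by (rule cube_cong[OF cube_diag[OF Xc_K[OF x], of d]]) (use empty in auto)
  next
    case (insert \<sigma> W)
    have \<sigma>: "\<sigma> \<in> vertices d" using insert.prems by blast
    have c: "cube d (w(\<sigma> := x))"
      by (rule insert.IH) (use insert.prems Rel_refl[OF Xc_K[OF x]] in auto)
    obtain N y where Ny0: "\<forall>i::nat. y i \<in> Xc"
        "\<forall>\<epsilon>\<in>vertices d. (\<lambda>i. a (lin (N i) \<epsilon>) (y i)) \<longlonglongrightarrow> (w(\<sigma> := x)) \<epsilon>"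
      by (rule cube_sequence[OF c Xc_subset Xc_dense])
    note Ny = spec[OF Ny0(1)] bspec[OF Ny0(2)]
    let ?y = "\<lambda>i. a (lin (N i) \<sigma>) (y i)"
    have yK: "?y i \<in> K" for i by (intro a_in Xc_K Ny(1))
    have "?y \<longlonglongrightarrow> x" using Ny(2)[OF \<sigma>] by simp
    then have Hy: "(\<lambda>i. H (?y i)) \<longlonglongrightarrow> H x" by (rule H_continuous[OF x yK])
    have Rw: "Rel d x (w \<sigma>)" using insert.prems(1) \<sigma> by blast
    \<comment> \<open>The vertex \<sigma> currently tends to \<open>x\<close>, and
      \<open>w \<sigma>\<close> has the same value of \<open>H\<close>. Hence
      \<open>fibre_lift\<close> moves the approximating points inside their classes so that they
      tend to \<open>w \<sigma>\<close>.\<close>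
    have "(\<lambda>i. H (?y i)) \<longlonglongrightarrow> prY (pt (w \<sigma>) (H (w \<sigma>)))"
      using Hy unfolding prY_pt H_cong[OF Rw] .
    from fibre_lift[OF yK this pt_in_X'[OF Xc_Rel[OF x Rw]], unfolded prX_pt]
    obtain z where z: "\<And>i. Rel d (?y i) (z i)" "z \<longlonglongrightarrow> w \<sigma>" by blast
    \<comment> \<open>The lifted points are moved back to the base points \<open>y i\<close>, to
      which they are then related. A constant cube with one vertex changed to a related point is
      again a cube, and translating it restores all the other limits.\<close>
    let ?z = "\<lambda>i. a (- lin (N i) \<sigma>) (z i)"
    have "Rel d (?z i) (y i)" for i
      using Rel_sym[OF Rel_translate[OF z(1), of "- lin (N i) \<sigma>" i]] by (simp add: a_inverse)
    then have "cube d (\<lambda>\<epsilon>. if \<epsilon> = \<sigma> then ?z i else y i)" for i by (rule Rel_any_vertex[OF _ \<sigma>])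
    from cube_translate[OF this, of 0]
    have "cube d (\<lambda>\<epsilon>. a (0 + lin (N i) \<epsilon>) (if \<epsilon> = \<sigma> then ?z i else y i))" for i .
    then show ?case
    proof (rule cube_limit)
      fix \<epsilon> assume \<epsilon>: "\<epsilon> \<in> vertices d"
      show "(\<lambda>i. a (0 + lin (N i) \<epsilon>) (if \<epsilon> = \<sigma> then ?z i else y i)) \<longlonglongrightarrow> w \<epsilon>"
        using z(2) Ny(2)[OF \<epsilon>] by (cases "\<epsilon> = \<sigma>") (simp_all add: a_inverse)
    qed
  qed
  from this[of "vertices d" w] show ?thesis using w by simp
qed

text \<open>All coordinates lie in \<open>Xc\<close>, where \<open>H\<close> is continuous, so any
  approximation of the cube by orbits of points of \<open>Xc\<close> lifts to the graph of
  \<open>H\<close>.\<close>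

lemma cube_X'_in_class:
  assumes x: "x \<in> Xc" and w: "\<And>\<epsilon>. \<epsilon> \<in> vertices d \<Longrightarrow> Rel d x (w \<epsilon>)"
  shows "X.cube d (\<lambda>\<epsilon>. pt (w \<epsilon>) (H x))"
proof -
  obtain N y where Ny0: "\<forall>i::nat. y i \<in> Xc"
      "\<forall>\<epsilon>\<in>vertices d. (\<lambda>i. a (lin (N i) \<epsilon>) (y i)) \<longlonglongrightarrow> w \<epsilon>"
    by (rule cube_sequence[OF cube_in_class[OF x w] Xc_subset Xc_dense])
  note Ny = spec[OF Ny0(1)] bspec[OF Ny0(2)]
  show ?thesis
  proof (rule X.cube_of_sequence)
    show "pt (y i) (H (y i)) \<in> X'" for i by (rule pt_in_X'[OF Ny(1)])
    fix \<epsilon> assume \<epsilon>: "\<epsilon> \<in> vertices d"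
    have Hy: "(\<lambda>i. H (a (lin (N i) \<epsilon>) (y i))) \<longlonglongrightarrow> H (w \<epsilon>)"
      by (rule H_continuous[OF Xc_Rel[OF x w[OF \<epsilon>]] _ Ny(2)[OF \<epsilon>]]) (intro a_in Xc_K Ny(1))
    show "(\<lambda>i. aX (lin (N i) \<epsilon>) (pt (y i) (H (y i)))) \<longlonglongrightarrow> pt (w \<epsilon>) (H x)"
      by (rule tendsto_ptI) (use Hy Ny(2)[OF \<epsilon>] H_cong[OF w[OF \<epsilon>]] in \<open>simp_all add: aX_pt[OF Ny(1)]\<close>)
  qed
qed

text \<open>The cube below is approximated by translates of generic points \<open>H (x i)\<close>.
  Openness lifts each vertex separately, with no relation between the lifts. Translated back,
  however, all lifts at stage i lie in the class of \<open>x i\<close>, and any choice of vertices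
  in a generic class is a cube.\<close>

theorem cube_X'_if_cube_Y':
  assumes w: "\<And>\<epsilon>. \<epsilon> \<in> vertices d \<Longrightarrow> w \<epsilon> \<in> X'" and cY: "Y.cube d (\<lambda>\<epsilon>. prY (w \<epsilon>))"
  shows "X.cube d w"
proof -
  obtain N h where Nh0: "\<forall>i::nat. h i \<in> H ` Xc"
      "\<forall>\<epsilon>\<in>vertices d. (\<lambda>i. aY (lin (N i) \<epsilon>) (h i)) \<longlonglongrightarrow> prY (w \<epsilon>)"
    by (rule Y.cube_sequence[OF cY image_subsetI[OF H_in_Y'] Y'_dense])
  note Nh = spec[OF Nh0(1)] bspec[OF Nh0(2)]
  have "\<forall>i. \<exists>x. x \<in> Xc \<and> h i = H x" using Nh(1) by blast
  from choice[OF this] obtain x where x: "\<And>i. x i \<in> Xc" "\<And>i. h i = H (x i)" by blast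
  let ?x = "\<lambda>\<epsilon> i. a (lin (N i) \<epsilon>) (x i)"
  have xK: "?x \<epsilon> i \<in> K" for \<epsilon> i by (intro a_in Xc_K x(1))
  have Hx: "(\<lambda>i. H (?x \<epsilon> i)) \<longlonglongrightarrow> prY (w \<epsilon>)" if \<epsilon>: "\<epsilon> \<in> vertices d" for \<epsilon>
    using Nh(2)[OF \<epsilon>] by (simp add: x(2) aY_def H_in_Y'[OF x(1)] H_translate)
  have "\<exists>z. (\<forall>i. Rel d (?x \<epsilon> i) (z i)) \<and> z \<longlonglongrightarrow> prX (w \<epsilon>)" if \<epsilon>: "\<epsilon> \<in> vertices d" for \<epsilon>
    using fibre_lift[OF xK Hx[OF \<epsilon>] w[OF \<epsilon>]] by blast
  then have "\<forall>\<epsilon>\<in>vertices d. \<exists>z. (\<forall>i. Rel d (?x \<epsilon> i) (z i)) \<and> z \<longlonglongrightarrow> prX (w \<epsilon>)" by blast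
  from bchoice[OF this] obtain z where z: "\<And>\<epsilon> i. \<epsilon> \<in> vertices d \<Longrightarrow> Rel d (?x \<epsilon> i) (z \<epsilon> i)"
      "\<And>\<epsilon>. \<epsilon> \<in> vertices d \<Longrightarrow> z \<epsilon> \<longlonglongrightarrow> prX (w \<epsilon>)" by blast
  let ?z = "\<lambda>\<epsilon> i. a (- lin (N i) \<epsilon>) (z \<epsilon> i)"
  have Rz: "Rel d (x i) (?z \<epsilon> i)" if "\<epsilon> \<in> vertices d" for \<epsilon> i
    using Rel_translate[OF z(1)[OF that], of "- lin (N i) \<epsilon>" i] by (simp add: a_inverse)
  have "X.cube d (\<lambda>\<epsilon>. pt (?z \<epsilon> i) (H (x i)))" for i by (rule cube_X'_in_class[OF x(1) Rz])
  from X.cube_translate[OF this, of 0]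
  have "X.cube d (\<lambda>\<epsilon>. aX (0 + lin (N i) \<epsilon>) (pt (?z \<epsilon> i) (H (x i))))" for i .
  then show ?thesis
  proof (rule X.cube_limit)
    fix \<epsilon> assume \<epsilon>: "\<epsilon> \<in> vertices d"
    have eq: "aX (0 + lin (N i) \<epsilon>) (pt (?z \<epsilon> i) (H (x i))) = pt (z \<epsilon> i) (H (?x \<epsilon> i))" for i
    proof -
      have "pt (?z \<epsilon> i) (H (x i)) \<in> X'"
        using pt_in_X'[OF Xc_Rel[OF x(1) Rz[OF \<epsilon>]], of i] H_cong[OF Rz[OF \<epsilon>], of i] by simp
      then show ?thesis by (simp add: aX_def a_inverse H_translate)
    qed
    show "(\<lambda>i. aX (0 + lin (N i) \<epsilon>) (pt (?z \<epsilon> i) (H (x i)))) \<longlonglongrightarrow> w \<epsilon>"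
      unfolding eq by (rule tendsto_ptI) (use z(2)[OF \<epsilon>] Hx[OF \<epsilon>] in simp_all)
  qed
qed

lemma cube_Y'_if_cube_X':
  assumes "X.cube d w" shows "Y.cube d (\<lambda>\<epsilon>. prY (w \<epsilon>))"
proof -
  have "\<exists>z\<in>X'. dist z y < r" if "y \<in> X'" "r > 0" for y r
    using that by (intro bexI[of _ y]) simp_all
  note dense = this
  obtain N v where Nv0: "\<forall>i::nat. v i \<in> X'"
      "\<forall>\<epsilon>\<in>vertices d. (\<lambda>i. aX (lin (N i) \<epsilon>) (v i)) \<longlonglongrightarrow> w \<epsilon>"
    by (rule X.cube_sequence[OF assms subset_refl dense])
  note Nv = spec[OF Nv0(1)] bspec[OF Nv0(2)]
  show ?thesis
  proof (rule Y.cube_of_sequence)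
    show "prY (v i) \<in> Y'" for i using Nv(1) by (auto simp: Y'_def)
    show "(\<lambda>i. aY (lin (N i) \<epsilon>) (prY (v i))) \<longlonglongrightarrow> prY (w \<epsilon>)" if "\<epsilon> \<in> vertices d" for \<epsilon>
      using tendsto_prY[OF Nv(2)[OF that]] by (simp add: prY_aX[OF Nv(1)])
  qed
qed

end

section \<open>The groups of cubes and the systems of the statement\<close>

text \<open>Affine integer functions on the vertices. As the acting group is abelian, these form the
  whole Host-Kra group for positive dimension, and those vanishing at \<open>{}\<close> form the
  face group.\<close>

definition aff :: "nat \<Rightarrow> int \<Rightarrow> (nat \<Rightarrow> int) \<Rightarrow> nat set \<Rightarrow> int" where
  "aff d s n = (\<lambda>\<epsilon>\<in>vertices d. s + lin n \<epsilon>)"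

lemma group_cube_group: "group (cube_group d)" by (simp add: cube_group_def)

lemma aff_carrier: "aff d s n \<in> carrier (cube_group d)"
  by (simp add: cube_group_def aff_def)

lemma aff_mult: "aff d s m \<otimes>\<^bsub>cube_group d\<^esub> aff d t n = aff d (s + t) (\<lambda>i. m i + n i)"
  by (simp add: cube_group_def aff_def fun_eq_iff restrict_def lin_add)

lemma aff_one: "\<one>\<^bsub>cube_group d\<^esub> = aff d 0 (\<lambda>_. 0)"
  by (simp add: cube_group_def aff_def fun_eq_iff restrict_def lin_zero)

lemma aff_inv: "inv\<^bsub>cube_group d\<^esub> aff d s n = aff d (- s) (\<lambda>i. - n i)"
proof (rule group.inv_equality[OF group_cube_group])
  show "aff d (- s) (\<lambda>i. - n i) \<otimes>\<^bsub>cube_group d\<^esub> aff d s n = \<one>\<^bsub>cube_group d\<^esub>"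
    by (simp only: aff_mult aff_one) simp
qed (rule aff_carrier)+

text \<open>\<open>T = {0}\<close> serves the face group and \<open>T = UNIV\<close> the Host-Kra
  group.\<close>

lemma subgroup_aff:
  assumes "0 \<in> T" "\<And>s t. s \<in> T \<Longrightarrow> t \<in> T \<Longrightarrow> s + t \<in> T" "\<And>s. s \<in> T \<Longrightarrow> - s \<in> T"
  shows "subgroup {aff d s n | s n. s \<in> T} (cube_group d)"
proof (rule group.subgroupI[OF group_cube_group])
  show "{aff d s n | s n. s \<in> T} \<subseteq> carrier (cube_group d)" using aff_carrier by blast
  show "{aff d s n | s n. s \<in> T} \<noteq> {}" using assms(1) by blast
  show "inv\<^bsub>cube_group d\<^esub> f \<in> {aff d s n | s n. s \<in> T}" if "f \<in> {aff d s n | s n. s \<in> T}" for f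
    using that assms(3) aff_inv[of d] by blast
  show "f \<otimes>\<^bsub>cube_group d\<^esub> g \<in> {aff d s n | s n. s \<in> T}"
    if "f \<in> {aff d s n | s n. s \<in> T}" "g \<in> {aff d s n | s n. s \<in> T}" for f g
    using that assms(2) aff_mult[of d] by blast
qed

lemma face_elt_upper: "face_elt d t {\<epsilon> \<in> vertices d. i \<in> \<epsilon>} = aff d 0 (\<lambda>j. if j = i then t else 0)"
  by (auto simp: face_elt_def aff_def fun_eq_iff restrict_def lin_single dest: vertices_finite)

lemma face_elt_lower: "face_elt d t {\<epsilon> \<in> vertices d. i \<notin> \<epsilon>} = aff d t (\<lambda>j. if j = i then - t else 0)"
  by (auto simp: face_elt_def aff_def fun_eq_iff restrict_def lin_single dest: vertices_finite)

lemma upper_facet_iff: "upper_facet d \<alpha> \<longleftrightarrow> (\<exists>i\<in>{1..d}. \<alpha> = {\<epsilon> \<in> vertices d. i \<in> \<epsilon>})"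
  unfolding upper_facet_def facet_def by (auto simp: vertices_def)

lemma FG_eq: "FG d = {aff d 0 n | n. True}"
proof
  show "FG d \<subseteq> {aff d 0 n | n. True}"
    unfolding FG_def
  proof (rule group.generate_subgroup_incl[OF group_cube_group])
    show "{face_elt d t \<alpha> | t \<alpha>. upper_facet d \<alpha>} \<subseteq> {aff d 0 n | n. True}"
      unfolding upper_facet_iff using face_elt_upper by blast
    show "subgroup {aff d 0 n | n. True} (cube_group d)" using subgroup_aff[of "{0}" d] by simp
  qed
  show "{aff d 0 n | n. True} \<subseteq> FG d"
  proof safe
    fix n
    have "j \<le> d \<Longrightarrow> aff d 0 (\<lambda>i. if i \<in> {1..j} then n i else 0) \<in> FG d" for j
    proof (induction j)
      case 0
      have "\<one>\<^bsub>cube_group d\<^esub> \<in> FG d" unfolding FG_def by (rule generate.one)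
      then show ?case by (simp add: aff_one)
    next
      case (Suc j)
      have "face_elt d (n (Suc j)) {\<epsilon> \<in> vertices d. Suc j \<in> \<epsilon>} \<in> FG d"
        unfolding FG_def upper_facet_iff using Suc.prems
        by (intro generate.incl CollectI exI conjI bexI[of _ "Suc j"]) auto
      then have "aff d 0 (\<lambda>i. if i \<in> {1..j} then n i else 0) \<otimes>\<^bsub>cube_group d\<^esub>
          aff d 0 (\<lambda>i. if i = Suc j then n (Suc j) else 0) \<in> FG d"
        using Suc unfolding FG_def face_elt_upper by (intro generate.eng) auto
      moreover have "(\<lambda>i. (if i \<in> {1..j} then n i else 0) + (if i = Suc j then n (Suc j) else 0))
          = (\<lambda>i. if i \<in> {1..Suc j} then n i else 0)" by (auto simp: fun_eq_iff)
      ultimately show ?case by (simp only: aff_mult add_0)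
    qed
    from this[of d] have "aff d 0 (\<lambda>i. if i \<in> {1..d} then n i else 0) \<in> FG d" by simp
    moreover have "aff d 0 (\<lambda>i. if i \<in> {1..d} then n i else 0) = aff d 0 n"
      unfolding aff_def by (intro restrict_ext arg_cong[where f = "(+) 0"] lin_cong) (auto simp: vertices_def)
    ultimately show "aff d 0 n \<in> FG d" by simp
  qed
qed

lemma HK_eq:
  assumes "d \<ge> 1" shows "HK d = {aff d s n | s n. True}"
proof
  show "HK d \<subseteq> {aff d s n | s n. True}"
    unfolding HK_def
  proof (rule group.generate_subgroup_incl[OF group_cube_group])
    show "{face_elt d t \<alpha> | t \<alpha>. facet d \<alpha>} \<subseteq> {aff d s n | s n. True}"
      unfolding facet_def using face_elt_upper face_elt_lower by blast
    show "subgroup {aff d s n | s n. True} (cube_group d)" using subgroup_aff[of UNIV d] by simp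
  qed
  show "{aff d s n | s n. True} \<subseteq> HK d"
  proof safe
    fix s n
    have "FG d \<subseteq> HK d"
      unfolding FG_def HK_def by (rule group.mono_generate[OF group_cube_group]) (auto simp: upper_facet_def)
    then have 1: "aff d 0 n \<in> HK d" unfolding FG_eq by blast
    \<comment> \<open>The diagonal shift is the product of the elements of two opposite facets. At
      least one direction must exist for this, whence \<open>d \<ge> 1\<close>.\<close>
    have "facet d {\<epsilon> \<in> vertices d. 1 \<in> \<epsilon>}" "facet d {\<epsilon> \<in> vertices d. 1 \<notin> \<epsilon>}"
      unfolding facet_def using assms by auto
    then have "face_elt d s {\<epsilon> \<in> vertices d. 1 \<in> \<epsilon>} \<in> HK d" "face_elt d s {\<epsilon> \<in> vertices d. 1 \<notin> \<epsilon>} \<in> HK d"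
      unfolding HK_def by (auto intro!: generate.incl)
    then have "aff d 0 (\<lambda>j. if j = 1 then s else 0) \<otimes>\<^bsub>cube_group d\<^esub>
        aff d s (\<lambda>j. if j = 1 then - s else 0) \<otimes>\<^bsub>cube_group d\<^esub> aff d 0 n \<in> HK d"
      using 1 unfolding HK_def face_elt_upper face_elt_lower by (intro generate.eng)
    moreover have "(\<lambda>i. (if i = 1 then s else 0) + (if i = 1 then - s else 0) + n i) = n" by auto
    ultimately show "aff d s n \<in> HK d" by (simp only: aff_mult add_0 add_0_right)
  qed
qed

section \<open>Iterates, cube spaces and \<open>Q\<close> in terms of abstract topologies\<close>

lemma tds_facts:
  assumes "tds X S"
  shows "compact_space X" "metrizable_space X" "homeomorphic_map X X S"
    "continuous_map X X S" "S ` topspace X = topspace X" "inj_on S (topspace X)"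
  using assms unfolding tds_def
  by (auto simp: homeomorphic_eq_everything_map)

lemma act_0 [simp]: "act X S 0 x = x" by (simp add: act_def)

lemma act_1 [simp]: "act X S 1 x = S x" by (simp add: act_def)

lemma act_step:
  assumes X: "tds X S" and x: "x \<in> topspace X"
  shows "act X S n x \<in> topspace X" "act X S (n + 1) x = S (act X S n x)"
proof -
  note S = tds_facts(4-6)[OF X]
  let ?i = "inv_into (topspace X) S"
  have i: "?i y \<in> topspace X" "S (?i y) = y" if "y \<in> topspace X" for y
    using that S(2) by (auto intro: inv_into_into f_inv_into_f)
  have i': "(?i ^^ m) x \<in> topspace X" for m by (induction m) (use x i in auto)
  have s': "(S ^^ m) x \<in> topspace X" for m by (induction m) (use x S(2) in auto)
  show "act X S n x \<in> topspace X" using i' s' by (simp add: act_def)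
  show "act X S (n + 1) x = S (act X S n x)"
  proof (cases "0 \<le> n")
    case True
    then have "nat (n + 1) = Suc (nat n)" by simp
    then show ?thesis using True by (simp add: act_def)
  next
    case False
    then have "nat (- n) = Suc (nat (- (n + 1)))" by simp
    then have "S (act X S n x) = (?i ^^ nat (- (n + 1))) x" using False i(2)[OF i'] by (simp add: act_def)
    moreover have "act X S (n + 1) x = (?i ^^ nat (- (n + 1))) x"
      using False by (cases "n = -1") (auto simp: act_def)
    ultimately show ?thesis by simp
  qed
qed

lemma act_add:
  assumes X: "tds X S" and x: "x \<in> topspace X"
  shows "act X S (m + n) x = act X S m (act X S n x)"
proof (induction m rule: int_induct[where k = 0])
  case base
  show ?case by simp
next
  case (step1 i)
  have "act X S (i + 1 + n) x = S (act X S (i + n) x)"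
    using act_step(2)[OF X x, of "i + n"] by (simp add: algebra_simps)
  also have "\<dots> = act X S (i + 1) (act X S n x)"
    unfolding step1(2) by (rule act_step(2)[OF X act_step(1)[OF X x], symmetric])
  finally show ?case .
next
  case (step2 i)
  let ?y = "act X S n x"
  have y: "?y \<in> topspace X" by (rule act_step(1)[OF X x])
  have "S (act X S (i - 1 + n) x) = act X S (i + n) x"
    using act_step(2)[OF X x, of "i - 1 + n"] by (simp add: algebra_simps)
  also have "\<dots> = S (act X S (i - 1) ?y)"
    unfolding step2(2) using act_step(2)[OF X y, of "i - 1"] by simp
  finally show ?case
    by (rule inj_onD[OF tds_facts(6)[OF X]]) (intro act_step(1) X x y)+
qed

lemma act_continuous:
  assumes X: "tds X S"
  shows "continuous_map X X (act X S n)"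
proof (induction n rule: int_induct[where k = 0])
  case base
  show ?case by (rule continuous_map_eq[OF continuous_map_id]) simp
next
  case (step1 i)
  show ?case
    by (rule continuous_map_eq[OF continuous_map_compose[OF step1(2) tds_facts(4)[OF X]]])
      (simp add: act_step(2)[OF X])
next
  case (step2 i)
  obtain S' where S': "homeomorphic_maps X X S S'"
    using tds_facts(3)[OF X] by (auto simp: homeomorphic_map_maps)
  show ?case
  proof (rule continuous_map_eq[OF continuous_map_compose[OF step2(2)]])
    show "continuous_map X X S'" using S' by (simp add: homeomorphic_maps_def)
    fix x assume x: "x \<in> topspace X"
    have "S (act X S (i - 1) x) = act X S i x" using act_step(2)[OF X x, of "i - 1"] by simp
    then show "(S' \<circ> act X S i) x = act X S (i - 1) x"
      using S' act_step(1)[OF X x, of "i - 1"] by (auto simp: homeomorphic_maps_def)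
  qed
qed

lemma closure_of_cube_space:
  fixes K :: "'m::metric_space set"
  assumes A: "A \<subseteq> vertices d \<rightarrow>\<^sub>E K"
  shows "w \<in> cube_space (top_of_set K) d closure_of A \<longleftrightarrow>
    w \<in> vertices d \<rightarrow>\<^sub>E K \<and> (\<forall>e>0. \<exists>v\<in>A. \<forall>\<epsilon>\<in>vertices d. dist (v \<epsilon>) (w \<epsilon>) < e)"
proof
  assume w: "w \<in> cube_space (top_of_set K) d closure_of A"
  then have wK: "w \<in> vertices d \<rightarrow>\<^sub>E K"
    using closure_of_subset_topspace[of "cube_space (top_of_set K) d" A] by (auto simp: cube_space_def)
  have "\<exists>v\<in>A. \<forall>\<epsilon>\<in>vertices d. dist (v \<epsilon>) (w \<epsilon>) < e" if e: "e > 0" for e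
  proof -
    let ?T = "PiE (vertices d) (\<lambda>\<epsilon>. K \<inter> ball (w \<epsilon>) e)"
    have "openin (cube_space (top_of_set K) d) ?T"
      unfolding cube_space_def openin_PiE_gen by (auto simp: openin_open_Int)
    moreover have "w \<in> ?T" using wK e by (auto simp: PiE_iff)
    ultimately obtain v where "v \<in> A" "v \<in> ?T" using w unfolding in_closure_of by blast
    then show ?thesis by (intro bexI[of _ v]) (auto simp: PiE_iff dist_commute)
  qed
  then show "w \<in> vertices d \<rightarrow>\<^sub>E K \<and> (\<forall>e>0. \<exists>v\<in>A. \<forall>\<epsilon>\<in>vertices d. dist (v \<epsilon>) (w \<epsilon>) < e)"
    using wK by blast
next
  assume w: "w \<in> vertices d \<rightarrow>\<^sub>E K \<and> (\<forall>e>0. \<exists>v\<in>A. \<forall>\<epsilon>\<in>vertices d. dist (v \<epsilon>) (w \<epsilon>) < e)"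
  have "inverse (real (Suc m)) > 0" for m by simp
  then have "\<forall>m::nat. \<exists>v. v \<in> A \<and> (\<forall>\<epsilon>\<in>vertices d. dist (v \<epsilon>) (w \<epsilon>) < inverse (Suc m))"
    using w by blast
  from choice[OF this] obtain v where v: "\<And>m. v m \<in> A"
      "\<And>m \<epsilon>. \<epsilon> \<in> vertices d \<Longrightarrow> dist (v m \<epsilon>) (w \<epsilon>) < inverse (Suc m)" by blast
  have lim: "(\<lambda>m. v m \<epsilon>) \<longlonglongrightarrow> w \<epsilon>" if \<epsilon>: "\<epsilon> \<in> vertices d" for \<epsilon>
  proof -
    have "(\<lambda>m. dist (v m \<epsilon>) (w \<epsilon>)) \<longlonglongrightarrow> 0"
      by (rule tendsto_sandwich[OF _ _ tendsto_const LIMSEQ_inverse_real_of_nat])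
        (use v(2)[OF \<epsilon>] in \<open>auto intro!: always_eventually less_imp_le\<close>)
    then show ?thesis by (rule iffD2[OF tendsto_dist_iff])
  qed
  have vK: "v m \<in> vertices d \<rightarrow>\<^sub>E K" for m using A v(1) by blast
  have "limitin (cube_space (top_of_set K) d) v w sequentially"
    unfolding cube_space_def limitin_componentwise
    using w vK lim by (auto simp: limitin_subtopology PiE_iff)
  then show "w \<in> cube_space (top_of_set K) d closure_of A"
  proof (rule limitin_closedin)
    show "\<forall>\<^sub>F m in sequentially. v m \<in> cube_space (top_of_set K) d closure_of A"
    proof (rule always_eventually, rule allI)
      fix m
      have "A \<subseteq> cube_space (top_of_set K) d closure_of A"
        using A by (intro closure_of_subset) (simp add: cube_space_def)
      then show "v m \<in> cube_space (top_of_set K) d closure_of A" using v(1) by blast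
    qed
  qed auto
qed

context zflow
begin

lemma act_eq: "x \<in> K \<Longrightarrow> act (top_of_set K) (a 1) n x = a n x"
  and tds: "tds (top_of_set K) (a 1)"
proof -
  have maps: "homeomorphic_maps (top_of_set K) (top_of_set K) (a 1) (a (- 1))"
    unfolding homeomorphic_maps_def using a_cont a_in by (auto simp: a_inverse)
  have "compact_space (top_of_set K)" using compact_K by (simp add: compact_space_subtopology)
  then show t: "tds (top_of_set K) (a 1)"
    unfolding tds_def using maps homeomorphic_map_maps
    by (auto intro: metrizable_space_subtopology metrizable_space_euclidean)
  assume x: "x \<in> K"
  then have xt: "x \<in> topspace (top_of_set K)" by simp
  show "act (top_of_set K) (a 1) n x = a n x"
  proof (induction n rule: int_induct[where k = 0])
    case base
    show ?case by (simp add: a_0)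
  next
    case (step1 i)
    then show ?case using act_step(2)[OF t xt, of i] by (simp add: add.commute flip: a_add)
  next
    case (step2 i)
    have "a 1 (act (top_of_set K) (a 1) (i - 1) x) = a i x"
      using act_step(2)[OF t xt, of "i - 1"] step2(2) by simp
    then have "a (- 1) (a 1 (act (top_of_set K) (a 1) (i - 1) x)) = a (- 1) (a i x)" by simp
    then show ?case by (simp add: a_inverse a_0 flip: a_add)
  qed
qed

lemma Q_eq_cube:
  assumes "d \<ge> 1"
  shows "Q (top_of_set K) (a 1) d = {w \<in> vertices d \<rightarrow>\<^sub>E K. cube d w}"
proof -
  let ?A = "{cube_act (top_of_set K) (a 1) d t (diag d x) | t x. t \<in> HK d \<and> x \<in> topspace (top_of_set K)}"
  have A: "?A = {(\<lambda>\<epsilon>\<in>vertices d. a (s + lin n \<epsilon>) x) | s n x. x \<in> K}"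
  proof -
    have "cube_act (top_of_set K) (a 1) d (aff d s n) (diag d x) = (\<lambda>\<epsilon>\<in>vertices d. a (s + lin n \<epsilon>) x)"
      if "x \<in> K" for s n x
      using that by (auto simp: cube_act_def aff_def diag_def act_eq fun_eq_iff restrict_def)
    then show ?thesis unfolding HK_eq[OF assms] by simp (metis (no_types, lifting))
  qed
  have AK: "?A \<subseteq> vertices d \<rightarrow>\<^sub>E K" unfolding A using a_in by auto
  have "(\<forall>e>0. \<exists>v\<in>?A. \<forall>\<epsilon>\<in>vertices d. dist (v \<epsilon>) (w \<epsilon>) < e) \<longleftrightarrow> cube d w" for w
  proof
    assume L: "\<forall>e>0. \<exists>v\<in>?A. \<forall>\<epsilon>\<in>vertices d. dist (v \<epsilon>) (w \<epsilon>) < e"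
    show "cube d w" unfolding cube_def
    proof (intro allI impI)
      fix e :: real assume "e > 0"
      then obtain v where v: "v \<in> ?A" "\<forall>\<epsilon>\<in>vertices d. dist (v \<epsilon>) (w \<epsilon>) < e" using L by blast
      then obtain s n x where "x \<in> K" "v = (\<lambda>\<epsilon>\<in>vertices d. a (s + lin n \<epsilon>) x)" unfolding A by blast
      \<comment> \<open>The shift \<open>s\<close> is absorbed into the base point.\<close>
      then have "\<forall>\<epsilon>\<in>vertices d. dist (a (lin n \<epsilon>) (a s x)) (w \<epsilon>) < e" "a s x \<in> K"
        using v(2) a_in by (auto simp: add.commute simp flip: a_add)
      then show "\<exists>n. \<exists>x\<in>K. \<forall>\<epsilon>\<in>vertices d. dist (a (lin n \<epsilon>) x) (w \<epsilon>) < e" by blast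
    qed
  next
    assume c: "cube d w"
    show "\<forall>e>0. \<exists>v\<in>?A. \<forall>\<epsilon>\<in>vertices d. dist (v \<epsilon>) (w \<epsilon>) < e"
    proof (intro allI impI)
      fix e :: real assume "e > 0"
      then obtain n x where nx: "x \<in> K" "\<And>\<epsilon>. \<epsilon> \<in> vertices d \<Longrightarrow> dist (a (lin n \<epsilon>) x) (w \<epsilon>) < e"
        using cubeE[OF c] by blast
      have "(\<lambda>\<epsilon>\<in>vertices d. a (0 + lin n \<epsilon>) x) \<in> ?A" unfolding A using nx(1) by blast
      then show "\<exists>v\<in>?A. \<forall>\<epsilon>\<in>vertices d. dist (v \<epsilon>) (w \<epsilon>) < e"
        by (rule bexI[rotated]) (use nx(2) in simp)
    qed
  qed
  then show ?thesis unfolding Q_def set_eq_iff closure_of_cube_space[OF AK] by simp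
qed

end

context minimal_zflow
begin

lemma minimal_system: "minimal_system (top_of_set K) (a 1)"
  unfolding minimal_system_def
proof (intro conjI ballI)
  show "tds (top_of_set K) (a 1)" by (rule tds)
  fix x assume "x \<in> topspace (top_of_set K)"
  then have x: "x \<in> K" by simp
  have "K \<subseteq> closure (range (\<lambda>n. a n x))"
    using a_dense[OF x] by (force simp: closure_approachable)
  moreover have "range (\<lambda>n. act (top_of_set K) (a 1) n x) = range (\<lambda>n. a n x)" using act_eq[OF x] by simp
  moreover have "range (\<lambda>n. a n x) \<subseteq> K" using a_in[OF x] by blast
  ultimately show "top_of_set K closure_of range (\<lambda>n. act (top_of_set K) (a 1) n x) = topspace (top_of_set K)"
    by (simp add: closure_of_subtopology inf.absorb2 inf.absorb1)
qed

end

section \<open>From an abstract system to a subset of a metric type, and \<open>RP\<close> in terms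
  of \<open>Rel\<close>\<close>

lemma compact_metrizable_embedding:
  assumes "compact_space X" "metrizable_space X"
  obtains g :: "'a \<Rightarrow> nat \<Rightarrow> real"
  where "homeomorphic_map X (top_of_set (g ` topspace X)) g"
proof -
  obtain M dd where M: "Metric_space M dd" and X: "X = Metric_space.mtopology M dd"
    using assms(2) unfolding metrizable_space_def by blast
  interpret Metric_space M dd by (rule M)
  have top: "topspace X = M" by (simp add: X)
  have "mtotally_bounded M"
    using assms(1) by (intro compactin_imp_mtotally_bounded) (simp add: X compact_space_def)
  then have "\<forall>m::nat. \<exists>F. finite F \<and> F \<subseteq> M \<and> M \<subseteq> (\<Union>x\<in>F. mball x (inverse (Suc m)))"
    unfolding mtotally_bounded_def by simp
  from choice[OF this] obtain F where F: "\<And>m. finite (F m)" "\<And>m. F m \<subseteq> M"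
      "\<And>m::nat. M \<subseteq> (\<Union>x\<in>F m. mball x (inverse (Suc m)))" by blast
  define D where "D = (\<Union>m. F m)"
  have D: "countable D" "D \<subseteq> M" unfolding D_def using F(1,2) by (auto simp: countable_finite)
  have dense: "\<exists>z\<in>D. dd z x < e" if "x \<in> M" "e > 0" for x e
  proof -
    obtain m :: nat where m: "inverse (Suc m) < e" using reals_Archimedean[OF \<open>e > 0\<close>] by blast
    obtain z where "z \<in> F m" "dd z x < inverse (Suc m)" using F(3)[of m] \<open>x \<in> M\<close> by auto
    then show ?thesis using m unfolding D_def by (intro bexI[of _ z]) auto
  qed
  \<comment> \<open>The distances to a countable dense set separate points and depend continuously
    on the point; compactness then makes the injection a homeomorphism onto its image.\<close>
  define g where "g x n = dd (from_nat_into D n) x" for x n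
  have DM: "from_nat_into D n \<in> M" if M: "M \<noteq> {}" for n
  proof -
    obtain x where "x \<in> M" using M by blast
    from dense[OF this, of 1] have "D \<noteq> {}" by auto
    then show ?thesis by (intro subsetD[OF D(2)] from_nat_into)
  qed
  have cont: "continuous_map X euclidean g"
  proof -
    have "continuous_map X euclideanreal (\<lambda>x. g x n)" for n
    proof (cases "M = {}")
      case True
      then show ?thesis using top by (simp add: continuous_map_on_empty)
    next
      case False
      have "continuous_map X euclideanreal (dd (from_nat_into D n))"
        using continuous_on_mdist[of "from_nat_into D n" "metric (M, dd)"] DM[OF False]
        by (simp add: X mtopology_of M)
      then show ?thesis by (simp add: g_def)
    qed
    then have "continuous_map X (product_topology (\<lambda>_. euclideanreal) UNIV) g"
      by (simp add: continuous_map_componentwise_UNIV)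
    then show ?thesis by (simp only: euclidean_product_topology)
  qed
  have inj: "inj_on g M"
  proof (rule inj_onI, rule ccontr)
    fix x y assume xy: "x \<in> M" "y \<in> M" "g x = g y" "x \<noteq> y"
    then have pos: "dd x y / 2 > 0" by simp
    obtain z where z: "z \<in> D" "dd z x < dd x y / 2" using dense[OF xy(1) pos] by blast
    obtain n where n: "from_nat_into D n = z" using from_nat_into_surj[OF D(1) z(1)] by blast
    have "dd z x = dd z y" using fun_cong[OF xy(3), of n] by (simp add: g_def n)
    moreover have "dd x y \<le> dd x z + dd z y" using xy z(1) D(2) by (intro triangle) auto
    ultimately show False using z(2) commute[of x z] by simp
  qed
  have "homeomorphic_map X (top_of_set (g ` topspace X)) g"
  proof (rule continuous_imp_homeomorphic_map)
    show "continuous_map X (top_of_set (g ` topspace X)) g"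
      by (rule continuous_map_into_subtopology[OF cont]) auto
    show "Hausdorff_space (top_of_set (g ` topspace X))"
      by (intro Hausdorff_space_subtopology) simp
  qed (use assms(1) inj top in auto)
  then show ?thesis by (rule that)
qed

locale embedded_system =
  fixes X :: "'a topology" and S :: "'a \<Rightarrow> 'a" and K :: "'m::metric_space set"
    and g :: "'a \<Rightarrow> 'm" and g' :: "'m \<Rightarrow> 'a"
  assumes sys: "minimal_system X S" and maps: "homeomorphic_maps X (top_of_set K) g g'"
begin

lemma tds_X: "tds X S" using sys by (simp add: minimal_system_def)

lemma g_K: "x \<in> topspace X \<Longrightarrow> g x \<in> K"
  and g'_X: "y \<in> K \<Longrightarrow> g' y \<in> topspace X"
  and g'_g: "x \<in> topspace X \<Longrightarrow> g' (g x) = x"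
  and g_g': "y \<in> K \<Longrightarrow> g (g' y) = y"
  using maps unfolding homeomorphic_maps_def continuous_map_def by auto

lemma g_cont: "continuous_map X (top_of_set K) g"
  and g'_cont: "continuous_map (top_of_set K) X g'"
  using maps unfolding homeomorphic_maps_def by auto

definition act_K :: "int \<Rightarrow> 'm \<Rightarrow> 'm" where
  "act_K n y = (if y \<in> K then g (act X S n (g' y)) else y)"

lemma act_K_g: "x \<in> topspace X \<Longrightarrow> act_K n (g x) = g (act X S n x)"
  by (simp add: act_K_def g_K g'_g)

lemma g'_act_K: "y \<in> K \<Longrightarrow> g' (act_K n y) = act X S n (g' y)"
  by (simp add: act_K_def g'_g act_step(1)[OF tds_X g'_X])

sublocale minimal_zflow K act_K
proof
  have "compactin (top_of_set K) (g ` topspace X)"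
    by (rule image_compactin[OF _ g_cont]) (use tds_facts(1)[OF tds_X] in \<open>simp add: compact_space_def\<close>)
  moreover have "g ` topspace X = K"
  proof
    show "g ` topspace X \<subseteq> K" using g_K by blast
    show "K \<subseteq> g ` topspace X"
    proof
      fix y assume y: "y \<in> K"
      have "g (g' y) \<in> g ` topspace X" by (intro imageI g'_X y)
      then show "y \<in> g ` topspace X" by (simp add: g_g' y)
    qed
  qed
  ultimately show "compact K" by (simp add: compactin_subtopology)
  show "continuous_on K (act_K n)" for n
  proof -
    have "continuous_map (top_of_set K) (top_of_set K) (g \<circ> (act X S n \<circ> g'))"
      by (intro continuous_map_compose[OF _ g_cont] continuous_map_compose[OF g'_cont] act_continuous tds_X)
    then have "continuous_on K (g \<circ> (act X S n \<circ> g'))"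
      by (simp add: continuous_map_in_subtopology)
    then show ?thesis by (rule continuous_on_eq) (simp add: act_K_def)
  qed
  show "act_K n y \<in> K" if "y \<in> K" for n y
    using that by (simp add: act_K_def g_K act_step(1)[OF tds_X g'_X])
  show "act_K n y = y" if "y \<notin> K" for n y using that by (simp add: act_K_def)
  show "act_K 0 y = y" for y by (simp add: act_K_def g_g')
  show "act_K (m + n) y = act_K m (act_K n y)" for m n y
    by (cases "y \<in> K")
      (simp_all add: act_K_def act_add[OF tds_X g'_X] g_K g'_g act_step(1)[OF tds_X g'_X])
  show "\<exists>n. dist (act_K n x) y < e" if xy: "x \<in> K" "y \<in> K" and e: "0 < e" for x y e
  proof -
    have "X closure_of range (\<lambda>n. act X S n (g' x)) = topspace X"
      using sys g'_X[OF xy(1)] by (simp add: minimal_system_def)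
    then have "g' y \<in> X closure_of range (\<lambda>n. act X S n (g' x))" using g'_X[OF xy(2)] by simp
    then have cl: "\<forall>T. g' y \<in> T \<and> openin X T \<longrightarrow> (\<exists>z. z \<in> range (\<lambda>n. act X S n (g' x)) \<and> z \<in> T)"
      unfolding in_closure_of by (rule conjunct2)
    define W where "W = {z \<in> topspace X. g z \<in> K \<inter> ball y e}"
    have "openin X W"
      unfolding W_def by (rule openin_continuous_map_preimage[OF g_cont]) (simp add: openin_open_Int)
    moreover have "g' y \<in> W" using xy e by (simp add: W_def g'_X g_g')
    ultimately have "\<exists>z. z \<in> range (\<lambda>n. act X S n (g' x)) \<and> z \<in> W" using cl by blast
    then obtain n where "act X S n (g' x) \<in> W" by blast
    then have "g (act X S n (g' x)) \<in> ball y e" by (simp add: W_def)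
    then show ?thesis using xy(1) by (intro exI[of _ n]) (simp add: act_K_def dist_commute)
  qed
qed

lemma limitin_g:
  assumes "limitin X f l F" shows "((\<lambda>i. g (f i)) \<longlongrightarrow> g l) F"
proof -
  have "limitin (top_of_set K) (g \<circ> f) (g l) F" by (rule continuous_map_limit[OF g_cont assms])
  then show ?thesis by (simp add: limitin_subtopology o_def)
qed

lemma limitin_g':
  assumes "(f \<longlongrightarrow> l) F" "l \<in> K" "\<And>i. f i \<in> K" shows "limitin X (\<lambda>i. g' (f i)) (g' l) F"
proof -
  have "limitin (top_of_set K) f l F" using assms by (simp add: limitin_subtopology)
  from continuous_map_limit[OF g'_cont this] show ?thesis by (simp add: o_def)
qed

lemma limitin_cubes_iff:
  "limitin (prod_topology (cube_space X k) (cube_space X k)) (\<lambda>p. (v p, w p)) (v0, w0) F \<longleftrightarrow>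
    limitin (cube_space X k) v v0 F \<and> limitin (cube_space X k) w w0 F"
  by (simp add: limitin_pairwise o_def)

text \<open>The definition gives two nearly agreeing cubes of dimension \<open>k\<close> with base
  points u and v. As the orbit of u is dense, v is nearly a translate of u, so the two together
  approximate a cube of dimension \<open>k + 1\<close>. Its opposite faces agree off their first
  vertices, and \<open>Rel_if_cube\<close> applies.\<close>

lemma RP_imp_Rel:
  assumes "(x, y) \<in> RP X S k" shows "Rel (Suc k) (g x) (g y)"
proof -
  obtain F b where F: "F \<noteq> bot" and ev: "\<forall>\<^sub>F p in F. p \<in> FG k \<times> topspace X \<times> topspace X"
    and lim: "limitin (prod_topology (cube_space X k) (cube_space X k))
          (\<lambda>(f, u, v). (cube_act X S k f (diag k u), cube_act X S k f (diag k v)))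
          (b({} := x), b({} := y)) F"
    and xy: "x \<in> topspace X" "y \<in> topspace X"
    using assms unfolding RP_def by auto
  let ?A = "\<lambda>p. cube_act X S k (fst p) (diag k (fst (snd p)))"
  let ?B = "\<lambda>p. cube_act X S k (fst p) (diag k (snd (snd p)))"
  have lim': "limitin (cube_space X k) ?A (b({} := x)) F" "limitin (cube_space X k) ?B (b({} := y)) F"
  proof -
    have "limitin (prod_topology (cube_space X k) (cube_space X k)) (\<lambda>p. (?A p, ?B p)) (b({} := x), b({} := y)) F"
      using lim by (simp only: case_prod_unfold)
    then show "limitin (cube_space X k) ?A (b({} := x)) F" "limitin (cube_space X k) ?B (b({} := y)) F"
      unfolding limitin_cubes_iff by simp_all
  qed
  \<comment> \<open>The limits of the two families become the opposite faces in the new direction: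
    \<open>x\<close> heads the lower face and \<open>y\<close> the upper one.\<close>
  define q where "q \<epsilon> = (if Suc k \<in> \<epsilon> then g ((b({} := y)) (\<epsilon> - {Suc k})) else g ((b({} := x)) \<epsilon>))" for \<epsilon>
  have "cube (Suc k) q"
    unfolding cube_def
  proof (intro allI impI)
    fix e :: real assume e: "e > 0"
    have evc: "\<forall>\<^sub>F p in F. \<forall>\<epsilon>\<in>vertices k. dist (g (C p \<epsilon>)) (g (c \<epsilon>)) < e / 2"
      if "limitin (cube_space X k) C c F" for C c
    proof (rule eventually_ball_finite[OF finite_vertices], rule ballI)
      fix \<epsilon> assume "\<epsilon> \<in> vertices k"
      then have "limitin X (\<lambda>p. C p \<epsilon>) (c \<epsilon>) F"
        using that unfolding cube_space_def limitin_componentwise by blast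
      from tendstoD[OF limitin_g[OF this] half_gt_zero[OF e]]
      show "\<forall>\<^sub>F p in F. dist (g (C p \<epsilon>)) (g (c \<epsilon>)) < e / 2" .
    qed
    have "\<forall>\<^sub>F p in F. p \<in> FG k \<times> topspace X \<times> topspace X
        \<and> (\<forall>\<epsilon>\<in>vertices k. dist (g (?A p \<epsilon>)) (g ((b({} := x)) \<epsilon>)) < e / 2)
        \<and> (\<forall>\<epsilon>\<in>vertices k. dist (g (?B p \<epsilon>)) (g ((b({} := y)) \<epsilon>)) < e / 2)"
      by (intro eventually_conj ev evc lim')
    then obtain p where p: "p \<in> FG k \<times> topspace X \<times> topspace X"
        "\<forall>\<epsilon>\<in>vertices k. dist (g (?A p \<epsilon>)) (g ((b({} := x)) \<epsilon>)) < e / 2"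
        "\<forall>\<epsilon>\<in>vertices k. dist (g (?B p \<epsilon>)) (g ((b({} := y)) \<epsilon>)) < e / 2"
      using eventually_happens'[OF F] by blast
    obtain n where n: "fst p = aff k 0 n" using p(1) unfolding FG_eq by auto
    define u where "u = g (fst (snd p))"
    define v where "v = g (snd (snd p))"
    have uv: "fst (snd p) \<in> topspace X" "snd (snd p) \<in> topspace X" using p(1) by auto
    have uvK: "u \<in> K" "v \<in> K" using uv by (simp_all add: u_def v_def g_K)
    have gA: "g (?A p \<epsilon>) = act_K (lin n \<epsilon>) u" "g (?B p \<epsilon>) = act_K (lin n \<epsilon>) v"
      if "\<epsilon> \<in> vertices k" for \<epsilon>
      using that uv by (simp_all add: cube_act_def diag_def n aff_def u_def v_def act_K_g)
    obtain \<delta> where \<delta>: "\<delta> > 0" "\<And>\<epsilon> z. \<epsilon> \<in> vertices k \<Longrightarrow> z \<in> K \<Longrightarrow> dist z v < \<delta> \<Longrightarrow>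
        dist (act_K (lin n \<epsilon>) z) (act_K (lin n \<epsilon>) v) < e / 2"
      using a_equicontinuous[OF half_gt_zero[OF e], where d = k and w = "\<lambda>_. v" and f = "lin n"] uvK(2) by blast
    \<comment> \<open>The translate of \<open>u\<close> is taken so near \<open>v\<close> that all
      face translations by \<open>n\<close> keep the error below half of \<open>e\<close>;
      \<open>t\<close> becomes the exponent of the new direction.\<close>
    obtain t where t: "dist (act_K t u) v < \<delta>" using a_dense[OF uvK \<delta>(1)] by blast
    let ?n = "n(Suc k := t)"
    have "dist (act_K (lin ?n \<epsilon>) u) (q \<epsilon>) < e" if \<epsilon>: "\<epsilon> \<in> vertices (Suc k)" for \<epsilon>
    proof (cases "Suc k \<in> \<epsilon>")
      case True
      let ?d = "\<epsilon> - {Suc k}"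
      have d: "?d \<in> vertices k" using \<epsilon> by (auto simp: vertices_def le_Suc_eq)
      have "lin ?n ?d = lin n ?d" by (rule lin_cong) auto
      then have "lin ?n (insert (Suc k) ?d) = t + lin n ?d"
        using lin_insert[OF vertices_finite[OF d], of "Suc k" ?n] by (simp del: insert_Diff_single)
      then have "lin ?n \<epsilon> = lin n ?d + t" using True by (simp add: insert_absorb)
      then have "act_K (lin ?n \<epsilon>) u = act_K (lin n ?d) (act_K t u)" by (simp add: a_add)
      moreover have "dist (act_K (lin n ?d) (act_K t u)) (act_K (lin n ?d) v) < e / 2"
        by (rule \<delta>(2)[OF d a_in[OF uvK(1)] t])
      moreover have "dist (act_K (lin n ?d) v) (q \<epsilon>) < e / 2"
        using bspec[OF p(3) d] True unfolding gA[OF d] by (simp add: q_def)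
      ultimately show ?thesis
        using dist_triangle[of "act_K (lin ?n \<epsilon>) u" "q \<epsilon>" "act_K (lin n ?d) v"] by simp
    next
      case False
      then have d: "\<epsilon> \<in> vertices k" using \<epsilon> by (auto simp: vertices_def le_Suc_eq)
      have "lin ?n \<epsilon> = lin n \<epsilon>" by (rule lin_cong) (use False in auto)
      moreover have "dist (act_K (lin n \<epsilon>) u) (q \<epsilon>) < e / 2"
        using bspec[OF p(2) d] False unfolding gA[OF d] by (simp add: q_def)
      ultimately show ?thesis using e by simp
    qed
    then show "\<exists>n. \<exists>x\<in>K. \<forall>\<epsilon>\<in>vertices (Suc k). dist (act_K (lin n \<epsilon>) x) (q \<epsilon>) < e"
      using uvK(1) by blast
  qed
  then have "Rel (Suc k) (q {}) (q {Suc k})"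
    by (rule Rel_if_cube) (auto simp: q_def vertices_def)
  then show ?thesis by (simp add: q_def)
qed

text \<open>The cube with \<open>x\<close> at \<open>{}\<close> and \<open>y\<close> elsewhere is
  cut into its two faces in the last direction. The base points of the upper face are those of the
  lower one, moved by the last exponent, and the common limit point off \<open>{}\<close> is
  constantly \<open>y\<close>. The required filter is the image of the sequence.\<close>

lemma Rel_imp_RP:
  assumes "Rel (Suc k) (g x) (g y)" and xy: "x \<in> topspace X" "y \<in> topspace X"
  shows "(x, y) \<in> RP X S k"
proof -
  let ?w = "\<lambda>\<epsilon>. if \<epsilon> = {} then g x else g y"
  have c: "cube (Suc k) ?w" using assms(1) by (simp add: Rel_def)
  have dense: "\<exists>z\<in>K. dist z y < r" if "y \<in> K" "r > 0" for y r
    using that by (intro bexI[of _ y]) simp_all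
  obtain N z where z: "\<forall>i::nat. z i \<in> K"
      "\<forall>\<epsilon>\<in>vertices (Suc k). (\<lambda>i. act_K (lin (N i) \<epsilon>) (z i)) \<longlonglongrightarrow> ?w \<epsilon>"
    by (rule cube_sequence[OF c subset_refl dense])
  define u where "u i = g' (z i)" for i
  define v where "v i = g' (act_K (N i (Suc k)) (z i))" for i
  define f where "f i = aff k 0 (N i)" for i
  define b where "b = (\<lambda>\<epsilon>\<in>vertices k - {{}}. y)"
  have zK: "z i \<in> K" for i using z(1) by blast
  have A: "limitin (cube_space X k) (\<lambda>i. cube_act X S k (f i) (diag k (g' (t i)))) (b({} := c)) sequentially"
    if t: "\<And>i. t i \<in> K" and lim: "\<And>\<epsilon>. \<epsilon> \<in> vertices k \<Longrightarrow>
        (\<lambda>i. act_K (lin (N i) \<epsilon>) (t i)) \<longlonglongrightarrow> (if \<epsilon> = {} then g c else g y)" and c: "c \<in> topspace X" for t c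
    unfolding cube_space_def limitin_componentwise
  proof (intro conjI ballI)
    show "b({} := c) \<in> extensional (vertices k)" by (auto simp: b_def extensional_def)
    show "\<forall>\<^sub>F i in sequentially. cube_act X S k (f i) (diag k (g' (t i))) \<in> topspace (product_topology (\<lambda>_. X) (vertices k))"
      using act_step(1)[OF tds_X g'_X[OF t]] by (intro always_eventually) (auto simp: cube_act_def diag_def)
    fix \<epsilon> assume \<epsilon>: "\<epsilon> \<in> vertices k"
    have "limitin X (\<lambda>i. g' (act_K (lin (N i) \<epsilon>) (t i))) (g' (if \<epsilon> = {} then g c else g y)) sequentially"
      by (rule limitin_g'[OF lim[OF \<epsilon>]]) (use xy c t a_in g_K in auto)
    moreover have "g' (if \<epsilon> = {} then g c else g y) = (b({} := c)) \<epsilon>"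
      using \<epsilon> xy c by (simp add: b_def g'_g)
    moreover have "cube_act X S k (f i) (diag k (g' (t i))) \<epsilon> = g' (act_K (lin (N i) \<epsilon>) (t i))" for i
      using \<epsilon> by (simp add: cube_act_def diag_def f_def aff_def g'_act_K t)
    ultimately show "limitin X (\<lambda>i. cube_act X S k (f i) (diag k (g' (t i))) \<epsilon>) ((b({} := c)) \<epsilon>) sequentially"
      by simp
  qed
  have V1: "vertices k \<subseteq> vertices (Suc k)" by (auto simp: vertices_def)
  have Au: "limitin (cube_space X k) (\<lambda>i. cube_act X S k (f i) (diag k (u i))) (b({} := x)) sequentially"
    unfolding u_def by (rule A[OF zK bspec[OF z(2) subsetD[OF V1]] xy(1)])
  have Av: "limitin (cube_space X k) (\<lambda>i. cube_act X S k (f i) (diag k (v i))) (b({} := y)) sequentially"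
    unfolding v_def
  proof (rule A)
    show "act_K (N i (Suc k)) (z i) \<in> K" for i by (rule a_in[OF zK])
    fix \<epsilon> assume \<epsilon>: "\<epsilon> \<in> vertices k"
    have "Suc k \<notin> \<epsilon>" "insert (Suc k) \<epsilon> \<in> vertices (Suc k)" using \<epsilon> by (auto simp: vertices_def)
    then have "lin (N i) (insert (Suc k) \<epsilon>) = lin (N i) \<epsilon> + N i (Suc k)" for i
      using vertices_finite[OF \<epsilon>] by (simp add: lin_insert)
    then show "(\<lambda>i. act_K (lin (N i) \<epsilon>) (act_K (N i (Suc k)) (z i))) \<longlonglongrightarrow> (if \<epsilon> = {} then g y else g y)"
      using bspec[OF z(2) \<open>insert (Suc k) \<epsilon> \<in> vertices (Suc k)\<close>] by (simp add: a_add)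
  qed (rule xy(2))
  let ?p = "\<lambda>i. (f i, u i, v i)"
  let ?h = "\<lambda>(f, u, v). (cube_act X S k f (diag k u), cube_act X S k f (diag k v))"
  have "limitin (prod_topology (cube_space X k) (cube_space X k)) (?h \<circ> ?p) (b({} := x), b({} := y)) sequentially"
    using Au Av by (simp add: limitin_pairwise o_def)
  then have "limitin (prod_topology (cube_space X k) (cube_space X k)) ?h (b({} := x), b({} := y)) (filtermap ?p sequentially)"
    unfolding limitin_def eventually_filtermap o_def .
  moreover have "filtermap ?p sequentially \<noteq> bot" by (simp add: filtermap_bot_iff)
  moreover have "\<forall>\<^sub>F p in filtermap ?p sequentially. p \<in> FG k \<times> topspace X \<times> topspace X"
    unfolding eventually_filtermap
  proof (rule always_eventually, rule allI)
    fix i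
    have "f i \<in> FG k" unfolding f_def FG_eq by blast
    then show "?p i \<in> FG k \<times> topspace X \<times> topspace X" using zK a_in by (simp add: u_def v_def g'_X)
  qed
  moreover have "b \<in> topspace (product_topology (\<lambda>_. X) (vertices k - {{}}))" using xy by (simp add: b_def)
  ultimately show ?thesis using xy unfolding RP_def by blast
qed

lemma RP_iff: "(x, y) \<in> RP X S k \<longleftrightarrow> x \<in> topspace X \<and> y \<in> topspace X \<and> Rel (Suc k) (g x) (g y)"
  using RP_imp_Rel Rel_imp_RP unfolding RP_def by blast

end

section \<open>Residual sets for the two almost one-to-one extensions\<close>

context odiagram
begin

lemma openin_X'_preimage:
  assumes "sat_open V" shows "openin (top_of_set X') {w \<in> X'. prX w \<in> V}"
proof -
  have "continuous_map (top_of_set X') (top_of_set K) prX"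
    using continuous_on_prX prX_X' by (simp add: continuous_map_in_subtopology image_subset_iff_funcset)
  from openin_continuous_map_preimage[OF this, of V] show ?thesis
    using assms by (simp add: sat_open_def)
qed

lemma prX_sat_open:
  assumes "sat_open V" "w \<in> X'" "w' \<in> X'" "prY w = prY w'" "prX w \<in> V"
  shows "prX w' \<in> V"
  using Rel_if_prY_eq[OF assms(2-4)] assms(1,5) unfolding sat_open_def cls_def by blast

text \<open>The preimage of a saturated set is a union of fibres of \<open>prY\<close>, so the image
  of its complement is the complement of its image; the former is compact.\<close>

lemma openin_Y'_image:
  assumes V: "sat_open V" shows "openin (top_of_set Y') (prY ` {w \<in> X'. prX w \<in> V})"
proof -
  have "closedin (top_of_set X') (X' - {w \<in> X'. prX w \<in> V})"
    using openin_X'_preimage[OF V] by (simp add: closedin_diff)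
  then have "compact (X' - {w \<in> X'. prX w \<in> V})" using compact_X' closedin_compact by blast
  then have "compact (prY ` (X' - {w \<in> X'. prX w \<in> V}))"
    by (rule compact_continuous_image[OF continuous_on_prY])
  then have "closedin (top_of_set Y') (prY ` (X' - {w \<in> X'. prX w \<in> V}))"
    by (intro closed_subset compact_imp_closed) (auto simp: Y'_def)
  then have "openin (top_of_set Y') (Y' - prY ` (X' - {w \<in> X'. prX w \<in> V}))"
    by (simp add: openin_diff)
  moreover have "Y' - prY ` (X' - {w \<in> X'. prX w \<in> V}) = prY ` {w \<in> X'. prX w \<in> V}"
    using prX_sat_open[OF V] unfolding Y'_def by auto
  ultimately show ?thesis by simp
qed

definition X0 where "X0 = {w \<in> X'. prX w \<in> Xc}"
definition Y0 where "Y0 = prY ` X0"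

abbreviation idx :: "(nat \<times> real \<times> int) set" where "idx \<equiv> UNIV \<times> \<rat> \<times> UNIV"

lemma countable_idx: "countable idx" by (intro countable_SIGMA countable_rat) auto

lemma idx_nonempty: "idx \<noteq> {}" using Rats_0 by blast

lemma gdelta_X0: "gdelta_in (top_of_set X') X0"
proof -
  have "X0 = \<Inter>((\<lambda>i. {w \<in> X'. prX w \<in> Oq (fst i) (fst (snd i)) (snd (snd i))}) ` idx)"
  proof
    show "X0 \<subseteq> \<Inter>((\<lambda>i. {w \<in> X'. prX w \<in> Oq (fst i) (fst (snd i)) (snd (snd i))}) ` idx)"
      by (auto simp: X0_def Xc_def)
    show "\<Inter>((\<lambda>i. {w \<in> X'. prX w \<in> Oq (fst i) (fst (snd i)) (snd (snd i))}) ` idx) \<subseteq> X0"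
    proof
      fix w assume w: "w \<in> \<Inter>((\<lambda>i. {w \<in> X'. prX w \<in> Oq (fst i) (fst (snd i)) (snd (snd i))}) ` idx)"
      have *: "w \<in> X' \<and> prX w \<in> Oq n q s" if "q \<in> \<rat>" for n q s
        using INT_D[OF w, of "(n, q, s)"] that by simp
      have "w \<in> X'" using * Rats_0 by blast
      then show "w \<in> X0" using * prX_X' unfolding X0_def Xc_def by blast
    qed
  qed
  moreover have "gdelta_in (top_of_set X') \<dots>"
    by (rule gdelta_in_Inter)
      (use countable_idx idx_nonempty sat_open_Oq openin_X'_preimage in \<open>auto intro!: open_imp_gdelta_in\<close>)
  ultimately show ?thesis by simp
qed

lemma gdelta_Y0: "gdelta_in (top_of_set Y') Y0"
proof -
  let ?W = "\<lambda>i. prY ` {w \<in> X'. prX w \<in> Oq (fst i) (fst (snd i)) (snd (snd i))}"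
  have "Y0 = \<Inter>(?W ` idx)"
  proof
    show "Y0 \<subseteq> \<Inter>(?W ` idx)" by (auto simp: Y0_def X0_def Xc_def)
    show "\<Inter>(?W ` idx) \<subseteq> Y0"
    proof
      fix h assume h: "h \<in> \<Inter>(?W ` idx)"
      have *: "h \<in> prY ` {w \<in> X'. prX w \<in> Oq n q s}" if "q \<in> \<rat>" for n q s
        using INT_D[OF h, of "(n, q, s)"] that by simp
      obtain w where w: "w \<in> X'" "h = prY w" using *[OF Rats_0] by blast
      \<comment> \<open>For each index there may be a different preimage \<open>w'\<close> of
        \<open>h\<close>. Saturation carries the condition over to the single preimage
        \<open>w\<close>, so here the image of the intersection is the intersection of the
        images.\<close>
      have "prX w \<in> Oq n q s" if q: "q \<in> \<rat>" for n q s
      proof -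
        obtain w' where w': "w' \<in> X'" "prX w' \<in> Oq n q s" "h = prY w'" using *[OF q] by blast
        show ?thesis by (rule prX_sat_open[OF sat_open_Oq w'(1) w(1) _ w'(2)]) (simp flip: w(2) w'(3))
      qed
      then show "h \<in> Y0" using w prX_X' unfolding Y0_def X0_def Xc_def by blast
    qed
  qed
  moreover have "gdelta_in (top_of_set Y') \<dots>"
    by (rule gdelta_in_Inter)
      (use countable_idx idx_nonempty sat_open_Oq openin_Y'_image in \<open>auto intro!: open_imp_gdelta_in\<close>)
  ultimately show ?thesis by simp
qed

lemma X0_dense: "top_of_set X' closure_of X0 = X'"
proof -
  have "(\<lambda>x. pt x (H x)) ` Xc \<subseteq> X0" using pt_in_X' by (auto simp: X0_def)
  then have "X' \<subseteq> closure X0" unfolding X'_def by (rule closure_mono)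
  moreover have "X0 \<subseteq> X'" by (auto simp: X0_def)
  ultimately show ?thesis by (simp add: closure_of_subtopology Int_absorb1 Int_absorb2)
qed

lemma Y0_dense: "top_of_set Y' closure_of Y0 = Y'"
proof -
  have HY: "H x \<in> Y0" if "x \<in> Xc" for x
    unfolding Y0_def X0_def using that pt_in_X'[OF that] by (intro rev_image_eqI[of "pt x (H x)"]) simp_all
  have "Y' \<subseteq> closure Y0"
    unfolding closure_approachable subset_iff using Y'_dense HY by blast
  moreover have "Y0 \<subseteq> Y'" by (auto simp: Y0_def X0_def Y'_def)
  ultimately show ?thesis by (simp add: closure_of_subtopology Int_absorb1 Int_absorb2)
qed

lemma prX_surj: "prX ` X' = K"
proof
  show "prX ` X' \<subseteq> K" using prX_X' by blast
  have "closed (prX ` X')"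
    by (intro compact_imp_closed compact_continuous_image continuous_on_prX compact_X')
  moreover have "y \<in> closure (prX ` X')" if y: "y \<in> K" for y
    unfolding closure_approachable
  proof (intro allI impI)
    fix r :: real assume "r > 0"
    then obtain x where x: "x \<in> Xc" "dist x y < r" using Xc_dense[OF y] by blast
    then show "\<exists>z\<in>prX ` X'. dist z y < r" by (intro bexI[of _ x] rev_image_eqI[OF pt_in_X'[OF x(1)]]) simp_all
  qed
  ultimately show "K \<subseteq> prX ` X'" by (simp add: subset_iff)
qed

lemma X0_unique:
  assumes "w \<in> X'" "prX w \<in> Xc" "z \<in> X'" "prX z = prX w" shows "z = w"
proof -
  have "prX z \<in> Xc" unfolding assms(4) by (rule assms(2))
  then have "prY z = H (prX w)" using prY_over_Xc[OF assms(3)] unfolding assms(4) by blast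
  then have "prY z = prY w" unfolding prY_over_Xc[OF assms(1,2)] .
  then have "pt (prX z) (prY z) = pt (prX w) (prY w)" by (simp only: assms(4))
  then show ?thesis by (simp only: pt_pr)
qed

lemma Y0_unique:
  assumes "w \<in> X'" "prX w \<in> Xc" "z \<in> X'" "Rel d (prX w) (prX z)" shows "prY z = prY w"
  unfolding prY_over_Xc[OF assms(1,2)] prY_over_Xc[OF assms(3) Xc_Rel[OF assms(2,4)]]
  by (rule H_cong[OF assms(4), symmetric])

theorem Q_saturated:
  "Q (top_of_set X') (aX 1) d = {w \<in> topspace (cube_space (top_of_set X') d). cube_map d prY w \<in> Q (top_of_set Y') (aY 1) d}"
proof -
  have "X.cube d w \<longleftrightarrow> cube_map d prY w \<in> vertices d \<rightarrow>\<^sub>E Y' \<and> Y.cube d (cube_map d prY w)"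
    if w: "w \<in> vertices d \<rightarrow>\<^sub>E X'" for w
  proof
    assume "X.cube d w"
    then have "Y.cube d (cube_map d prY w)"
      by (rule Y.cube_cong[OF cube_Y'_if_cube_X']) (simp add: cube_map_def)
    moreover have "cube_map d prY w \<in> vertices d \<rightarrow>\<^sub>E Y'" using w by (auto simp: cube_map_def Y'_def)
    ultimately show "cube_map d prY w \<in> vertices d \<rightarrow>\<^sub>E Y' \<and> Y.cube d (cube_map d prY w)" by blast
  next
    assume "cube_map d prY w \<in> vertices d \<rightarrow>\<^sub>E Y' \<and> Y.cube d (cube_map d prY w)"
    then have "Y.cube d (cube_map d prY w)" by blast
    then have "Y.cube d (\<lambda>\<epsilon>. prY (w \<epsilon>))" by (rule Y.cube_cong) (simp add: cube_map_def)
    then show "X.cube d w" by (rule cube_X'_if_cube_Y'[rotated]) (use w in auto)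
  qed
  then show ?thesis
    unfolding X.Q_eq_cube[of d, simplified] Y.Q_eq_cube[of d, simplified]
    by (auto simp: cube_space_def)
qed

end

section \<open>Assembly over the original system\<close>

lemma saturated_extension:
  fixes K :: "(nat \<Rightarrow> real) set"
  assumes emb: "embedded_system X S K g g'" and od: "odiagram K (embedded_system.act_K X S K g g') e"
  shows "\<exists>(X' :: (nat \<Rightarrow> real) topology) S' (Y' :: (nat \<Rightarrow> real) topology) R' \<theta>' \<pi>' \<theta>.
    minimal_system X' S' \<and> minimal_system Y' R' \<and>
    extension X' S' X S \<theta>' \<and>
    extension X' S' Y' R' \<pi>' \<and>
    extension Y' R' (max_factor X S k) (max_factor_homeo S) \<theta> \<and>
    (\<forall>x \<in> topspace X'. max_factor_proj X S k (\<theta>' x) = \<theta> (\<pi>' x)) \<and>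
    almost_one_to_one Y' \<theta> \<and> almost_one_to_one X' \<theta>' \<and>
    Q X' S' (Suc k) = {w \<in> topspace (cube_space X' (Suc k)). cube_map (Suc k) \<pi>' w \<in> Q Y' R' (Suc k)}"
proof -
  interpret embedded_system X S K g g' by (rule emb)
  interpret od: odiagram K act_K k e by (rule od)
  let ?X = "top_of_set od.X'" and ?Y = "top_of_set od.Y'"
  let ?P = "\<lambda>x. RP X S k `` {x}"
  define \<theta>' where "\<theta>' w = g' (prX w)" for w
  \<comment> \<open>A preimage under \<open>prY\<close> is chosen arbitrarily;
    \<open>\<theta>_prY\<close> shows by \<open>Rel_if_prY_eq\<close> that the class does not depend
    on the choice.\<close>
  define \<theta> where "\<theta> h = ?P (\<theta>' (SOME w. w \<in> od.X' \<and> prY w = h))" for h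
  have P_eq: "?P x = {y \<in> topspace X. Rel (Suc k) (g x) (g y)}" if "x \<in> topspace X" for x
    using that RP_iff by auto
  have P_iff: "?P x = ?P y \<longleftrightarrow> Rel (Suc k) (g x) (g y)" if "x \<in> topspace X" "y \<in> topspace X" for x y
  proof
    assume eq: "?P x = ?P y"
    have "y \<in> ?P y" using that Rel_refl[OF g_K] by (simp add: P_eq)
    then show "Rel (Suc k) (g x) (g y)" unfolding eq[symmetric] using that by (simp add: P_eq)
  next
    assume R: "Rel (Suc k) (g x) (g y)"
    then show "?P x = ?P y" unfolding P_eq[OF that(1)] P_eq[OF that(2)]
      using Rel_trans Rel_sym by blast
  qed
  have \<theta>'_X: "\<theta>' w \<in> topspace X" if "w \<in> od.X'" for w
    using that by (simp add: \<theta>'_def g'_X od.prX_X')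
  have g_\<theta>': "g (\<theta>' w) = prX w" if "w \<in> od.X'" for w
    using that by (simp add: \<theta>'_def g_g' od.prX_X')
  have \<theta>_prY: "\<theta> (prY w) = ?P (\<theta>' w)" if w: "w \<in> od.X'" for w
  proof -
    define v where "v = (SOME v. v \<in> od.X' \<and> prY v = prY w)"
    have "v \<in> od.X' \<and> prY v = prY w" unfolding v_def by (rule someI[of _ w]) (use w in simp)
    then have v: "v \<in> od.X'" "prY v = prY w" by blast+
    have "?P (\<theta>' v) = ?P (\<theta>' w)"
      unfolding P_iff[OF \<theta>'_X[OF v(1)] \<theta>'_X[OF w]] g_\<theta>'[OF v(1)] g_\<theta>'[OF w]
      by (rule od.Rel_if_prY_eq[OF v(1) w v(2)])
    then show ?thesis by (simp add: \<theta>_def v_def)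
  qed
  have proj: "quotient_map X (max_factor X S k) ?P"
    unfolding max_factor_def by (rule quotient_map_quotient_space)
  have cont_prY: "continuous_map ?X ?Y prY"
    using continuous_on_prY by (simp add: continuous_map_in_subtopology od.Y'_def)
  have surj_prY: "prY ` od.X' = od.Y'" by (simp add: od.Y'_def)
  have cont_\<theta>': "continuous_map ?X X \<theta>'"
  proof -
    have "continuous_map ?X (top_of_set K) prX"
      using continuous_on_prX od.prX_X' by (simp add: continuous_map_in_subtopology image_subset_iff_funcset)
    from continuous_map_compose[OF this g'_cont] have "continuous_map ?X X (g' \<circ> prX)" .
    moreover have "g' \<circ> prX = \<theta>'" by (simp add: \<theta>'_def fun_eq_iff)
    ultimately show ?thesis by simp
  qed
  have surj_\<theta>': "\<theta>' ` od.X' = topspace X"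
  proof
    show "\<theta>' ` od.X' \<subseteq> topspace X" using \<theta>'_X by blast
    show "topspace X \<subseteq> \<theta>' ` od.X'"
    proof
      fix x assume x: "x \<in> topspace X"
      then have "g x \<in> prX ` od.X'" unfolding od.prX_surj by (rule g_K)
      then obtain w where w: "g x = prX w" "w \<in> od.X'" by (rule imageE)
      have "\<theta>' w = x" using g'_g[OF x] w(1) by (simp add: \<theta>'_def)
      then show "x \<in> \<theta>' ` od.X'" using w(2) by blast
    qed
  qed
  have eq_\<theta>': "\<theta>' (od.aX n w) = act X S n (\<theta>' w)" if "w \<in> od.X'" for n w
    using that by (simp add: \<theta>'_def od.prX_aX g'_act_K od.prX_X')
  have 1: "extension ?X (od.aX 1) X S \<theta>'"
    unfolding extension_def using cont_\<theta>' surj_\<theta>' eq_\<theta>'[of _ 1] by simp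
  have 2: "extension ?X (od.aX 1) ?Y (od.aY 1) prY"
    unfolding extension_def using cont_prY surj_prY od.prY_aX by simp
  have S_P: "?P (S x) = S ` ?P x" if x: "x \<in> topspace X" for x
  proof -
    have gS: "g (S y) = act_K 1 (g y)" if "y \<in> topspace X" for y using act_K_g[OF that, of 1] by simp
    have Sx: "S y \<in> topspace X" if "y \<in> topspace X" for y
      using tds_facts(5)[OF tds_X] that by blast
    have R: "Rel (Suc k) (g (S x)) (g (S y)) \<longleftrightarrow> Rel (Suc k) (g x) (g y)" if y: "y \<in> topspace X" for y
    proof
      assume "Rel (Suc k) (g (S x)) (g (S y))"
      from Rel_translate[OF this, of "- 1"] show "Rel (Suc k) (g x) (g y)"
        by (simp add: gS x y a_inverse)
    next
      assume "Rel (Suc k) (g x) (g y)"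
      from Rel_translate[OF this, of 1] show "Rel (Suc k) (g (S x)) (g (S y))" by (simp add: gS x y)
    qed
    show ?thesis
    proof
      show "S ` ?P x \<subseteq> ?P (S x)" unfolding P_eq[OF x] P_eq[OF Sx[OF x]] using R Sx by blast
      show "?P (S x) \<subseteq> S ` ?P x"
      proof
        fix z assume "z \<in> ?P (S x)"
        then have z: "z \<in> topspace X" "Rel (Suc k) (g (S x)) (g z)" unfolding P_eq[OF Sx[OF x]] by blast+
        then obtain y where y: "z = S y" "y \<in> topspace X" using tds_facts(5)[OF tds_X] by blast
        then have "y \<in> ?P x" unfolding P_eq[OF x] using z R by blast
        then show "z \<in> S ` ?P x" using y(1) by blast
      qed
    qed
  qed
  have 3: "extension ?Y (od.aY 1) (max_factor X S k) (max_factor_homeo S) \<theta>"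
    unfolding extension_def
  proof (intro conjI ballI)
    \<comment> \<open>As \<open>prY\<close> is a continuous surjection from a compact onto a
      Hausdorff space, it is a quotient map. Continuity of \<theta> is thus reduced to that of its
      composition with \<open>prY\<close>, in which the choice has disappeared.\<close>
    have "quotient_map ?X ?Y prY"
    proof (rule continuous_closed_imp_quotient_map[OF cont_prY])
      show "closed_map ?X ?Y prY"
        by (rule continuous_imp_closed_map[OF cont_prY])
          (simp_all add: compact_space_subtopology od.compact_X' Hausdorff_space_subtopology)
      show "prY ` topspace ?X = topspace ?Y" using surj_prY by simp
    qed
    moreover have "continuous_map ?X (max_factor X S k) (\<theta> \<circ> prY)"
    proof (rule continuous_map_eq)
      show "continuous_map ?X (max_factor X S k) (?P \<circ> \<theta>')"
        by (rule continuous_map_compose[OF cont_\<theta>' quotient_imp_continuous_map[OF proj]])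
    qed (simp add: \<theta>_prY)
    ultimately show "continuous_map ?Y (max_factor X S k) \<theta>" by (rule continuous_compose_quotient_map)
    have "\<theta> ` prY ` od.X' = ?P ` \<theta>' ` od.X'" unfolding image_image by (rule image_cong) (simp_all add: \<theta>_prY)
    then show "\<theta> ` topspace ?Y = topspace (max_factor X S k)"
      using surj_prY surj_\<theta>' quotient_imp_surjective_map[OF proj] by simp
    fix h assume "h \<in> topspace ?Y"
    then obtain w where w: "w \<in> od.X'" "h = prY w" using surj_prY by auto
    have "\<theta> (od.aY 1 h) = ?P (\<theta>' (od.aX 1 w))"
      unfolding w(2) od.prY_aX[OF w(1), symmetric] by (rule \<theta>_prY[OF od.aX_in[OF w(1)]])
    also have "\<dots> = S ` ?P (\<theta>' w)" using eq_\<theta>'[OF w(1), of 1] S_P[OF \<theta>'_X[OF w(1)]] by simp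
    also have "\<dots> = max_factor_homeo S (\<theta> h)" unfolding max_factor_homeo_def w(2) \<theta>_prY[OF w(1)] ..
    finally show "\<theta> (od.aY 1 h) = max_factor_homeo S (\<theta> h)" .
  qed
  have 4: "almost_one_to_one ?X \<theta>'"
    unfolding almost_one_to_one_def
  proof (intro exI[of _ od.X0] conjI ballI)
    show "gdelta_in ?X od.X0" by (rule od.gdelta_X0)
    show "?X closure_of od.X0 = topspace ?X" using od.X0_dense by simp
    fix w assume "w \<in> od.X0"
    then have w: "w \<in> od.X'" "prX w \<in> od.Xc" by (auto simp: od.X0_def)
    have "z = w" if "z \<in> od.X'" "\<theta>' z = \<theta>' w" for z
      by (rule od.X0_unique[OF w that(1)]) (use that g_\<theta>' w(1) in metis)
    then show "{z \<in> topspace ?X. \<theta>' z = \<theta>' w} = {w}" using w(1) by auto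
  qed
  have 5: "almost_one_to_one ?Y \<theta>"
    unfolding almost_one_to_one_def
  proof (intro exI[of _ od.Y0] conjI ballI)
    show "gdelta_in ?Y od.Y0" by (rule od.gdelta_Y0)
    show "?Y closure_of od.Y0 = topspace ?Y" using od.Y0_dense by simp
    fix h assume "h \<in> od.Y0"
    then obtain w where w: "w \<in> od.X'" "prX w \<in> od.Xc" "h = prY w" by (auto simp: od.Y0_def od.X0_def)
    have "z = h" if z: "z \<in> od.Y'" "\<theta> z = \<theta> h" for z
    proof -
      obtain v where v: "v \<in> od.X'" "z = prY v" using z(1) surj_prY by blast
      have "?P (\<theta>' w) = ?P (\<theta>' v)" using z(2) by (simp add: v w \<theta>_prY)
      then have "Rel (Suc k) (prX w) (prX v)"
        unfolding P_iff[OF \<theta>'_X[OF w(1)] \<theta>'_X[OF v(1)]] g_\<theta>'[OF v(1)] g_\<theta>'[OF w(1)] .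
      then show ?thesis unfolding v(2) w(3) by (rule od.Y0_unique[OF w(1,2) v(1)])
    qed
    moreover have "h \<in> od.Y'" using w surj_prY by blast
    ultimately show "{z \<in> topspace ?Y. \<theta> z = \<theta> h} = {h}" by auto
  qed
  have 6: "\<forall>x\<in>topspace ?X. max_factor_proj X S k (\<theta>' x) = \<theta> (prY x)"
    by (simp add: max_factor_proj_def \<theta>_prY)
  show ?thesis
    by (intro exI conjI; fact od.X.minimal_system od.Y.minimal_system 1 2 3 6 5 4 od.Q_saturated)
qed

(* Every compact metrizable space is homeomorphic to a subspace of nat => real, so taking
   the points of X' and Y' (the latter being X'_{d-1}) in that type is no restriction. *)
theorem theorem5p18:
  fixes X :: "'a topology" and S :: "'a \<Rightarrow> 'a" and d :: nat
  assumes "minimal_system X S" and "d \<ge> 2"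
  shows "\<exists>(X' :: (nat \<Rightarrow> real) topology) S' (Y' :: (nat \<Rightarrow> real) topology) R' \<theta>' \<pi>' \<theta>.
    minimal_system X' S' \<and> minimal_system Y' R' \<and>
    extension X' S' X S \<theta>' \<and>
    extension X' S' Y' R' \<pi>' \<and>
    extension Y' R' (max_factor X S (d - 1)) (max_factor_homeo S) \<theta> \<and>
    (\<forall>x \<in> topspace X'. max_factor_proj X S (d - 1) (\<theta>' x) = \<theta> (\<pi>' x)) \<and>
    almost_one_to_one Y' \<theta> \<and> almost_one_to_one X' \<theta>' \<and>
    Q X' S' d = {w \<in> topspace (cube_space X' d). cube_map d \<pi>' w \<in> Q Y' R' d}"
proof -
  have tds: "tds X S" using assms(1) by (simp add: minimal_system_def)
  obtain g :: "'a \<Rightarrow> nat \<Rightarrow> real" where g: "homeomorphic_map X (top_of_set (g ` topspace X)) g"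
    using compact_metrizable_embedding[OF tds_facts(1,2)[OF tds]] by blast
  then obtain g' where g': "homeomorphic_maps X (top_of_set (g ` topspace X)) g g'"
    unfolding homeomorphic_map_maps by blast
  have emb: "embedded_system X S (g ` topspace X) g g'" using assms(1) g' by (rule embedded_system.intro)
  obtain D :: "(nat \<Rightarrow> real) set" where D: "countable D" "\<And>U. open U \<Longrightarrow> U \<noteq> {} \<Longrightarrow> \<exists>y\<in>D. y \<in> U"
    using countable_dense_exists by metis
  have dense: "\<exists>n. dist (from_nat_into D n) x < r" if "0 < r" for x r
  proof -
    have "ball x r \<noteq> {}" using that by simp
    then obtain y where y: "y \<in> D" "y \<in> ball x r" using D(2) by blast
    then show ?thesis using from_nat_into_surj[OF D(1) y(1)] by (auto simp: dist_commute)
  qed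
  have "odiagram (g ` topspace X) (embedded_system.act_K X S (g ` topspace X) g g') (from_nat_into D)"
  proof (intro odiagram.intro odiagram_axioms.intro)
    interpret embedded_system X S "g ` topspace X" g g' by (rule emb)
    show "minimal_zflow (g ` topspace X) act_K" by unfold_locales
  qed (rule dense)
  from saturated_extension[OF emb this, of "d - 1"] show ?thesis using assms(2) by simp
qed

end
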